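(* Let $T>0$, $\varepsilon>0$, $m\in(\frac d{d+2},1)$, and let $V(x)=c\langle x\rangle^{-2\alpha}$ with $\alpha>\frac d2+\frac1m$. Suppose $\rho_0\in\mathcal P_2(\mathbb R^d)$ satisfies $\mathcal U^m[\rho_0]<+\infty$. Then there exists a distributional solution $\rho^\varepsilon\in C([0,T];\mathcal P_2(\mathbb R^d))$ of $$\partial_t\rho=-\frac m{1-m}\,\mathrm{div}\big(\rho\,\nabla V_\varepsilon*(V_\varepsilon*\rho)^{m-1}\big)$$ with $\rho^\varepsilon(0)=\rho_0$; that is, $\rho^\varepsilon$ is an absolutely continuous curve $[0,T]\to\mathcal P_2(\mathbb R^d)$ such that for every $\varphi\in C^1_c(\mathbb R^d)$ and every $t\in[0,T]$, $$\int\varphi\,d\rho^\varepsilon_t-\int\varphi\,d\rho_0=\frac m{1-m}\int_0^t\int_{\mathbb R^d}\nabla\varphi(x)\cdot\nabla V_\varepsilon*(V_\varepsilon*\rho^\varepsilon_s)^{m-1}(x)\,d\rho^\varepsilon_s(x)\,ds.$$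
   Context: $\mathcal P_2(\mathbb R^d)$: Borel probability measures on $\mathbb R^d$ with finite second moment, with the 2-Wasserstein distance. $\langle x\rangle:=\sqrt{1+|x|^2}$; $c=1/\int_{\mathbb R^d}(1+|x|^2)^{-\alpha}dx$; $V_\varepsilon(x):=\varepsilon^{-d}V(x/\varepsilon)$. For $\mu=\rho\mathcal L^d+\mu_s$ with $\mu_s\perp\mathcal L^d$ ($\mathcal L^d$ the Lebesgue measure), $\mathcal U^m[\mu]:=-\frac1{1-m}\int_{\mathbb R^d}\rho(x)^m\,dx$. *)

theory Defs
  imports "HOL-Probability.Probability"
begin

definition P2 :: "'a::euclidean_space measure set" where
  "P2 = {\<mu>. prob_space \<mu> \<and> sets \<mu> = sets borel \<and> (\<integral>\<^sup>+ x. ennreal ((norm x)\<^sup>2) \<partial>\<mu>) < \<infinity>}"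

definition couplings :: "'a::euclidean_space measure \<Rightarrow> 'a measure \<Rightarrow> ('a \<times> 'a) measure set" where
  "couplings \<mu> \<nu> = {\<gamma>. sets \<gamma> = sets borel \<and> distr \<gamma> borel fst = \<mu> \<and> distr \<gamma> borel snd = \<nu>}"

text \<open>On \<^const>\<open>P2\<close> the infimum is finite, so \<^const>\<open>enn2real\<close> loses nothing there.\<close>

definition W2 :: "'a::euclidean_space measure \<Rightarrow> 'a measure \<Rightarrow> real" where
  "W2 \<mu> \<nu> = sqrt (enn2real (INF \<gamma>\<in>couplings \<mu> \<nu>. \<integral>\<^sup>+ z. ennreal ((dist (fst z) (snd z))\<^sup>2) \<partial>\<gamma>))"

definition W2_continuous_on :: "real set \<Rightarrow> (real \<Rightarrow> 'a::euclidean_space measure) \<Rightarrow> bool" where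
  "W2_continuous_on I \<mu> \<longleftrightarrow> (\<forall>t\<in>I. \<mu> t \<in> P2) \<and>
     (\<forall>t\<in>I. ((\<lambda>s. W2 (\<mu> s) (\<mu> t)) \<longlongrightarrow> 0) (at t within I))"

text \<open>Absolute continuity of a curve in a metric space, in the sense of
  Ambrosio, Gigli and Savare: the increments are controlled by the integral of
  an \<open>L\<^sup>1\<close> function.\<close>

definition W2_absolutely_continuous :: "real \<Rightarrow> (real \<Rightarrow> 'a::euclidean_space measure) \<Rightarrow> bool" where
  "W2_absolutely_continuous T \<mu> \<longleftrightarrow> (\<forall>t\<in>{0..T}. \<mu> t \<in> P2) \<and>
     (\<exists>g :: real \<Rightarrow> real. set_integrable lborel {0..T} g \<and>
        (\<forall>s t. 0 \<le> s \<and> s \<le> t \<and> t \<le> T \<longrightarrow> W2 (\<mu> s) (\<mu> t) \<le> (LBINT r:{s..t}. g r)))"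

definition mutually_singular :: "'a::euclidean_space measure \<Rightarrow> 'a measure \<Rightarrow> bool" where
  "mutually_singular \<mu> \<nu> \<longleftrightarrow>
     (\<exists>N\<in>sets borel. emeasure \<mu> N = 0 \<and> emeasure \<nu> (- N) = 0)"

text \<open>\<^const>\<open>RN_deriv\<close> is \<open>0\<close> by convention unless the measure is absolutely continuous as a
  whole, so it does not give the Lebesgue density of a general measure.\<close>

definition is_ac_density :: "'a::euclidean_space measure \<Rightarrow> ('a \<Rightarrow> real) \<Rightarrow> bool" where
  "is_ac_density \<mu> f \<longleftrightarrow> f \<in> borel_measurable borel \<and> (\<forall>x. 0 \<le> f x) \<and>
     (\<exists>\<mu>s. sets \<mu>s = sets borel \<and> mutually_singular lborel \<mu>s \<and>
        (\<forall>A\<in>sets borel. emeasure \<mu> A =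
           emeasure (density lborel (\<lambda>x. ennreal (f x))) A + emeasure \<mu>s A))"

definition ac_density :: "'a::euclidean_space measure \<Rightarrow> 'a \<Rightarrow> real" where
  "ac_density \<mu> = (SOME f. is_ac_density \<mu> f)"

text \<open>Extended-real valued, because the integral may be infinite.\<close>

definition energy :: "real \<Rightarrow> 'a::euclidean_space measure \<Rightarrow> ereal" where
  "energy m \<mu> = - (ereal (1 / (1 - m)) * enn2ereal (\<integral>\<^sup>+ x. ennreal (ac_density \<mu> x powr m) \<partial>lborel))"

definition bracket :: "'a::euclidean_space \<Rightarrow> real" where
  "bracket x = sqrt (1 + (norm x)\<^sup>2)"

definition kernel_const :: "'a::euclidean_space itself \<Rightarrow> real \<Rightarrow> real" where
  "kernel_const TYPE('a) \<alpha> = 1 / (LBINT x::'a. (1 + (norm x)\<^sup>2) powr (- \<alpha>))"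

definition bracket_kernel :: "real \<Rightarrow> 'a::euclidean_space \<Rightarrow> real" where
  "bracket_kernel \<alpha> x = kernel_const TYPE('a) \<alpha> * bracket x powr (- 2 * \<alpha>)"

definition rescale :: "real \<Rightarrow> ('a::euclidean_space \<Rightarrow> real) \<Rightarrow> 'a \<Rightarrow> real" where
  "rescale \<epsilon> V x = (1 / \<epsilon> ^ DIM('a)) * V (x /\<^sub>R \<epsilon>)"

text \<open>Meaningful only at points of differentiability.\<close>

definition grad :: "('a::euclidean_space \<Rightarrow> real) \<Rightarrow> 'a \<Rightarrow> 'a" where
  "grad f x = (THE D. GDERIV f x :> D)"

definition conv_measure :: "('a::euclidean_space \<Rightarrow> real) \<Rightarrow> 'a measure \<Rightarrow> 'a \<Rightarrow> real" where
  "conv_measure K \<mu> x = (LINT y|\<mu>. K (x - y))"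

definition conv_fun :: "('a::euclidean_space \<Rightarrow> 'a) \<Rightarrow> ('a \<Rightarrow> real) \<Rightarrow> 'a \<Rightarrow> 'a" where
  "conv_fun K h x = (LBINT y. h y *\<^sub>R K (x - y))"

text \<open>Gradient first, then convolution: \<open>\<nabla>V * (V * \<mu>)\<^sup>m\<^sup>-\<^sup>1\<close>, for a general kernel \<open>V\<close>.\<close>

definition nonlocal_field :: "real \<Rightarrow> ('a::euclidean_space \<Rightarrow> real) \<Rightarrow> 'a measure \<Rightarrow> 'a \<Rightarrow> 'a" where
  "nonlocal_field m V \<mu> = conv_fun (grad V) (\<lambda>y. conv_measure V \<mu> y powr (m - 1))"

definition C1c :: "('a::euclidean_space \<Rightarrow> real) set" where
  "C1c = {\<phi>. (\<forall>x. \<phi> differentiable (at x)) \<and> continuous_on UNIV (grad \<phi>) \<and>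
             compact (closure (support_on UNIV \<phi>))}"

text \<open>Since the Bochner integral of a non-integrable function is \<open>0\<close> by convention, the first
  three conditions say explicitly that the integrals in the equation exist.\<close>

definition distributional_solution ::
    "real \<Rightarrow> real \<Rightarrow> ('a::euclidean_space \<Rightarrow> real) \<Rightarrow> 'a measure \<Rightarrow> (real \<Rightarrow> 'a measure) \<Rightarrow> bool" where
  "distributional_solution T m V \<rho>0 \<rho> \<longleftrightarrow>
     (\<forall>s\<in>{0..T}. \<forall>x. integrable lborel
        (\<lambda>y. conv_measure V (\<rho> s) y powr (m - 1) *\<^sub>R grad V (x - y))) \<and>
     (\<forall>\<phi>\<in>C1c.
        (\<forall>s\<in>{0..T}. integrable (\<rho> s) (\<lambda>x. grad \<phi> x \<bullet> nonlocal_field m V (\<rho> s) x)) \<and>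
        set_integrable lborel {0..T}
          (\<lambda>s. LINT x|\<rho> s. grad \<phi> x \<bullet> nonlocal_field m V (\<rho> s) x) \<and>
        (\<forall>t\<in>{0..T}.
           (LINT x|\<rho> t. \<phi> x) - (LINT x|\<rho>0. \<phi> x) =
             m / (1 - m) *
               (LBINT s:{0..t}. (LINT x|\<rho> s. grad \<phi> x \<bullet> nonlocal_field m V (\<rho> s) x))))"

end

theory Submission
  imports Defs "HOL-Complex_Analysis.Great_Picard"
begin

text \<open>The equation is the Wasserstein gradient flow of the regularised energy
  \<open>\<U>\<^sup>m[V * \<rho>]\<close>. The initial datum is replaced by finitely many weighted particles, for which one step of
  the minimizing movement scheme is a finite-dimensional minimization: its Euler-Lagrange equation
  says that every particle moves by the time step times the velocity at its new position. Comparing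
  energies bounds the discrete action \<open>\<Sum> \<parallel>X\<^bsub>k+1\<^esub> - X\<^bsub>k\<^esub>\<parallel>\<^sup>2 / \<tau>\<close>, because \<open>m > d/(d+2)\<close> lets the energy be
  controlled by a small multiple of the second moment. Hence the discrete curves are equicontinuous,
  and compactness of measures with bounded second moments yields a limit curve.

  The field passes to the limit because \<open>V * \<rho>\<close> is bounded below by a multiple of
  \<open>\<langle>y\<rangle>\<^bsup>-2\<alpha>\<^esup>\<close>, so that the integrand defining the velocity is dominated by a multiple of
  \<open>\<langle>y\<rangle>\<^bsup>-2\<alpha>m\<^esup>\<close>, and \<open>2\<alpha>m > d\<close>. Couplings are measures on the product space, so the same
  compactness gives lower semicontinuity of \<open>W\<^sub>2\<close>.

  Compactness is reduced to Helly's selection theorem on the real line by means of a Borel section of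
  a space-filling curve, and Skorohod's theorem then makes the convergence almost sure.\<close>

section \<open>A space-filling curve with a Borel section\<close>

text \<open>The available bound on the velocity at x grows like \<open>wt x powr \<alpha>\<close>,
  which a second moment does not control. Speeds are therefore estimated only through the energy,
  and in the limit the field is tested only against compactly supported gradients. The implicit step
  makes this possible: it comes from minimality, without any Lipschitz estimate for the field. Since
  its equation holds at the new positions, test functions are expanded about the end point of each
  jump. The discrete curves jump, so absolute continuity of the limit cannot be read off from them.
  Their jumps are sorted by speed: those of speed at most c give a c-Lipschitz length in the limit,
  and the faster ones have total length at most \<open>S / real c\<close> by the action bound. The
  limiting length is thus Lipschitz up to an arbitrarily small monotone remainder, which makes its
  Stieltjes measure absolutely continuous; the density is the function that controls the
  distances.\<close>

definition ternary :: "(nat \<Rightarrow> bool) \<Rightarrow> real" where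
  "ternary a = (\<Sum>i. 2 * of_bool (a i) / 3 ^ Suc i)"

lemma summable_ternary: "summable (\<lambda>i. 2 * of_bool (a i) / 3 ^ Suc i :: real)"
proof (rule summable_comparison_test')
  show "summable (\<lambda>i. (2/3) * (1/3) ^ i :: real)"
    by (intro summable_mult summable_geometric) auto
qed (auto simp: of_bool_def power_divide)

lemma ternary_shift: "3 * ternary a = 2 * of_bool (a 0) + ternary (a \<circ> Suc)"
proof -
  have "ternary a = 2 * of_bool (a 0) / 3 + (\<Sum>i. 2 * of_bool (a (Suc i)) / 3 ^ Suc (Suc i))"
    unfolding ternary_def using suminf_split_head[OF summable_ternary[of a]] by simp
  also have "(\<Sum>i. 2 * of_bool (a (Suc i)) / 3 ^ Suc (Suc i)) = (1/3) * ternary (a \<circ> Suc)"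
    unfolding ternary_def by (subst suminf_mult[OF summable_ternary, symmetric]) simp
  finally show ?thesis by simp
qed

lemma ternary_bounds: "0 \<le> ternary a" "ternary a \<le> 1"
proof -
  show "0 \<le> ternary a"
    unfolding ternary_def by (intro suminf_nonneg summable_ternary) auto
  have "ternary a \<le> (\<Sum>i. (2/3) * (1/3) ^ i :: real)"
    unfolding ternary_def
    by (intro suminf_le summable_ternary summable_mult summable_geometric)
      (auto simp: of_bool_def power_divide)
  also have "\<dots> = 1"
    by (subst suminf_mult) (auto simp: suminf_geometric intro: summable_geometric)
  finally show "ternary a \<le> 1" .
qed

text \<open>Period 2, value 0 on \<open>{0..1/3}\<close> and value 1 on \<open>{2/3..1}\<close>. A
  number whose ternary digits are 0 and 2 only never lies in the open middle third, so a continuous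
  function can read off its leading digit.\<close>

definition digit_wave :: "real \<Rightarrow> real" where
  "digit_wave x = max 0 (min 1 (1/2 - cos (pi * x)))"

text \<open>Multiplication by \<open>3 ^ j\<close> turns the digits before position j into an even
  integer, which the period of the wave ignores. What remains lies in the outer third selected by
  \<open>a j\<close>.\<close>

lemma digit_wave_ternary: "digit_wave (3 ^ j * ternary a) = of_bool (a j)"
proof -
  have "\<exists>N::int. 3 ^ j * ternary a = 2 * of_int N + ternary (\<lambda>i. a (j + i))"
  proof (induction j)
    case 0
    show ?case by (intro exI[of _ 0]) simp
  next
    case (Suc j)
    then obtain N :: int where N: "3 ^ j * ternary a = 2 * of_int N + ternary (\<lambda>i. a (j + i))"
      by blast
    have "3 ^ Suc j * ternary a = 2 * of_int (3 * N + of_bool (a j)) + ternary (\<lambda>i. a (Suc j + i))"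
      using ternary_shift[of "\<lambda>i. a (j + i)"] N by (simp add: o_def)
    then show ?case by blast
  qed
  then obtain N :: int where N: "3 ^ j * ternary a = 2 * of_int N + ternary (\<lambda>i. a (j + i))"
    by blast
  define r where "r = ternary (\<lambda>i. a (j + i))"
  define q where "q = ternary ((\<lambda>i. a (j + i)) \<circ> Suc)"
  have r: "3 * r = 2 * of_bool (a j) + q" and q: "0 \<le> q" "q \<le> 1"
    unfolding r_def q_def using ternary_shift[of "\<lambda>i. a (j + i)"] ternary_bounds by auto
  have "cos (pi * (3 ^ j * ternary a)) = cos (pi * r + 2 * pi * of_int N)"
    unfolding N r_def by (simp add: algebra_simps)
  also have "\<dots> = cos (pi * r)"
    by (simp add: cos_add)
  finally have c: "digit_wave (3 ^ j * ternary a) = digit_wave r"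
    by (simp add: digit_wave_def)
  show ?thesis
  proof (cases "a j")
    case True
    have "cos (pi * r) \<le> cos (2 * pi / 3)"
      using r q True by (intro cos_monotone_0_pi_le) (auto simp: field_simps)
    then show ?thesis using True c by (simp add: digit_wave_def cos_120)
  next
    case False
    have "cos (pi / 3) \<le> cos (pi * r)"
      using r q False by (intro cos_monotone_0_pi_le) (auto simp: field_simps)
    then show ?thesis using False c by (simp add: digit_wave_def cos_60)
  qed
qed

lemma binary_expansion_exists:
  fixes x :: real
  assumes "0 \<le> x" "x \<le> 1"
  shows "\<exists>a. (\<lambda>k. of_bool (a k) / 2 ^ Suc k) sums x"
proof -
  \<comment> \<open>\<open>y k\<close> is the remainder after k digits, rescaled to the unit
    interval. The rule fixes 1, so the end point x = 1 gets the expansion consisting of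
    ones.\<close>
  define y where "y k = ((\<lambda>u. 2 * u - of_bool (u \<ge> 1/2)) ^^ k) x" for k
  have ySuc: "y (Suc k) = 2 * y k - of_bool (y k \<ge> 1/2)" and y0: "y 0 = x" for k
    by (simp_all add: y_def)
  have yb: "0 \<le> y k \<and> y k \<le> 1" for k
    by (induction k) (use assms in \<open>auto simp: y0 ySuc\<close>)
  have ps: "(\<Sum>i<k. of_bool (y i \<ge> 1/2) / 2 ^ Suc i) = x - y k / 2 ^ k" for k
  proof (induction k)
    case (Suc k)
    have "y k / 2 ^ k = of_bool (y k \<ge> 1/2) / 2 ^ Suc k + y (Suc k) / 2 ^ Suc k"
      unfolding ySuc add_divide_distrib[symmetric] by simp
    with Suc show ?case by simp
  qed (simp add: y0)
  have "(\<lambda>k. y k / 2 ^ k) \<longlonglongrightarrow> 0"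
  proof (rule tendsto_sandwich[of "\<lambda>_. 0" _ _ "\<lambda>k. (1/2) ^ k"])
    show "\<forall>\<^sub>F k in sequentially. y k / 2 ^ k \<le> (1/2) ^ k"
      using yb by (auto simp: power_divide divide_right_mono)
  qed (use yb in \<open>auto intro: LIMSEQ_power_zero\<close>)
  then have "(\<lambda>k. \<Sum>i<k. of_bool (y i \<ge> 1/2) / 2 ^ Suc i) \<longlonglongrightarrow> x - 0"
    unfolding ps by (intro tendsto_diff tendsto_const)
  then show ?thesis unfolding sums_def by (intro exI[of _ "\<lambda>i. y i \<ge> 1/2"]) simp
qed

text \<open>Schoenberg's space-filling curve: the coordinates of the point with parameter \<open>t\<close> have the
  ternary digits of \<open>t\<close>, distributed over the coordinates by a pairing function, as binary digits.\<close>

lemma space_filling_curve: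
  "\<exists>p :: real \<Rightarrow> 'a::euclidean_space. continuous_on UNIV p \<and>
     (\<forall>z. (\<forall>b\<in>Basis. \<bar>z \<bullet> b\<bar> \<le> 1) \<longrightarrow> (\<exists>t\<in>{0..1}. p t = z))"
proof -
  define idx :: "'a \<Rightarrow> nat" where "idx = to_nat_on Basis"
  define coord where "coord i t = (\<Sum>k. digit_wave (3 ^ prod_encode (i, k) * t) / 2 ^ Suc k)" for i t
  define p :: "real \<Rightarrow> 'a" where "p t = (\<Sum>b\<in>Basis. (2 * coord (idx b) t - 1) *\<^sub>R b)" for t
  have dw: "\<bar>digit_wave x\<bar> \<le> 1" for x
    by (auto simp: digit_wave_def)
  have cont: "continuous_on UNIV (coord i)" for i
  proof -
    have "uniform_limit UNIV (\<lambda>n t. \<Sum>k<n. digit_wave (3 ^ prod_encode (i, k) * t) / 2 ^ Suc k)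
        (coord i) sequentially"
      unfolding coord_def
    proof (rule Weierstrass_m_test)
      show "summable (\<lambda>k. (1/2) * (1/2) ^ k :: real)"
        by (intro summable_mult summable_geometric) auto
      show "norm (digit_wave (3 ^ prod_encode (i, k) * t) / 2 ^ Suc k) \<le> (1/2) * (1/2) ^ k" for k t
        using dw by (auto simp: power_divide field_simps)
    qed
    then show ?thesis
      by (rule uniform_limit_theorem[rotated])
        (auto simp: digit_wave_def intro!: always_eventually continuous_intros)
  qed
  have "continuous_on UNIV p"
    unfolding p_def by (intro continuous_intros cont)
  moreover have "\<exists>t\<in>{0..1}. p t = z" if z: "\<forall>b\<in>Basis. \<bar>z \<bullet> b\<bar> \<le> 1" for z
  proof -
    have "\<exists>a. (\<lambda>k. of_bool (a k) / 2 ^ Suc k) sums ((z \<bullet> b + 1) / 2)" if "b \<in> Basis" for b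
      using z that by (intro binary_expansion_exists) (auto simp: abs_le_iff)
    then obtain A where A: "\<And>b. b \<in> Basis \<Longrightarrow> (\<lambda>k. of_bool (A b k) / 2 ^ Suc k) sums ((z \<bullet> b + 1) / 2)"
      by metis
    define a where "a j = (case prod_decode j of (i, k) \<Rightarrow> A (from_nat_into Basis i) k)" for j
    have coord: "coord (idx b) (ternary a) = (z \<bullet> b + 1) / 2" if "b \<in> Basis" for b
    proof -
      have "a (prod_encode (idx b, k)) = A b k" for k
        using that by (simp add: a_def idx_def from_nat_into_to_nat_on[OF countable_finite[OF finite_Basis]])
      then show ?thesis
        unfolding coord_def digit_wave_ternary by (simp only: sums_unique[OF A[OF that], symmetric])
    qed
    have "2 * coord (idx b) (ternary a) - 1 = z \<bullet> b" if "b \<in> Basis" for b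
      using coord[OF that] by simp
    then have "p (ternary a) = (\<Sum>b\<in>Basis. (z \<bullet> b) *\<^sub>R b)"
      unfolding p_def by (intro sum.cong) auto
    then have "p (ternary a) = z"
      by (simp add: euclidean_representation)
    then show ?thesis using ternary_bounds[of a] by auto
  qed
  ultimately show ?thesis by blast
qed

text \<open>The smallest parameter in each compact fibre is a measurable choice: its sublevel set at
  \<open>c\<close> is the compact image of \<open>{0..c}\<close>, enlarged by the complement of the
  whole image, where the value is set to 0.\<close>

lemma cube_Borel_section:
  "\<exists>(p :: real \<Rightarrow> 'a::euclidean_space) \<sigma>. continuous_on UNIV p \<and> \<sigma> \<in> borel_measurable borel \<and>
     (\<forall>z. \<sigma> z \<in> {0..1}) \<and> (\<forall>z. (\<forall>b\<in>Basis. \<bar>z \<bullet> b\<bar> \<le> 1) \<longrightarrow> p (\<sigma> z) = z)"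
proof -
  obtain p :: "real \<Rightarrow> 'a" where p: "continuous_on UNIV p"
    and sur: "\<And>z. (\<forall>b\<in>Basis. \<bar>z \<bullet> b\<bar> \<le> 1) \<Longrightarrow> (\<exists>t\<in>{0..1}. p t = z)"
    using space_filling_curve by blast
  define \<sigma> where "\<sigma> z = (if z \<in> p ` {0..1} then Inf {t \<in> {0..1}. p t = z} else 0)" for z
  have attained: "\<sigma> z \<in> {t \<in> {0..1}. p t = z}" if "z \<in> p ` {0..1}" for z
  proof -
    have "closed ({0..1} \<inter> p -` {z})"
      by (intro continuous_closed_preimage continuous_on_subset[OF p]) auto
    moreover have "{0..1} \<inter> p -` {z} = {t \<in> {0..1}. p t = z}" by auto
    ultimately have "closed {t \<in> {0..1}. p t = z}" by simp
    moreover have "{t \<in> {0..1}. p t = z} \<noteq> {}" using that by auto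
    moreover have "bdd_below {t \<in> {0..1}. p t = z}" by (auto intro!: bdd_belowI[of _ 0])
    ultimately have "Inf {t \<in> {0..1}. p t = z} \<in> {t \<in> {0..1}. p t = z}"
      by (intro closed_contains_Inf)
    then show ?thesis using that by (simp only: \<sigma>_def if_True)
  qed
  have range: "\<sigma> z \<in> {0..1}" for z
    using attained[of z] by (cases "z \<in> p ` {0..1}") (auto simp: \<sigma>_def)
  have le_iff: "\<sigma> z \<le> c \<longleftrightarrow> z \<in> p ` {0..c}" if "z \<in> p ` {0..1}" "c \<le> 1" for z c
  proof
    assume "\<sigma> z \<le> c"
    then show "z \<in> p ` {0..c}" using attained[OF that(1)] by force
  next
    assume "z \<in> p ` {0..c}"
    then obtain t where t: "t \<in> {0..c}" "p t = z" by auto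
    have "Inf {t \<in> {0..1}. p t = z} \<le> t"
      using t that(2) by (intro cInf_lower) (auto intro!: bdd_belowI[of _ 0])
    then show "\<sigma> z \<le> c" using t that by (auto simp: \<sigma>_def)
  qed
  have img: "p ` {0..c} \<in> sets borel" for c
    by (intro borel_closed compact_imp_closed compact_continuous_image continuous_on_subset[OF p]) auto
  have "\<sigma> \<in> borel_measurable borel"
    unfolding borel_measurable_iff_le
  proof (intro allI)
    fix c :: real
    consider "c < 0" | "0 \<le> c" "c < 1" | "1 \<le> c" by linarith
    then show "{w \<in> space borel. \<sigma> w \<le> c} \<in> sets borel"
    proof cases
      case 1
      then have "\<not> \<sigma> w \<le> c" for w using range[of w] by auto
      then have "{w \<in> space borel. \<sigma> w \<le> c} = {}" by auto
      then show ?thesis by simp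
    next
      case 2
      then have "p ` {0..c} \<subseteq> p ` {0..1}" by (intro image_mono) auto
      then have "{w \<in> space borel. \<sigma> w \<le> c} = p ` {0..c} \<union> (- p ` {0..1})"
        using 2 le_iff by (auto simp: \<sigma>_def)
      then show ?thesis using img by auto
    next
      case 3
      then have "{w \<in> space borel. \<sigma> w \<le> c} = UNIV" using range by (auto intro: order_trans)
      then show ?thesis by simp
    qed
  qed
  moreover have "p (\<sigma> z) = z" if "\<forall>b\<in>Basis. \<bar>z \<bullet> b\<bar> \<le> 1" for z
    using attained[of z] sur[OF that] by auto
  ultimately show ?thesis using p range by blast
qed

section \<open>Weak compactness of measures with bounded second moments\<close>

definition moment_le :: "real \<Rightarrow> 'a::euclidean_space measure set" where
  "moment_le M = {\<mu>. prob_space \<mu> \<and> sets \<mu> = sets borel \<and> (\<integral>\<^sup>+ x. ennreal ((norm x)\<^sup>2) \<partial>\<mu>) \<le> ennreal M}"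

lemma moment_le_measurable:
  "\<mu> \<in> moment_le M \<Longrightarrow> f \<in> borel_measurable borel \<Longrightarrow> f \<in> borel_measurable \<mu>"
  using measurable_cong_sets[of \<mu> borel] by (auto simp: moment_le_def)

lemma moment_le_second_moment:
  assumes "\<mu> \<in> moment_le M" "M \<ge> 0"
  shows "integrable \<mu> (\<lambda>x. (norm x)\<^sup>2)" "(LINT x|\<mu>. (norm x)\<^sup>2) \<le> M"
proof -
  have m: "(\<lambda>x. (norm x)\<^sup>2) \<in> borel_measurable \<mu>"
    by (rule moment_le_measurable[OF assms(1)]) measurable
  have le: "(\<integral>\<^sup>+ x. ennreal ((norm x)\<^sup>2) \<partial>\<mu>) \<le> ennreal M"
    using assms(1) by (simp add: moment_le_def)
  then show i: "integrable \<mu> (\<lambda>x. (norm x)\<^sup>2)"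
    using m by (intro integrableI_nonneg) (auto intro: le_less_trans)
  show "(LINT x|\<mu>. (norm x)\<^sup>2) \<le> M"
    using le assms(2) by (subst (asm) nn_integral_eq_integral[OF i]) auto
qed

lemma moment_le_mono: "\<mu> \<in> moment_le M \<Longrightarrow> M \<le> M' \<Longrightarrow> \<mu> \<in> moment_le M'"
  by (auto simp: moment_le_def intro: order_trans[OF _ ennreal_leI])

text \<open>The bound makes weak convergence applicable, the Lipschitz condition gives
  equicontinuity in time along the discrete curves, and the class still determines a measure. The
  Lipschitz constant is left arbitrary.\<close>

definition lip1 :: "('a::euclidean_space \<Rightarrow> real) \<Rightarrow> bool" where
  "lip1 f \<longleftrightarrow> (\<forall>x. \<bar>f x\<bar> \<le> 1) \<and> (\<exists>L\<ge>0. \<forall>x y. \<bar>f x - f y\<bar> \<le> L * dist x y)"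

lemma lip1I: "(\<And>x. \<bar>f x\<bar> \<le> 1) \<Longrightarrow> (\<And>x y. \<bar>f x - f y\<bar> \<le> L * dist x y) \<Longrightarrow> lip1 f"
  unfolding lip1_def
proof (intro conjI exI[of _ "max L 0"] allI)
  fix x y assume "\<And>x y. \<bar>f x - f y\<bar> \<le> L * dist x y"
  then show "\<bar>f x - f y\<bar> \<le> max L 0 * dist x y"
    by (meson max.cobounded1 mult_right_mono order_trans zero_le_dist)
qed auto

lemma lip1_continuous: "lip1 f \<Longrightarrow> continuous_on UNIV f"
  unfolding lip1_def
proof (elim conjE exE)
  fix L assume "0 \<le> L" "\<forall>x y. \<bar>f x - f y\<bar> \<le> L * dist x y"
  then show "continuous_on UNIV f"
    by (intro lipschitz_on_continuous_on[of L] lipschitz_onI) (auto simp: dist_real_def)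
qed

text \<open>Almost sure convergence of a Skorohod representation, which serves as the notion of weak
  convergence here.\<close>

definition skorohod_conv :: "(nat \<Rightarrow> 'a::euclidean_space measure) \<Rightarrow> 'a measure \<Rightarrow> bool" where
  "skorohod_conv \<mu> \<nu> \<longleftrightarrow> (\<exists>(\<Omega> :: real measure) W W'. prob_space \<Omega> \<and>
     (\<forall>n. W n \<in> borel_measurable \<Omega> \<and> distr \<Omega> borel (W n) = \<mu> n) \<and>
     W' \<in> borel_measurable \<Omega> \<and> distr \<Omega> borel W' = \<nu> \<and>
     (AE \<omega> in \<Omega>. (\<lambda>n. W n \<omega>) \<longlonglongrightarrow> W' \<omega>))"

lemma skorohod_convE:
  assumes "skorohod_conv \<mu> \<nu>"
  obtains \<Omega> :: "real measure" and W W' where "prob_space \<Omega>"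
    "\<And>n. W n \<in> borel_measurable \<Omega>" "\<And>n. distr \<Omega> borel (W n) = \<mu> n"
    "W' \<in> borel_measurable \<Omega>" "distr \<Omega> borel W' = \<nu>" "AE \<omega> in \<Omega>. (\<lambda>n. W n \<omega>) \<longlonglongrightarrow> W' \<omega>"
  using assms unfolding skorohod_conv_def by blast

section \<open>The space as an open unit ball\<close>

definition to_ball :: "'a::euclidean_space \<Rightarrow> 'a" where
  "to_ball x = x /\<^sub>R sqrt (1 + (norm x)\<^sup>2)"

definition of_ball :: "'a::euclidean_space \<Rightarrow> 'a" where
  "of_ball z = z /\<^sub>R sqrt (1 - (norm z)\<^sup>2)"

lemma one_minus_norm_to_ball: "1 - (norm (to_ball x))\<^sup>2 = 1 / (1 + (norm x)\<^sup>2)"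
proof -
  have p: "0 < 1 + (norm x)\<^sup>2" by (smt (verit) zero_le_power2)
  then have "(norm (to_ball x))\<^sup>2 = (norm x)\<^sup>2 / (1 + (norm x)\<^sup>2)"
    by (simp add: to_ball_def power_mult_distrib power_divide divide_simps)
  then show ?thesis using p by (simp add: field_simps)
qed

lemma norm_to_ball: "norm (to_ball x) < 1"
proof -
  have "0 < 1 + (norm x)\<^sup>2" by (smt (verit) zero_le_power2)
  then have "(norm (to_ball x))\<^sup>2 < 1\<^sup>2"
    using one_minus_norm_to_ball[of x] by (smt (verit) one_power2 zero_less_divide_1_iff)
  then show ?thesis using power2_less_imp_less by fastforce
qed

lemma of_ball_to_ball: "of_ball (to_ball x) = x"
proof -
  have "0 < 1 + (norm x)\<^sup>2" by (smt (verit) zero_le_power2)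
  then show ?thesis
    unfolding of_ball_def one_minus_norm_to_ball
    by (simp add: to_ball_def real_sqrt_divide)
qed

text \<open>The identity turns the second moment into a penalty that blows up at the unit sphere;
  this excludes the escape of mass to infinity.\<close>

lemma one_plus_norm_of_ball:
  assumes "norm z < 1"
  shows "(1 + (norm (of_ball z))\<^sup>2) * (1 - (norm z)\<^sup>2) = 1"
proof -
  have p: "0 < 1 - (norm z)\<^sup>2"
    using assms by (simp add: power_less_one_iff)
  then have "(norm (of_ball z))\<^sup>2 = (norm z)\<^sup>2 / (1 - (norm z)\<^sup>2)"
    by (simp add: of_ball_def power_mult_distrib power_divide divide_simps)
  then show ?thesis using p by (simp add: field_simps)
qed

lemma isCont_of_ball: "norm z < 1 \<Longrightarrow> isCont of_ball z"
  unfolding of_ball_def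
  by (intro continuous_intros) (auto simp: abs_square_eq_1)

lemma measurable_of_ball [measurable]: "of_ball \<in> borel_measurable borel"
  unfolding of_ball_def by measurable

lemma measurable_to_ball [measurable]: "to_ball \<in> borel_measurable borel"
  unfolding to_ball_def by measurable

text \<open>Prohorov's theorem under a moment bound. The ball map followed by the section carries
  every measure to the unit interval, where tightness is automatic. The Skorohod variables are
  mapped back by the curve and \<open>of_ball\<close>; only these two have to be continuous. The
  limit could sit on the unit sphere, where \<open>of_ball\<close> breaks down, and Fatou's lemma
  rules this out.\<close>

theorem moment_le_compact:
  fixes \<mu> :: "nat \<Rightarrow> 'a::euclidean_space measure"
  assumes \<mu>: "\<And>n. \<mu> n \<in> moment_le M"
  shows "\<exists>r \<nu>. strict_mono r \<and> skorohod_conv (\<lambda>n. \<mu> (r n)) \<nu> \<and> \<nu> \<in> moment_le M"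
proof -
  have prob: "prob_space (\<mu> n)" and sets: "sets (\<mu> n) = sets borel"
    and mom: "(\<integral>\<^sup>+ x. ennreal ((norm x)\<^sup>2) \<partial>\<mu> n) \<le> ennreal M" for n
    using \<mu>[of n] by (auto simp: moment_le_def)
  obtain p :: "real \<Rightarrow> 'a" and \<sigma> where p: "continuous_on UNIV p"
    and [measurable]: "\<sigma> \<in> borel_measurable borel"
    and \<sigma>: "\<And>z. \<sigma> z \<in> {0..1}" and p\<sigma>: "\<And>z. (\<forall>b\<in>Basis. \<bar>z \<bullet> b\<bar> \<le> 1) \<Longrightarrow> p (\<sigma> z) = z"
    using cube_Borel_section by metis
  have pm [measurable]: "p \<in> borel_measurable borel"
    using p by (rule borel_measurable_continuous_onI)
  have p\<sigma>b: "p (\<sigma> z) = z" if "norm z \<le> 1" for z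
    using that by (intro p\<sigma> ballI order_trans[OF Basis_le_norm]) auto
  have m\<sigma>: "(\<lambda>x. \<sigma> (to_ball x)) \<in> borel_measurable (\<mu> n)" for n
    by (rule moment_le_measurable[OF \<mu>]) measurable
  define s where "s n = distr (\<mu> n) borel (\<lambda>x. \<sigma> (to_ball x))" for n
  have rd: "real_distribution (s n)" for n
    unfolding s_def by (intro prob_space.real_distribution_distr prob m\<sigma>)
  have "tight s"
    unfolding tight_def
  proof (intro conjI allI impI)
    show "real_distribution (s n)" for n by (rule rd)
    fix e :: real assume "e > 0"
    \<comment> \<open>All parameters lie in \<open>{0..1}\<close>; the left end is moved to -1
      because the half-open interval has to contain 0.\<close>
    have "measure (s n) {-1<..1} = 1" for n
    proof -
      have "(\<lambda>x. \<sigma> (to_ball x)) -` {-1<..1} = UNIV" using \<sigma> by (force intro: less_le_trans[of _ 0])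
      then show ?thesis
        using prob_space.prob_space[OF prob, of n]
        by (simp add: s_def measure_distr[OF m\<sigma>])
    qed
    then show "\<exists>a b. a < b \<and> (\<forall>n. 1 - e < measure (s n) {a<..b})"
      using \<open>e > 0\<close> by (intro exI[of _ "-1"] exI[of _ 1]) auto
  qed
  then obtain r s' where r: "strict_mono r" "real_distribution s'" "weak_conv_m (s \<circ> id \<circ> r) s'"
    using tight_imp_convergent_subsubsequence[of s id] by (auto simp: strict_mono_def)
  have wc: "weak_conv_m (\<lambda>n. s (r n)) s'" using r(3) by (simp add: o_def)
  from Skorohod[OF rd r(2) wc] obtain \<Omega> :: "real measure" and Y Y'
    where \<Omega>: "prob_space \<Omega>" and Y: "\<forall>n. Y n \<in> borel_measurable \<Omega>"
      and dY: "\<forall>n. distr \<Omega> borel (Y n) = s (r n)"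
      and Y': "Y' \<in> measurable \<Omega> lborel" and lim: "\<forall>\<omega>\<in>space \<Omega>. (\<lambda>n. Y n \<omega>) \<longlonglongrightarrow> Y' \<omega>"
    by blast
  have [measurable]: "Y n \<in> borel_measurable \<Omega>" "Y' \<in> borel_measurable \<Omega>" for n
    using Y Y' by auto
  interpret prob_space \<Omega> by (rule \<Omega>)
  define W where "W n \<omega> = of_ball (p (Y n \<omega>))" for n \<omega>
  define W' where "W' \<omega> = of_ball (p (Y' \<omega>))" for \<omega>
  have [measurable]: "W n \<in> borel_measurable \<Omega>" "W' \<in> borel_measurable \<Omega>" for n
    unfolding W_def W'_def by measurable
  \<comment> \<open>The section need not be continuous: it is undone exactly by \<open>p\<close>,
    and this alone recovers the law of the original measure.\<close>
  have dW: "distr \<Omega> borel (W n) = \<mu> (r n)" for n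
  proof -
    have "distr \<Omega> borel (W n) = distr (distr \<Omega> borel (Y n)) borel (\<lambda>y. of_ball (p y))"
      by (simp add: distr_distr o_def W_def[abs_def])
    also have "\<dots> = distr (\<mu> (r n)) borel (\<lambda>x. of_ball (p (\<sigma> (to_ball x))))"
      unfolding dY[rule_format] s_def by (subst distr_distr[OF _ m\<sigma>]) (simp_all add: o_def)
    also have "(\<lambda>x. of_ball (p (\<sigma> (to_ball x)))) = (\<lambda>x. x)"
      by (simp add: p\<sigma>b[OF less_imp_le[OF norm_to_ball]] of_ball_to_ball)
    finally show ?thesis by (simp add: distr_id2[OF sets[symmetric]])
  qed
  have momW: "(\<integral>\<^sup>+ \<omega>. ennreal ((norm (W n \<omega>))\<^sup>2) \<partial>\<Omega>) \<le> ennreal M" for n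
    using mom[of "r n"] unfolding dW[symmetric] by (subst (asm) nn_integral_distr) auto
  have in_ball: "AE \<omega> in \<Omega>. norm (p (Y n \<omega>)) < 1" for n
  proof -
    have "AE y in distr (\<mu> (r n)) borel (\<lambda>x. \<sigma> (to_ball x)). norm (p y) < 1"
      by (subst AE_distr_iff[OF m\<sigma>]) (auto simp: p\<sigma>b[OF less_imp_le[OF norm_to_ball]] norm_to_ball)
    then have "AE y in distr \<Omega> borel (Y n). norm (p y) < 1"
      unfolding dY[rule_format] s_def .
    then show ?thesis by (subst (asm) AE_distr_iff) auto
  qed
  \<comment> \<open>Only a lower limit of the second moments is available here; the convergence of
    \<open>W n\<close> is deduced from its being finite almost surely.\<close>
  have Fatou: "(\<integral>\<^sup>+ \<omega>. liminf (\<lambda>n. ennreal ((norm (W n \<omega>))\<^sup>2)) \<partial>\<Omega>) \<le> ennreal M"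
  proof -
    have "(\<integral>\<^sup>+ \<omega>. liminf (\<lambda>n. ennreal ((norm (W n \<omega>))\<^sup>2)) \<partial>\<Omega>)
        \<le> liminf (\<lambda>n. \<integral>\<^sup>+ \<omega>. ennreal ((norm (W n \<omega>))\<^sup>2) \<partial>\<Omega>)"
      by (intro nn_integral_liminf) measurable
    also have "\<dots> \<le> ennreal M"
      using Liminf_mono[of "\<lambda>n. \<integral>\<^sup>+ \<omega>. ennreal ((norm (W n \<omega>))\<^sup>2) \<partial>\<Omega>" "\<lambda>_. ennreal M" sequentially] momW
      by (auto simp: Liminf_const)
    finally show ?thesis .
  qed
  then have "AE \<omega> in \<Omega>. liminf (\<lambda>n. ennreal ((norm (W n \<omega>))\<^sup>2)) \<noteq> \<infinity>"
    by (intro nn_integral_noteq_infinite) (auto simp: top_unique)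
  moreover have "AE \<omega> in \<Omega>. \<forall>n. norm (p (Y n \<omega>)) < 1"
    using in_ball by (simp add: AE_all_countable)
  ultimately have conv: "AE \<omega> in \<Omega>. (\<lambda>n. W n \<omega>) \<longlonglongrightarrow> W' \<omega>"
    using AE_space
  proof (eventually_elim, goal_cases)
    case (1 \<omega>)
    define z where "z n = p (Y n \<omega>)" for n
    define z' where "z' = p (Y' \<omega>)"
    have z: "z \<longlonglongrightarrow> z'"
      unfolding z_def z'_def using lim 1(3) p
      by (auto intro!: isCont_tendsto_compose[of _ p] simp: continuous_on_eq_continuous_at)
    then have nz: "(\<lambda>n. 1 - (norm (z n))\<^sup>2) \<longlonglongrightarrow> 1 - (norm z')\<^sup>2"
      by (intro tendsto_intros)
    have zn: "norm (z n) < 1" for n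
      using 1(2) by (simp add: z_def)
    have "norm z' \<le> 1"
      using tendsto_norm[OF z] zn by (intro LIMSEQ_le_const2[of "\<lambda>n. norm (z n)"]) (auto intro: less_imp_le)
    \<comment> \<open>If the limit were on the sphere, \<open>one_plus_norm_of_ball\<close> would
      make the norms of \<open>W n\<close> tend to infinity, against the finite lower limit.\<close>
    moreover have "norm z' \<noteq> 1"
    proof
      assume "norm z' = 1"
      then have z0: "(\<lambda>n. 1 - (norm (z n))\<^sup>2) \<longlonglongrightarrow> 0" using nz by simp
      have "ennreal c \<le> liminf (\<lambda>n. ennreal ((norm (W n \<omega>))\<^sup>2))" if "c > 0" for c
      proof (rule Liminf_bounded)
        have "\<forall>\<^sub>F n in sequentially. 1 - (norm (z n))\<^sup>2 < 1 / (c + 1)"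
          using that by (intro order_tendstoD(2)[OF z0]) auto
        then show "\<forall>\<^sub>F n in sequentially. ennreal c \<le> ennreal ((norm (W n \<omega>))\<^sup>2)"
        proof eventually_elim
          case (elim n)
          have pos: "0 < 1 - (norm (z n))\<^sup>2"
            using zn[of n] by (simp add: power_less_one_iff)
          have "1 + (norm (W n \<omega>))\<^sup>2 = 1 / (1 - (norm (z n))\<^sup>2)"
            using one_plus_norm_of_ball[OF zn[of n]] pos by (simp add: W_def z_def field_simps)
          also have "\<dots> > c + 1"
            using elim pos that by (simp add: field_simps)
          finally show ?case by (intro ennreal_leI) simp
        qed
      qed
      moreover obtain c where "liminf (\<lambda>n. ennreal ((norm (W n \<omega>))\<^sup>2)) = ennreal c" "c \<ge> 0"
        using 1(1) by (cases "liminf (\<lambda>n. ennreal ((norm (W n \<omega>))\<^sup>2))") auto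
      ultimately have "ennreal (c + 1) \<le> ennreal c"
        by (metis add_nonneg_pos zero_less_one)
      then show False using \<open>c \<ge> 0\<close> by simp
    qed
    ultimately have "norm z' < 1" by simp
    then show ?case
      using isCont_tendsto_compose[OF isCont_of_ball z] by (simp add: W_def W'_def z_def z'_def)
  qed
  have "(\<integral>\<^sup>+ \<omega>. ennreal ((norm (W' \<omega>))\<^sup>2) \<partial>\<Omega>) = (\<integral>\<^sup>+ \<omega>. liminf (\<lambda>n. ennreal ((norm (W n \<omega>))\<^sup>2)) \<partial>\<Omega>)"
  proof (intro nn_integral_cong_AE, use conv in eventually_elim)
    case (elim \<omega>)
    have "(\<lambda>n. ennreal ((norm (W n \<omega>))\<^sup>2)) \<longlonglongrightarrow> ennreal ((norm (W' \<omega>))\<^sup>2)"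
      by (intro tendsto_ennrealI tendsto_intros elim)
    then show ?case by (intro lim_imp_Liminf[symmetric]) auto
  qed
  with Fatou have "(\<integral>\<^sup>+ x. ennreal ((norm x)\<^sup>2) \<partial>distr \<Omega> borel W') \<le> ennreal M"
    by (subst nn_integral_distr) auto
  moreover have "skorohod_conv (\<lambda>n. \<mu> (r n)) (distr \<Omega> borel W')"
    unfolding skorohod_conv_def
    by (intro exI[of _ \<Omega>] exI[of _ W] exI[of _ W']) (use conv dW \<Omega> in auto)
  moreover have "prob_space (distr \<Omega> borel W')" by (intro prob_space_distr) auto
  ultimately show ?thesis
    using r(1) by (intro exI[of _ r] exI[of _ "distr \<Omega> borel W'"]) (auto simp: moment_le_def)
qed

section \<open>Passing to the limit in integrals\<close>

lemma skorohod_conv_subseq: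
  assumes "skorohod_conv \<mu> \<nu>" "strict_mono r"
  shows "skorohod_conv (\<lambda>n. \<mu> (r n)) \<nu>"
  using assms(1)
proof (rule skorohod_convE)
  fix \<Omega> :: "real measure" and W W'
  assume W: "prob_space \<Omega>" "\<And>n. W n \<in> borel_measurable \<Omega>" "\<And>n. distr \<Omega> borel (W n) = \<mu> n"
    "W' \<in> borel_measurable \<Omega>" "distr \<Omega> borel W' = \<nu>" and lim: "AE \<omega> in \<Omega>. (\<lambda>n. W n \<omega>) \<longlonglongrightarrow> W' \<omega>"
  have "AE \<omega> in \<Omega>. (\<lambda>n. W (r n) \<omega>) \<longlonglongrightarrow> W' \<omega>"
    using lim by eventually_elim (use LIMSEQ_subseq_LIMSEQ[OF _ assms(2)] in \<open>auto simp: o_def\<close>)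
  then show ?thesis
    unfolding skorohod_conv_def
    by (intro exI[of _ \<Omega>] exI[of _ "\<lambda>n. W (r n)"] exI[of _ W']) (use W in auto)
qed

text \<open>The integrand may vary with \<open>n\<close> because it is itself a functional of \<open>\<mu> n\<close> in the application.\<close>

lemma skorohod_conv_integral:
  fixes f :: "nat \<Rightarrow> 'a::euclidean_space \<Rightarrow> real"
  assumes "skorohod_conv \<mu> \<nu>" and f: "\<And>n. f n \<in> borel_measurable borel" "f' \<in> borel_measurable borel"
    and lim: "\<And>x x'. x \<longlonglongrightarrow> x' \<Longrightarrow> (\<lambda>n. f n (x n)) \<longlonglongrightarrow> f' x'"
    and bound: "\<And>n x. \<bar>f n x\<bar> \<le> B"
  shows "(\<lambda>n. LINT x|\<mu> n. f n x) \<longlonglongrightarrow> (LINT x|\<nu>. f' x)"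
proof -
  obtain \<Omega> :: "real measure" and W W' where \<Omega>: "prob_space \<Omega>" and
    W: "\<And>n. W n \<in> borel_measurable \<Omega>" "\<And>n. distr \<Omega> borel (W n) = \<mu> n"
    "W' \<in> borel_measurable \<Omega>" "distr \<Omega> borel W' = \<nu>" "AE \<omega> in \<Omega>. (\<lambda>n. W n \<omega>) \<longlonglongrightarrow> W' \<omega>"
    by (rule skorohod_convE[OF assms(1)]) (rule that)
  interpret prob_space \<Omega> by (rule \<Omega>)
  have [measurable]: "W n \<in> borel_measurable \<Omega>" "W' \<in> borel_measurable \<Omega>"
    "f n \<in> borel_measurable borel" "f' \<in> borel_measurable borel" for n
    using W f by auto
  have "(\<lambda>n. LINT \<omega>|\<Omega>. f n (W n \<omega>)) \<longlonglongrightarrow> (LINT \<omega>|\<Omega>. f' (W' \<omega>))"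
  proof (rule integral_dominated_convergence)
    show "AE \<omega> in \<Omega>. (\<lambda>n. f n (W n \<omega>)) \<longlonglongrightarrow> f' (W' \<omega>)"
      using W(5) by eventually_elim (rule lim)
    show "integrable \<Omega> (\<lambda>_. B)" by simp
  qed (use bound in auto)
  moreover have "(LINT \<omega>|\<Omega>. f n (W n \<omega>)) = (LINT x|\<mu> n. f n x)" for n
    using W by (subst integral_distr[symmetric, of _ _ borel]) auto
  moreover have "(LINT \<omega>|\<Omega>. f' (W' \<omega>)) = (LINT x|\<nu>. f' x)"
    using W by (subst integral_distr[symmetric, of _ _ borel]) auto
  ultimately show ?thesis by simp
qed

lemma skorohod_conv_bounded_continuous:
  fixes f :: "'a::euclidean_space \<Rightarrow> real"
  assumes "skorohod_conv \<mu> \<nu>" and f: "continuous_on UNIV f" "\<And>x. \<bar>f x\<bar> \<le> B"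
  shows "(\<lambda>n. LINT x|\<mu> n. f x) \<longlonglongrightarrow> (LINT x|\<nu>. f x)"
  by (rule skorohod_conv_integral[OF assms(1) _ _ _ f(2)])
    (use f(1) in \<open>auto intro: borel_measurable_continuous_onI isCont_tendsto_compose
      simp: continuous_on_eq_continuous_at\<close>)

lemma skorohod_conv_lip1:
  "skorohod_conv \<mu> \<nu> \<Longrightarrow> lip1 f \<Longrightarrow> (\<lambda>n. LINT x|\<mu> n. f x) \<longlonglongrightarrow> (LINT x|\<nu>. f x)"
  by (rule skorohod_conv_bounded_continuous[where B=1]) (auto simp: lip1_continuous, simp add: lip1_def)

text \<open>Fatou's lemma on the common probability space. No bound on \<open>f\<close> is required,
  so it applies to the quadratic cost of a coupling.\<close>

lemma skorohod_conv_nn_integral_le: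
  fixes f :: "'a::euclidean_space \<Rightarrow> real"
  assumes "skorohod_conv \<mu> \<nu>" and f: "continuous_on UNIV f"
    and le: "\<And>n. (\<integral>\<^sup>+ x. ennreal (f x) \<partial>\<mu> n) \<le> ennreal (b n)" and b: "b \<longlonglongrightarrow> b'"
  shows "(\<integral>\<^sup>+ x. ennreal (f x) \<partial>\<nu>) \<le> ennreal b'"
proof -
  obtain \<Omega> :: "real measure" and W W' where \<Omega>: "prob_space \<Omega>" and
    W: "\<And>n. W n \<in> borel_measurable \<Omega>" "\<And>n. distr \<Omega> borel (W n) = \<mu> n"
    "W' \<in> borel_measurable \<Omega>" "distr \<Omega> borel W' = \<nu>" "AE \<omega> in \<Omega>. (\<lambda>n. W n \<omega>) \<longlonglongrightarrow> W' \<omega>"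
    by (rule skorohod_convE[OF assms(1)]) (rule that)
  have [measurable]: "W n \<in> borel_measurable \<Omega>" "W' \<in> borel_measurable \<Omega>"
    "f \<in> borel_measurable borel" for n
    using W f by (auto intro: borel_measurable_continuous_onI)
  have "(\<integral>\<^sup>+ x. ennreal (f x) \<partial>\<nu>) = (\<integral>\<^sup>+ \<omega>. ennreal (f (W' \<omega>)) \<partial>\<Omega>)"
    unfolding W(4)[symmetric] by (subst nn_integral_distr) auto
  also have "\<dots> = (\<integral>\<^sup>+ \<omega>. liminf (\<lambda>n. ennreal (f (W n \<omega>))) \<partial>\<Omega>)"
  proof (intro nn_integral_cong_AE, use W(5) in eventually_elim)
    case (elim \<omega>)
    have "(\<lambda>n. ennreal (f (W n \<omega>))) \<longlonglongrightarrow> ennreal (f (W' \<omega>))"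
      using f by (intro tendsto_ennrealI isCont_tendsto_compose[of _ f] elim)
        (auto simp: continuous_on_eq_continuous_at)
    then show ?case by (intro lim_imp_Liminf[symmetric]) auto
  qed
  also have "\<dots> \<le> liminf (\<lambda>n. \<integral>\<^sup>+ \<omega>. ennreal (f (W n \<omega>)) \<partial>\<Omega>)"
    by (intro nn_integral_liminf) measurable
  also have "(\<lambda>n. \<integral>\<^sup>+ \<omega>. ennreal (f (W n \<omega>)) \<partial>\<Omega>) = (\<lambda>n. \<integral>\<^sup>+ x. ennreal (f x) \<partial>\<mu> n)"
  proof
    fix n
    show "(\<integral>\<^sup>+ \<omega>. ennreal (f (W n \<omega>)) \<partial>\<Omega>) = (\<integral>\<^sup>+ x. ennreal (f x) \<partial>\<mu> n)"
      unfolding W(2)[of n, symmetric] by (subst nn_integral_distr) auto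
  qed
  also have "liminf \<dots> \<le> liminf (\<lambda>n. ennreal (b n))"
    by (intro Liminf_mono always_eventually allI le)
  also have "\<dots> = ennreal b'"
    by (intro lim_imp_Liminf tendsto_ennrealI b) simp
  finally show ?thesis .
qed

text \<open>The truncated multiples of the distance to the complement of an open set are Lipschitz
  and converge to its indicator, and open sets form an intersection-stable generator of the Borel
  sets.\<close>

lemma moment_le_eqI:
  fixes \<mu> \<nu> :: "'a::euclidean_space measure"
  assumes "\<mu> \<in> moment_le M" "\<nu> \<in> moment_le M'"
    and eq: "\<And>f. lip1 f \<Longrightarrow> (LINT x|\<mu>. f x) = (LINT x|\<nu>. f x)"
  shows "\<mu> = \<nu>"
proof -
  have \<mu>: "prob_space \<mu>" "sets \<mu> = sets borel" and \<nu>: "prob_space \<nu>" "sets \<nu> = sets borel"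
    using assms(1,2) by (auto simp: moment_le_def)
  interpret \<mu>: prob_space \<mu> by (rule \<mu>)
  interpret \<nu>: prob_space \<nu> by (rule \<nu>)
  have op: "measure \<mu> U = measure \<nu> U" if U: "open U" for U
  \<comment> \<open>\<open>infdist\<close> to the empty set is 0 by convention, so the approximating
    functions would vanish for the whole space.\<close>
  proof (cases "U = UNIV")
    case True
    then show ?thesis
      using \<mu>.prob_space \<nu>.prob_space sets_eq_imp_space_eq[OF \<mu>(2)] sets_eq_imp_space_eq[OF \<nu>(2)] by simp
  next
    case False
    define f where "f k x = min 1 (real k * infdist x (- U))" for k x
    have fm: "f k \<in> borel_measurable borel" for k
      unfolding f_def by (intro borel_measurable_continuous_onI continuous_intros)
    have fb: "\<bar>f k x\<bar> \<le> 1" for k x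
      by (auto simp: f_def infdist_nonneg)
    have fl: "\<bar>f k x - f k y\<bar> \<le> real k * dist x y" for k x y
    proof -
      have "\<bar>f k x - f k y\<bar> \<le> \<bar>real k * infdist x (- U) - real k * infdist y (- U)\<bar>"
        by (auto simp: f_def)
      also have "\<dots> = real k * \<bar>infdist x (- U) - infdist y (- U)\<bar>"
        by (simp add: abs_mult flip: right_diff_distrib)
      also have "\<dots> \<le> real k * dist x y"
        by (intro mult_left_mono infdist_triangle_abs) auto
      finally show ?thesis .
    qed
    have fU: "(\<lambda>k. f k x) \<longlonglongrightarrow> indicator U x" for x
    proof (cases "x \<in> U")
      case True
      then have "infdist x (- U) \<noteq> 0"
        using False U in_closed_iff_infdist_zero[of "- U" x] by auto
      then have d: "infdist x (- U) > 0" using infdist_nonneg[of x "- U"] by linarith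
      have "\<forall>\<^sub>F k in sequentially. f k x = 1"
        using eventually_ge_at_top[of "nat \<lceil>1 / infdist x (- U)\<rceil>"]
      proof eventually_elim
        case (elim k)
        then have "1 / infdist x (- U) \<le> real k" by linarith
        then show ?case using d by (auto simp: f_def field_simps)
      qed
      then show ?thesis using True by (simp add: tendsto_eventually)
    qed (simp add: f_def infdist_zero)
    have lim: "(\<lambda>k. LINT x|M. f k x) \<longlonglongrightarrow> measure M U"
      if M: "prob_space M" "sets M = sets borel" for M :: "'a measure"
    proof -
      interpret prob_space M by fact
      have mb: "f \<in> borel_measurable M" if "f \<in> borel_measurable borel" for f :: "'a \<Rightarrow> real"
        using that measurable_cong_sets[OF M(2) refl] by auto
      have "(\<lambda>k. LINT x|M. f k x) \<longlonglongrightarrow> (LINT x|M. indicator U x)"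
        by (rule integral_dominated_convergence[where w="\<lambda>_. 1"])
          (use fm fU fb U M in \<open>auto intro!: mb\<close>)
      also have "(LINT x|M. indicator U x) = measure M U"
        using M U sets.sets_into_space[of U M] by (simp add: Int_absorb2)
      finally show ?thesis .
    qed
    show ?thesis
      using lim[OF \<mu>] lim[OF \<nu>] eq[OF lip1I[OF fb fl]] by (auto intro: LIMSEQ_unique)
  qed
  show ?thesis
  proof (rule measure_eqI_generator_eq[where E="{U. open U}" and \<Omega>=UNIV and A="\<lambda>_. UNIV"])
    show "emeasure \<mu> X = emeasure \<nu> X" if "X \<in> {U. open U}" for X
      using op that by (simp add: \<mu>.emeasure_eq_measure \<nu>.emeasure_eq_measure)
  qed (use \<mu>(2) \<nu>(2) in \<open>auto simp: Int_stable_def borel_def\<close>)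
qed

text \<open>The subsequence principle. A deviation that persists would survive along a subsequence;
  compactness represents a further subsequence by Skorohod variables, and the integrals of
  \<open>lip1\<close> functions identify its limit as \<open>\<nu>\<close>. Representations are thus
  needed only along subsequences, while the conclusion concerns the whole sequence.\<close>

lemma tendsto_along_compact:
  fixes \<mu> :: "nat \<Rightarrow> 'a::euclidean_space measure" and J :: "nat \<Rightarrow> real"
  assumes \<mu>: "\<And>n. \<mu> n \<in> moment_le M" and \<nu>: "\<nu> \<in> moment_le M'"
    and lip1: "\<And>f. lip1 f \<Longrightarrow> (\<lambda>n. LINT x|\<mu> n. f x) \<longlonglongrightarrow> (LINT x|\<nu>. f x)"
    and J: "\<And>r. strict_mono r \<Longrightarrow> skorohod_conv (\<lambda>n. \<mu> (r n)) \<nu> \<Longrightarrow> (\<lambda>n. J (r n)) \<longlonglongrightarrow> J'"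
  shows "J \<longlonglongrightarrow> J'"
proof (rule ccontr)
  assume "\<not> J \<longlonglongrightarrow> J'"
  then obtain e where e: "e > 0" "\<And>N. \<exists>n\<ge>N. e \<le> dist (J n) J'"
    unfolding lim_sequentially by (meson not_le)
  then have "\<exists>\<^sub>F n in sequentially. e \<le> dist (J n) J'"
    unfolding frequently_sequentially by blast
  then obtain s :: "nat \<Rightarrow> nat" where s: "strict_mono s" "\<And>n. e \<le> dist (J (s n)) J'"
    using infinite_enumerate[of "{n. e \<le> dist (J n) J'}"]
    unfolding frequently_cofinite[symmetric] cofinite_eq_sequentially[symmetric] by auto
  obtain r \<nu>' where r: "strict_mono r" "skorohod_conv (\<lambda>n. \<mu> (s (r n))) \<nu>'" and \<nu>': "\<nu>' \<in> moment_le M"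
    using moment_le_compact[of "\<lambda>n. \<mu> (s n)" M] \<mu> by blast
  have sr: "strict_mono (\<lambda>n. s (r n))" using strict_mono_o[OF s(1) r(1)] by (simp add: o_def)
  have "\<nu>' = \<nu>"
  proof (rule moment_le_eqI[OF \<nu>' \<nu>])
    fix f :: "'a \<Rightarrow> real" assume f: "lip1 f"
    show "(LINT x|\<nu>'. f x) = (LINT x|\<nu>. f x)"
      using skorohod_conv_lip1[OF r(2) f] LIMSEQ_subseq_LIMSEQ[OF lip1[OF f] sr]
      by (simp add: o_def LIMSEQ_unique)
  qed
  then have "(\<lambda>n. J (s (r n))) \<longlonglongrightarrow> J'"
    using r(2) by (intro J sr) simp
  then obtain N where "dist (J (s (r N))) J' < e"
    using e(1) unfolding lim_sequentially by blast
  then show False using s(2)[of "r N"] by simp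
qed

section \<open>Absolutely continuous curves\<close>

lemma emeasure_interval_measure_Ioc_cont:
  fixes H :: "real \<Rightarrow> real"
  assumes "mono H" "continuous_on UNIV H" "a \<le> b"
  shows "emeasure (interval_measure H) {a<..b} = ennreal (H b - H a)"
proof (rule emeasure_interval_measure_Ioc[OF assms(3)])
  show "continuous (at_right a) H" for a
    using assms(2) by (auto simp: continuous_on_eq_continuous_at intro: continuous_at_imp_continuous_at_within)
qed (use assms(1) in \<open>auto dest: monoD\<close>)

lemma interval_measure_eqI:
  fixes H :: "real \<Rightarrow> real"
  assumes H: "mono H" "continuous_on UNIV H" and N: "sets N = sets borel"
    and eq: "\<And>a b. a \<le> b \<Longrightarrow> emeasure N {a<..b} = ennreal (H b - H a)"
  shows "interval_measure H = N"
proof (rule measure_eqI_generator_eq[where E="range (\<lambda>(a, b). {a<..b::real})" and \<Omega>=UNIV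
      and A="\<lambda>n. {- real n<..real n}"])
  show "Int_stable (range (\<lambda>(a, b). {a<..b::real}))"
    by (auto simp: Int_stable_def Int_greaterThanAtMost)
  note Ioc = emeasure_interval_measure_Ioc_cont[OF H]
  show "emeasure (interval_measure H) I = emeasure N I" if I: "I \<in> range (\<lambda>(a, b). {a<..b})" for I
  proof -
    obtain a b where ab: "I = {a<..b}" using I by auto
    show ?thesis using Ioc[of a b] eq[of a b] by (cases "a \<le> b") (auto simp: ab)
  qed
  show "sets (interval_measure H) = sigma_sets UNIV (range (\<lambda>(a, b). {a<..b}))"
    and "sets N = sigma_sets UNIV (range (\<lambda>(a, b). {a<..b}))"
    by (simp_all add: N borel_sigma_sets_Ioc)
  show "(\<Union>n. {- real n<..real n}) = UNIV" by (rule UN_Ioc_eq_UNIV)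
  show "emeasure (interval_measure H) {- real n<..real n} \<noteq> \<infinity>" for n
    using Ioc[of "- real n" "real n"] by simp
qed auto

text \<open>Both sides give a half-open interval the increment of the sum. The use is domination: if
  a difference of two functions increases, then the Stieltjes measure of one is bounded by that of
  the other.\<close>

lemma interval_measure_add:
  fixes F G :: "real \<Rightarrow> real"
  assumes F: "mono F" "continuous_on UNIV F" and G: "mono G" "continuous_on UNIV G"
    and A: "A \<in> sets borel"
  shows "emeasure (interval_measure (\<lambda>x. F x + G x)) A =
    emeasure (interval_measure F) A + emeasure (interval_measure G) A"
proof -
  define N where "N = measure_of UNIV (sets borel)
    (\<lambda>A. emeasure (interval_measure F) A + emeasure (interval_measure G) A)"
  have N: "emeasure N A = emeasure (interval_measure F) A + emeasure (interval_measure G) A"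
    if "A \<in> sets borel" for A
  proof (rule emeasure_measure_of[OF N_def])
    show "countably_additive (sets N) (\<lambda>A. emeasure (interval_measure F) A + emeasure (interval_measure G) A)"
    proof (rule countably_additiveI)
      fix A :: "nat \<Rightarrow> real set" assume A: "range A \<subseteq> sets N" "disjoint_family A"
      then have A': "range A \<subseteq> sets (interval_measure F)" "range A \<subseteq> sets (interval_measure G)"
        by (auto simp: N_def sets.sigma_sets_eq[of borel, simplified])
      show "(\<Sum>i. emeasure (interval_measure F) (A i) + emeasure (interval_measure G) (A i)) =
          emeasure (interval_measure F) (\<Union>(range A)) + emeasure (interval_measure G) (\<Union>(range A))"
        using A' A(2) by (simp add: suminf_add[symmetric] suminf_emeasure)
    qed
  qed (use that in \<open>auto simp: positive_def N_def sets.sigma_sets_eq[of borel, simplified]\<close>)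
  have "interval_measure (\<lambda>x. F x + G x) = N"
  proof (rule interval_measure_eqI)
    show "mono (\<lambda>x. F x + G x)" "continuous_on UNIV (\<lambda>x. F x + G x)"
      using F G by (auto intro!: monoI add_mono continuous_intros dest: monoD)
    show "sets N = sets borel"
      by (simp add: N_def sets.sigma_sets_eq[of borel, simplified])
    show "emeasure N {a<..b} = ennreal (F b + G b - (F a + G a))" if "a \<le> b" for a b
      using monoD[OF F(1) that] monoD[OF G(1) that]
      by (simp add: N emeasure_interval_measure_Ioc_cont F G that ennreal_plus[symmetric] algebra_simps del: ennreal_plus)
  qed
  then show ?thesis using N[OF A] by simp
qed

text \<open>Uniform approximation of the increments by those of Lipschitz functions yields the
  absolute continuity of the Stieltjes measure, and Radon-Nikodym the density.\<close>

lemma absolutely_continuous_density: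
  fixes \<Lambda> :: "real \<Rightarrow> real"
  assumes mono: "mono \<Lambda>" and cont: "continuous_on UNIV \<Lambda>"
    and range: "\<And>t. 0 \<le> \<Lambda> t \<and> \<Lambda> t \<le> B"
    and split: "\<And>e. e > 0 \<Longrightarrow> \<exists>L K. mono L \<and> continuous_on UNIV L \<and> mono (\<lambda>t. \<Lambda> t - L t) \<and>
      mono (\<lambda>t. K * t - L t) \<and> K \<ge> 0 \<and> (\<forall>s t. s \<le> t \<longrightarrow> (\<Lambda> t - L t) - (\<Lambda> s - L s) \<le> e)"
  shows "\<exists>g. integrable lborel g \<and> (\<forall>s t. s \<le> t \<longrightarrow> \<Lambda> t - \<Lambda> s = (LBINT r:{s..t}. g r))"
proof -
  define \<mu> where "\<mu> = interval_measure \<Lambda>"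
  have Icc: "emeasure (interval_measure H) {a..b} = ennreal (H b - H a)"
    if "mono H" "continuous_on UNIV H" "a \<le> b" for H and a b :: real
    using that by (intro emeasure_interval_measure_Icc) (auto simp: monoD)
  have total: "emeasure (interval_measure H) UNIV \<le> ennreal e"
    if H: "mono H" "continuous_on UNIV H" "\<And>s t. s \<le> t \<Longrightarrow> H t - H s \<le> e" for H and e :: real
  proof -
    have inc: "incseq (\<lambda>n. {- real n..real n})" by (auto simp: incseq_def)
    have U: "(\<Union>n. {- real n..real n}) = UNIV"
    proof (intro set_eqI iffI UNIV_I)
      fix x :: real
      have "x \<in> {- real (nat \<lceil>\<bar>x\<bar>\<rceil>)..real (nat \<lceil>\<bar>x\<bar>\<rceil>)}"
        unfolding atLeastAtMost_iff by linarith
      then show "x \<in> (\<Union>n. {- real n..real n})" by blast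
    qed
    have "emeasure (interval_measure H) UNIV = (SUP n. emeasure (interval_measure H) {- real n..real n})"
      using SUP_emeasure_incseq[of "\<lambda>n. {- real n..real n}" "interval_measure H"] inc U
      by (simp add: image_subset_iff)
    moreover have "emeasure (interval_measure H) {- real n..real n} \<le> ennreal e" for n
      using H by (subst Icc) (auto intro!: ennreal_leI)
    ultimately show ?thesis by (simp add: SUP_le_iff)
  qed
  have fin: "emeasure \<mu> UNIV \<le> ennreal B"
    unfolding \<mu>_def
  proof (rule total[OF mono cont])
    show "\<Lambda> t - \<Lambda> s \<le> B" for s t using range[of s] range[of t] by linarith
  qed
  have ac: "absolutely_continuous lborel \<mu>"
    unfolding absolutely_continuous_def
  proof
    fix A :: "real set" assume A: "A \<in> null_sets lborel"
    then have Ab: "A \<in> sets borel" by auto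
    have "emeasure \<mu> A \<le> ennreal e" if e: "e > 0" for e
    proof -
      obtain L K where L: "mono L" "continuous_on UNIV L" "mono (\<lambda>t. \<Lambda> t - L t)"
        "mono (\<lambda>t. K * t - L t)" "K \<ge> 0" "\<And>s t. s \<le> t \<Longrightarrow> (\<Lambda> t - L t) - (\<Lambda> s - L s) \<le> e"
        using split[OF e] by blast
      \<comment> \<open>The Lipschitz part: \<open>K * t\<close> is the sum of the increasing
        functions \<open>L t\<close> and \<open>K * t - L t\<close>, so the measure of
        \<open>L\<close> is at most K times Lebesgue measure and vanishes on the null set.\<close>
      have "interval_measure (\<lambda>t. K * t) = density lborel (\<lambda>_. ennreal K)"
      proof (rule interval_measure_eqI)
        show "mono (\<lambda>t. K * t)" "continuous_on UNIV (\<lambda>t. K * t)"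
          using L(5) by (auto intro!: monoI mult_left_mono continuous_intros)
        show "emeasure (density lborel (\<lambda>_. ennreal K)) {a<..b} = ennreal (K * b - K * a)" if "a \<le> b" for a b
          using that L(5) by (simp add: emeasure_density_const ennreal_mult[symmetric] right_diff_distrib)
      qed simp
      then have "emeasure (interval_measure (\<lambda>t. K * t)) A = emeasure (density lborel (\<lambda>_. ennreal K)) A"
        by simp
      also have "\<dots> = 0" using A by (simp add: emeasure_density_const null_sets_def)
      finally have "emeasure (interval_measure (\<lambda>t. L t + (K * t - L t))) A = 0" by simp
      then have L0: "emeasure (interval_measure L) A = 0"
        using L Ab by (subst (asm) interval_measure_add) (auto intro!: continuous_intros)
      \<comment> \<open>The null set is therefore charged by the remainder alone, whose total mass
        is at most \<open>e\<close>.\<close>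
      have "emeasure \<mu> A = emeasure (interval_measure (\<lambda>t. L t + (\<Lambda> t - L t))) A"
        by (simp add: \<mu>_def)
      also have "\<dots> = emeasure (interval_measure (\<lambda>t. \<Lambda> t - L t)) A"
        using L Ab cont L0 by (subst interval_measure_add) (auto intro!: continuous_intros)
      also have "\<dots> \<le> emeasure (interval_measure (\<lambda>t. \<Lambda> t - L t)) UNIV"
        using emeasure_space[of "interval_measure (\<lambda>t. \<Lambda> t - L t)" A] by simp
      also have "\<dots> \<le> ennreal e"
        using L cont by (intro total) (auto intro!: continuous_intros)
      finally show ?thesis .
    qed
    then have "emeasure \<mu> A \<le> 0 + ennreal e" if "e > 0" for e
      using that by simp
    then have "emeasure \<mu> A \<le> 0"
      by (rule ennreal_le_epsilon)
    then show "A \<in> null_sets \<mu>" using Ab by (simp add: null_sets_def \<mu>_def)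
  qed
  interpret \<mu>: finite_measure \<mu>
    by (rule finite_measureI) (use fin in \<open>auto simp: \<mu>_def top_unique\<close>)
  have sm: "sets \<mu> = sets lborel" by (simp add: \<mu>_def)
  obtain D where D: "D \<in> borel_measurable lborel" "\<And>x. 0 \<le> D x" 
    and RN: "AE x in lborel. RN_deriv lborel \<mu> x = ennreal (D x)"
    using sigma_finite_measure.real_RN_deriv[OF sigma_finite_lborel \<mu>.finite_measure_axioms ac sm] by metis
  have dens: "density lborel (\<lambda>x. ennreal (D x)) = \<mu>"
  proof -
    have "density lborel (\<lambda>x. ennreal (D x)) = density lborel (RN_deriv lborel \<mu>)"
      using D(1) RN by (intro density_cong) auto
    then show ?thesis
      using sigma_finite_measure.density_RN_deriv[OF sigma_finite_lborel ac sm] by simp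
  qed
  have nn: "(\<integral>\<^sup>+ x. ennreal (D x) * indicator X x \<partial>lborel) = emeasure \<mu> X" if "X \<in> sets borel" for X
    unfolding dens[symmetric] using that D by (subst emeasure_density) auto
  have int: "integrable lborel D"
    using D nn[of UNIV] fin by (intro integrableI_nonneg) (auto simp: less_top[symmetric] top_unique)
  have "\<Lambda> t - \<Lambda> s = (LBINT r:{s..t}. D r)" if "s \<le> t" for s t
  proof -
    have "(LBINT r:{s..t}. D r) = (LBINT r. D r * indicator {s..t} r)"
      by (simp add: set_lebesgue_integral_def mult.commute)
    also have "\<dots> = enn2real (\<integral>\<^sup>+ r. ennreal (D r * indicator {s..t} r) \<partial>lborel)"
      using D by (intro integral_eq_nn_integral) auto
    also have "(\<integral>\<^sup>+ r. ennreal (D r * indicator {s..t} r) \<partial>lborel) = emeasure \<mu> {s..t}"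
      by (subst nn[symmetric]) (auto intro!: nn_integral_cong simp: indicator_def)
    also have "\<dots> = ennreal (\<Lambda> t - \<Lambda> s)"
      unfolding \<mu>_def by (intro Icc mono cont that)
    finally show ?thesis using monoD[OF mono that] by simp
  qed
  then show ?thesis using int by blast
qed

lemma W2_le_of_coupling:
  assumes "\<gamma> \<in> couplings \<mu> \<nu>" "(\<integral>\<^sup>+ z. ennreal ((dist (fst z) (snd z))\<^sup>2) \<partial>\<gamma>) \<le> ennreal (b\<^sup>2)" "b \<ge> 0"
  shows "W2 \<mu> \<nu> \<le> b"
proof -
  have "(INF \<gamma>\<in>couplings \<mu> \<nu>. \<integral>\<^sup>+ z. ennreal ((dist (fst z) (snd z))\<^sup>2) \<partial>\<gamma>) \<le> ennreal (b\<^sup>2)"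
    using assms by (blast intro: INF_lower2)
  then have "enn2real (INF \<gamma>\<in>couplings \<mu> \<nu>. \<integral>\<^sup>+ z. ennreal ((dist (fst z) (snd z))\<^sup>2) \<partial>\<gamma>) \<le> b\<^sup>2"
    using enn2real_mono[of _ "ennreal (b\<^sup>2)"] by fastforce
  then show ?thesis unfolding W2_def using assms(3) by (intro real_le_lsqrt) auto
qed

section \<open>The kernel and the velocity field\<close>

text \<open>The square of \<^const>\<open>bracket\<close>.\<close>

definition wt :: "'a::euclidean_space \<Rightarrow> real" where
  "wt x = 1 + (norm x)\<^sup>2"

lemma wt_ge_1: "1 \<le> wt x" and wt_pos [simp]: "0 < wt x" and wt_nonneg [simp]: "0 \<le> wt x"
  and wt_nonzero [simp]: "wt x \<noteq> 0"
proof -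
  show "1 \<le> wt x" by (simp add: wt_def)
  then show "0 < wt x" "0 \<le> wt x" "wt x \<noteq> 0" by linarith+
qed

lemma wt_minus [simp]: "wt (- x) = wt x"
  by (simp add: wt_def)

lemma continuous_on_wt [continuous_intros]:
  "continuous_on S f \<Longrightarrow> continuous_on S (\<lambda>x. wt (f x))"
  unfolding wt_def by (intro continuous_intros)

lemma measurable_wt [measurable]: "wt \<in> borel_measurable borel"
  unfolding wt_def by measurable

lemma norm_add_squared_le: "(norm (x + y))\<^sup>2 \<le> 2 * (norm x)\<^sup>2 + 2 * (norm y)\<^sup>2"
proof -
  have "(norm (x + y))\<^sup>2 \<le> (norm x + norm y)\<^sup>2"
    by (intro power_mono norm_triangle_ineq) auto
  also have "\<dots> \<le> 2 * (norm x)\<^sup>2 + 2 * (norm y)\<^sup>2"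
    using sum_squares_bound[of "norm x" "norm y"] by (simp add: power2_sum)
  finally show ?thesis .
qed

text \<open>A Peetre inequality: translating the weight costs only a factor that depends on the
  translation. Its powers give the bounds on shifted kernels.\<close>

lemma wt_add: "wt (x + y) \<le> 2 * wt x * wt y"
proof -
  have "(norm (x + y))\<^sup>2 \<le> 2 * (norm x)\<^sup>2 + 2 * (norm y)\<^sup>2" by (rule norm_add_squared_le)
  moreover have "2 * wt x * wt y = 2 + 2 * (norm x)\<^sup>2 + 2 * (norm y)\<^sup>2 + 2 * ((norm x)\<^sup>2 * (norm y)\<^sup>2)"
    by (simp add: wt_def algebra_simps)
  moreover have "0 \<le> (norm x)\<^sup>2 * (norm y)\<^sup>2" by simp
  ultimately show ?thesis unfolding wt_def[of "x + y"] by linarith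
qed

lemma wt_diff_powr_le:
  assumes "a \<ge> 0"
  shows "wt (x - y) powr - a \<le> 2 powr a * wt x powr a * wt y powr - a"
    and "wt (x - y) powr - a \<le> 2 powr a * wt y powr a * wt x powr - a"
proof -
  have *: "wt u powr - a \<le> 2 powr a * wt v powr a * wt w powr - a" if "wt w \<le> 2 * wt u * wt v" for u v w :: 'a
  proof -
    have "wt w powr a \<le> (2 * wt u * wt v) powr a"
      using that assms by (intro powr_mono2) auto
    also have "\<dots> = 2 powr a * wt u powr a * wt v powr a"
      by (simp add: powr_mult)
    finally show ?thesis by (simp add: powr_minus field_simps)
  qed
  show "wt (x - y) powr - a \<le> 2 powr a * wt x powr a * wt y powr - a"
    using wt_add[of "y - x" x] wt_minus[of "x - y"] by (intro *) simp
  show "wt (x - y) powr - a \<le> 2 powr a * wt y powr a * wt x powr - a"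
    using wt_add[of "x - y" y] by (intro *) simp
qed

lemma wt_diff_powr_ge:
  assumes "a \<ge> 0"
  shows "2 powr - a * wt x powr - a * wt y powr - a \<le> wt (x - y) powr - a"
proof -
  have "(2 * wt x * wt y) powr - a \<le> wt (x - y) powr - a"
    using wt_add[of x "- y"] assms by (intro powr_mono2') auto
  then show ?thesis by (simp add: powr_mult)
qed

text \<open>Dyadic balls take the place of polar coordinates. If k is least with |x| < 2^k, then
  \<open>wt x\<close> is at least 4^(k-1); the factor \<open>4 powr g\<close> in \<open>b\<close>
  pays for the shift from k - 1 to k and covers k = 0. The volumes 2^(kd) against the weights
  4^(-gk) form a geometric series, which converges because 2g > d.\<close>

lemma integrable_wt_powr:
  assumes "g > real DIM('a) / 2"
  shows "integrable lborel (\<lambda>x::'a::euclidean_space. wt x powr - g)"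
proof (rule integrableI_nonneg)
  define c where "c = unit_ball_vol (real DIM('a))"
  define q where "q = (4::real) powr - g"
  define b where "b k = 4 powr g * q ^ k" for k :: nat
  have b0: "b k \<ge> 0" for k by (simp add: b_def q_def)
  have g: "g > 0" using assms by (rule le_less_trans[rotated]) auto
  have pw: "ennreal (wt x powr - g) \<le> (\<Sum>k. ennreal (b k) * indicator (ball 0 (2 ^ k)) x)" for x :: 'a
  proof -
    obtain n where n: "norm x < 2 ^ n" using real_arch_pow[of 2 "norm x"] by auto
    define k where "k = (LEAST k. norm x < 2 ^ k)"
    have k: "norm x < 2 ^ k" unfolding k_def using n by (rule LeastI)
    have "4 ^ k / 4 \<le> wt x"
    proof (cases k)
      case 0
      then show ?thesis using wt_ge_1[of x] by simp
    next
      case (Suc j)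
      then have "\<not> norm x < 2 ^ j" using not_less_Least[of j "\<lambda>k. norm x < 2 ^ k"] by (simp add: k_def)
      then have "(2 ^ j)\<^sup>2 \<le> (norm x)\<^sup>2" by (intro power_mono) auto
      moreover have "((2::real) ^ j)\<^sup>2 = 4 ^ j" by (simp add: power2_eq_square power_mult_distrib[symmetric])
      ultimately show ?thesis using Suc by (simp add: wt_def)
    qed
    then have "wt x powr - g \<le> (4 ^ k / 4) powr - g"
      using g by (intro powr_mono2') auto
    also have "\<dots> = b k"
      by (simp add: b_def q_def powr_divide powr_minus powr_realpow[symmetric] powr_powr mult.commute divide_simps)
    finally have "ennreal (wt x powr - g) \<le> ennreal (b k) * indicator (ball 0 (2 ^ k)) x"
      using k b0 by (auto intro: ennreal_leI)
    also have "\<dots> \<le> (\<Sum>k. ennreal (b k) * indicator (ball 0 (2 ^ k)) x)"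
      using sum_le_suminf[OF summableI, of "{k}" "\<lambda>k. ennreal (b k) * indicator (ball 0 (2 ^ k)) x"]
      by (simp only: sum.insert sum.empty finite.intros empty_iff not_False_eq_True add_0_right finite_insert zero_le)
    finally show ?thesis .
  qed
  have "(\<integral>\<^sup>+ x. ennreal (wt (x::'a) powr - g) \<partial>lborel) \<le> (\<integral>\<^sup>+ (x::'a). (\<Sum>k. ennreal (b k) * indicator (ball 0 (2 ^ k)) x) \<partial>lborel)"
    by (intro nn_integral_mono pw)
  also have "\<dots> = (\<Sum>k. \<integral>\<^sup>+ (x::'a). ennreal (b k) * indicator (ball 0 (2 ^ k)) x \<partial>lborel)"
    by (intro nn_integral_suminf borel_measurable_times_ennreal borel_measurable_indicator) auto
  also have "\<dots> = (\<Sum>k. ennreal ((4 powr g * c) * (q * 2 ^ DIM('a)) ^ k))"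
  proof (intro suminf_cong)
    fix k
    have "(\<integral>\<^sup>+ (x::'a). ennreal (b k) * indicator (ball 0 (2 ^ k)) x \<partial>lborel) = ennreal (b k) * ennreal (c * (2 ^ k) ^ DIM('a))"
      by (simp add: nn_integral_cmult_indicator emeasure_ball c_def)
    also have "\<dots> = ennreal ((4 powr g * c) * (q * 2 ^ DIM('a)) ^ k)"
      using b0 by (subst ennreal_mult[symmetric]) (auto simp: c_def b_def power_mult_distrib power_mult[symmetric] mult_ac)
    finally show "(\<integral>\<^sup>+ (x::'a). ennreal (b k) * indicator (ball 0 (2 ^ k)) x \<partial>lborel) = ennreal ((4 powr g * c) * (q * 2 ^ DIM('a)) ^ k)" .
  qed
  also have "\<dots> < \<infinity>"
  proof -
    have "q = 2 powr (- 2 * g)"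
      using powr_powr[of 2 2 "- g"] by (simp add: q_def)
    then have "q * 2 ^ DIM('a) = 2 powr (real DIM('a) - 2 * g)"
      by (simp add: powr_realpow[symmetric] powr_add[symmetric])
    also have "\<dots> < 1" using assms by (simp add: powr_less_one)
    finally have "norm (q * 2 ^ DIM('a)) < 1" by (simp add: q_def)
    then have "summable (\<lambda>k. (4 powr g * c) * (q * 2 ^ DIM('a)) ^ k)"
      by (intro summable_mult summable_geometric)
    then show ?thesis
      by (subst suminf_ennreal2) (auto simp: q_def c_def)
  qed
  finally show "(\<integral>\<^sup>+ x. ennreal (wt (x::'a) powr - g) \<partial>lborel) < \<infinity>" .
qed auto

lemma GDERIV_unique:
  assumes "GDERIV f x :> D" "GDERIV f x :> D'"
  shows "D = D'"
proof -
  have "(\<lambda>h. h \<bullet> D) = (\<lambda>h. h \<bullet> D')"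
    using has_derivative_unique assms unfolding gderiv_def by blast
  then have "(D - D') \<bullet> (D - D') = 0"
    by (metis inner_diff_right right_minus_eq)
  then show ?thesis by simp
qed

lemma grad_eqI: "GDERIV f x :> D \<Longrightarrow> grad f x = D"
  unfolding grad_def using GDERIV_unique by blast

text \<open>Upper and lower bounds with the same exponent are the point: the negative power
  \<open>m - 1\<close> of the regularised density is controlled from below. \<open>\<alpha>m\<close>
  makes the integrand of the field integrable, \<open>\<alpha>1\<close> gives the kernel a finite
  second moment, and \<open>m_dim\<close> is the condition m > d/(d+2) in the form that makes
  \<open>wt y powr - (m / (1 - m))\<close> integrable. The gradient of the bracket kernel decays
  faster than demanded here; the cruder bound lets a single \<open>k2\<close> serve for
  both.\<close>

locale kernel =
  fixes V :: "'a::euclidean_space \<Rightarrow> real" and DV :: "'a \<Rightarrow> 'a" and \<alpha> m k1 k2 :: real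
  assumes m: "0 < m" "m < 1" and m_dim: "m / (1 - m) > real DIM('a) / 2"
    and \<alpha>m: "\<alpha> * m > real DIM('a) / 2" and \<alpha>1: "\<alpha> - 1 > real DIM('a) / 2"
    and k1: "k1 > 0" and V_ge: "\<And>x. k1 * wt x powr - \<alpha> \<le> V x" and V_le: "\<And>x. V x \<le> k2 * wt x powr - \<alpha>"
    and V_even: "\<And>x. V (- x) = V x" and V_deriv: "\<And>x. GDERIV V x :> DV x"
    and DV_le: "\<And>x. norm (DV x) \<le> k2 * wt x powr - \<alpha>" and DV_cont: "continuous_on UNIV DV"
begin

lemma \<alpha>_pos: "\<alpha> > 0"
  using \<alpha>1 by (smt (verit) DIM_positive divide_nonneg_pos of_nat_0_le_iff)

lemma V_pos: "0 < V x"
  using k1 by (intro less_le_trans[OF _ V_ge]) auto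

lemma k2_pos: "k2 > 0"
  using less_le_trans[OF V_pos[of 0] V_le] by (simp add: zero_less_mult_iff)

lemma wt_powr_le_1: "wt x powr - \<alpha> \<le> 1"
  using powr_mono2'[of "-\<alpha>" 1 "wt x"] wt_ge_1[of x] \<alpha>_pos by simp

lemma V_le_k2: "V x \<le> k2"
  using V_le[of x] mult_left_mono[OF wt_powr_le_1[of x] less_imp_le[OF k2_pos]] by simp

lemma DV_le_k2: "norm (DV x) \<le> k2"
  using DV_le[of x] mult_left_mono[OF wt_powr_le_1[of x] less_imp_le[OF k2_pos]] by simp

lemma V_has_derivative: "(V has_derivative (\<lambda>h. h \<bullet> DV x)) (at x within S)"
  using V_deriv[of x] unfolding gderiv_def by (rule has_derivative_at_withinI)

lemma V_cont: "continuous_on UNIV V"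
  by (intro has_derivative_continuous_on[OF V_has_derivative])

lemma V_Lipschitz: "\<bar>V x - V y\<bar> \<le> k2 * dist x y"
proof -
  have "norm (V x - V y) \<le> k2 * norm (x - y)"
  proof (rule differentiable_bound[of UNIV V "\<lambda>x h. h \<bullet> DV x"])
    show "onorm (\<lambda>h. h \<bullet> DV x) \<le> k2" for x
    proof (rule onorm_le)
      show "norm (h \<bullet> DV x) \<le> k2 * norm h" for h
        using Cauchy_Schwarz_ineq2[of h "DV x"] mult_left_mono[OF DV_le_k2[of x], of "norm h"]
        by (simp add: mult.commute)
    qed
  qed (auto intro: V_has_derivative)
  then show ?thesis by (simp add: dist_norm)
qed

lemma measurable_V [measurable]: "V \<in> borel_measurable borel"
  by (intro borel_measurable_continuous_onI V_cont)

lemma measurable_DV [measurable]: "DV \<in> borel_measurable borel"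
  by (intro borel_measurable_continuous_onI DV_cont)

lemma grad_V: "grad V = DV"
  using grad_eqI[OF V_deriv] by blast

lemma DV_minus: "DV (- x) = - DV x"
proof -
  have "((\<lambda>x. V (- x)) has_derivative (\<lambda>h. (- h) \<bullet> DV (- x))) (at x)"
    by (rule has_derivative_compose[of uminus uminus x UNIV V "\<lambda>h. h \<bullet> DV (- x)"])
      (auto intro!: derivative_eq_intros V_has_derivative)
  then have "GDERIV V x :> - DV (- x)"
    unfolding gderiv_def by (simp add: V_even)
  from GDERIV_unique[OF this V_deriv] show ?thesis by (metis minus_minus)
qed

text \<open>The factor 1/2 is the mass that Chebyshev's inequality keeps in the ball of squared
  radius 2M, and \<open>(1 + 2 * M) powr - \<alpha>\<close> is the least value of
  \<open>wt x powr - \<alpha>\<close> there.\<close>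

definition low :: "real \<Rightarrow> real" where
  "low M = k1 * 2 powr - \<alpha> * (1 + 2 * M) powr - \<alpha> / 2"

lemma low_pos: "M > 0 \<Longrightarrow> low M > 0"
  using k1 by (simp add: low_def)

lemma integrable_V_law:
  assumes "prob_space \<mu>" "sets \<mu> = sets borel"
  shows "integrable \<mu> (\<lambda>x. V (y - x))"
proof -
  interpret prob_space \<mu> by fact
  have "(\<lambda>x. V (y - x)) \<in> borel_measurable \<mu>"
    unfolding measurable_cong_sets[OF assms(2) refl] by measurable
  then show ?thesis
    using V_le_k2 V_pos by (intro integrable_const_bound[of _ k2]) (auto simp: abs_of_pos)
qed

lemma conv_measure_cont:
  assumes \<mu>: "prob_space \<mu>" "sets \<mu> = sets borel"
  shows "continuous_on UNIV (conv_measure V \<mu>)"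
proof (rule lipschitz_on_continuous_on, rule lipschitz_onI)
  interpret prob_space \<mu> by (rule \<mu>)
  fix x y
  have "\<bar>conv_measure V \<mu> x - conv_measure V \<mu> y\<bar> = \<bar>LINT z|\<mu>. V (x - z) - V (y - z)\<bar>"
    unfolding conv_measure_def
    by (subst Bochner_Integration.integral_diff) (auto intro: integrable_V_law[OF \<mu>])
  also have "\<dots> \<le> (LINT z|\<mu>. \<bar>V (x - z) - V (y - z)\<bar>)"
    by (rule integral_abs_bound)
  also have "\<dots> \<le> (LINT z|\<mu>. k2 * dist x y)"
    using V_Lipschitz[of "x - z" "y - z" for z]
    by (intro integral_mono integrable_abs Bochner_Integration.integrable_diff integrable_V_law[OF \<mu>]) (auto simp: dist_norm)
  also have "\<dots> = k2 * dist x y" by (simp add: prob_space)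
  finally show "dist (conv_measure V \<mu> x) (conv_measure V \<mu> y) \<le> k2 * dist x y"
    by (simp add: dist_real_def)
qed (use k2_pos in auto)

lemma measurable_conv_measure:
  "\<mu> \<in> moment_le M \<Longrightarrow> conv_measure V \<mu> \<in> borel_measurable borel"
  by (intro borel_measurable_continuous_onI conv_measure_cont) (auto simp: moment_le_def)

text \<open>At least half of the mass lies where |x|^2 is at most 2M, and there the shifted kernel
  keeps the decay of the unshifted one. Instead of the indicator of that ball its minorant 1 -
  |x|^2/(2M) is integrated, which brings in the second moment directly.\<close>

lemma conv_measure_ge:
  assumes \<mu>: "\<mu> \<in> moment_le M" and M: "M > 0"
  shows "low M * wt y powr - \<alpha> \<le> conv_measure V \<mu> y"
proof -
  interpret prob_space \<mu> using \<mu> by (simp add: moment_le_def)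
  have *: "(1 + 2 * M) powr - \<alpha> * (1 - (norm x)\<^sup>2 / (2 * M)) \<le> wt x powr - \<alpha>" for x :: 'a
  proof (cases "(norm x)\<^sup>2 \<le> 2 * M")
    case True
    then have "(1 + 2 * M) powr - \<alpha> \<le> wt x powr - \<alpha>"
      using \<alpha>_pos by (intro powr_mono2') (auto simp: wt_def add_pos_nonneg)
    moreover have "1 - (norm x)\<^sup>2 / (2 * M) \<le> 1" using M by simp
    ultimately show ?thesis
      by (smt (verit) mult_left_le powr_ge_zero)
  next
    case False
    then have "1 - (norm x)\<^sup>2 / (2 * M) \<le> 0" using M by simp
    then show ?thesis
      by (meson mult_nonneg_nonpos order_trans powr_ge_zero)
  qed
  let ?g = "\<lambda>x::'a. k1 * 2 powr - \<alpha> * wt y powr - \<alpha> * ((1 + 2 * M) powr - \<alpha> * (1 - (norm x)\<^sup>2 / (2 * M)))"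
  note i2 = moment_le_second_moment[OF \<mu> less_imp_le[OF M]]
  have "low M * wt y powr - \<alpha> \<le> k1 * 2 powr - \<alpha> * wt y powr - \<alpha> * ((1 + 2 * M) powr - \<alpha> * (1 - (LINT x|\<mu>. (norm x)\<^sup>2) / (2 * M)))"
  proof -
    have "1 / 2 \<le> 1 - (LINT x|\<mu>. (norm x)\<^sup>2) / (2 * M)"
      using i2(2) M by (simp add: field_simps)
    then have "k1 * 2 powr - \<alpha> * wt y powr - \<alpha> * ((1 + 2 * M) powr - \<alpha> * (1 / 2)) \<le>
       k1 * 2 powr - \<alpha> * wt y powr - \<alpha> * ((1 + 2 * M) powr - \<alpha> * (1 - (LINT x|\<mu>. (norm x)\<^sup>2) / (2 * M)))"
      using k1 by (intro mult_left_mono) auto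
    then show ?thesis by (simp add: low_def mult_ac)
  qed
  also have "\<dots> = (LINT x|\<mu>. ?g x)"
    using i2(1) by (simp add: prob_space)
  also have "\<dots> \<le> (LINT x|\<mu>. V (y - x))"
  proof (intro integral_mono)
    show "integrable \<mu> ?g" using i2(1) by auto
    show "integrable \<mu> (\<lambda>x. V (y - x))" using \<mu> by (intro integrable_V_law) (auto simp: moment_le_def)
    fix x
    have "?g x \<le> k1 * 2 powr - \<alpha> * wt y powr - \<alpha> * wt x powr - \<alpha>"
      by (rule mult_left_mono[OF *]) (use k1 in auto)
    also have "\<dots> \<le> k1 * wt (y - x) powr - \<alpha>"
      using mult_left_mono[OF wt_diff_powr_ge[of \<alpha> y x], of k1] \<alpha>_pos k1 by (simp add: mult_ac)
    finally show "?g x \<le> V (y - x)" using V_ge[of "y - x"] by linarith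
  qed
  finally show ?thesis by (simp add: conv_measure_def)
qed

lemma conv_measure_pos:
  assumes "\<mu> \<in> moment_le M" "M > 0"
  shows "0 < conv_measure V \<mu> y"
  using low_pos[OF assms(2)] by (intro less_le_trans[OF _ conv_measure_ge[OF assms]]) auto

section \<open>Bounds and stability of the velocity field\<close>

lemma weight_le:
  assumes "\<mu> \<in> moment_le M" "M > 0"
  shows "conv_measure V \<mu> y powr (m - 1) \<le> low M powr (m - 1) * wt y powr (\<alpha> * (1 - m))"
proof -
  have "conv_measure V \<mu> y powr (m - 1) \<le> (low M * wt y powr - \<alpha>) powr (m - 1)"
    using m low_pos[OF assms(2)] by (intro powr_mono2' conv_measure_ge[OF assms]) auto
  also have "\<dots> = low M powr (m - 1) * wt y powr (\<alpha> * (1 - m))"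
    using low_pos[OF assms(2)] by (simp add: powr_mult powr_powr algebra_simps)
  finally show ?thesis .
qed

text \<open>The weight grows with exponent \<open>\<alpha> * (1 - m)\<close> and the gradient decays
  with exponent \<open>\<alpha>\<close>, which leaves the integrable decay
  \<open>\<alpha> * m\<close> in y. The price is the growth \<open>wt x powr \<alpha>\<close> in
  x.\<close>

lemma weighted_DV_le:
  assumes w: "0 \<le> w" "w \<le> C * wt y powr (\<alpha> * (1 - m))" and "C \<ge> 0"
  shows "w * norm (DV (x - y)) \<le> C * k2 * 2 powr \<alpha> * wt x powr \<alpha> * wt y powr - (\<alpha> * m)"
proof -
  have "w * norm (DV (x - y)) \<le> (C * wt y powr (\<alpha> * (1 - m))) * (k2 * (2 powr \<alpha> * wt x powr \<alpha> * wt y powr - \<alpha>))"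
  proof (intro mult_mono w)
    have "norm (DV (x - y)) \<le> k2 * wt (x - y) powr - \<alpha>" by (rule DV_le)
    also have "\<dots> \<le> k2 * (2 powr \<alpha> * wt x powr \<alpha> * wt y powr - \<alpha>)"
      using \<alpha>_pos k2_pos by (intro mult_left_mono wt_diff_powr_le(1)) auto
    finally show "norm (DV (x - y)) \<le> k2 * (2 powr \<alpha> * wt x powr \<alpha> * wt y powr - \<alpha>)" .
  qed (use assms in auto)
  also have "\<dots> = C * k2 * 2 powr \<alpha> * wt x powr \<alpha> * (wt y powr (\<alpha> * (1 - m)) * wt y powr - \<alpha>)"
    by (simp add: mult_ac)
  also have "wt y powr (\<alpha> * (1 - m)) * wt y powr - \<alpha> = wt y powr - (\<alpha> * m)"
    by (simp add: powr_add[symmetric] algebra_simps)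
  finally show ?thesis .
qed

definition fbound :: "real \<Rightarrow> real" where
  "fbound M = low M powr (m - 1) * k2 * 2 powr \<alpha>"

lemma fbound_nonneg: "fbound M \<ge> 0"
  using k2_pos by (simp add: fbound_def)

lemma field_integrand_le:
  assumes "\<mu> \<in> moment_le M" "M > 0"
  shows "norm (conv_measure V \<mu> y powr (m - 1) *\<^sub>R DV (x - y)) \<le> fbound M * wt x powr \<alpha> * wt y powr - (\<alpha> * m)"
  using weighted_DV_le[OF _ weight_le[OF assms]] by (simp add: fbound_def)

lemma integrable_wt_\<alpha>m: "integrable lborel (\<lambda>y::'a. wt y powr - (\<alpha> * m))"
  using \<alpha>m by (intro integrable_wt_powr)

lemma integrable_field:
  assumes "\<mu> \<in> moment_le M" "M > 0"
  shows "integrable lborel (\<lambda>y. conv_measure V \<mu> y powr (m - 1) *\<^sub>R DV (x - y))"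
proof (rule Bochner_Integration.integrable_bound)
  show "integrable lborel (\<lambda>y::'a. fbound M * wt x powr \<alpha> * wt y powr - (\<alpha> * m))"
    by (intro integrable_mult_right integrable_wt_\<alpha>m)
  note measurable_conv_measure[OF assms(1), measurable]
  show "(\<lambda>y. conv_measure V \<mu> y powr (m - 1) *\<^sub>R DV (x - y)) \<in> borel_measurable lborel"
    by measurable
  show "AE y in lborel. norm (conv_measure V \<mu> y powr (m - 1) *\<^sub>R DV (x - y)) \<le>
      norm (fbound M * wt x powr \<alpha> * wt y powr - (\<alpha> * m))"
    using field_integrand_le[OF assms] fbound_nonneg by (auto simp: abs_mult)
qed

abbreviation field :: "'a measure \<Rightarrow> 'a \<Rightarrow> 'a" where
  "field \<equiv> nonlocal_field m V"

lemma field_eq: "field \<mu> x = (LINT y|lborel. conv_measure V \<mu> y powr (m - 1) *\<^sub>R DV (x - y))"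
  by (simp add: nonlocal_field_def conv_fun_def grad_V)

definition ftotal :: "real \<Rightarrow> real" where
  "ftotal M = fbound M * (LINT y|lborel. wt (y::'a) powr - (\<alpha> * m))"

lemma norm_field_le:
  assumes "\<mu> \<in> moment_le M" "M > 0"
  shows "norm (field \<mu> x) \<le> ftotal M * wt x powr \<alpha>"
proof -
  have "norm (field \<mu> x) \<le> (LINT y|lborel. fbound M * wt x powr \<alpha> * wt (y::'a) powr - (\<alpha> * m))"
    unfolding field_eq
  proof (rule Bochner_Integration.integral_norm_bound_integral[OF integrable_field[OF assms]])
    show "integrable lborel (\<lambda>y::'a. fbound M * wt x powr \<alpha> * wt y powr - (\<alpha> * m))"
      by (intro integrable_mult_right integrable_wt_\<alpha>m)
  qed (rule field_integrand_le[OF assms])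
  then show ?thesis by (simp add: ftotal_def mult_ac)
qed

text \<open>The measures enter only through the pointwise limits of their convolutions with V, since
  the moment bound supplies the dominating function. The base points move as well because the lemma
  is applied along convergent Skorohod variables.\<close>

lemma field_tendsto:
  assumes \<mu>: "\<And>n. \<mu> n \<in> moment_le M" and \<nu>: "\<nu> \<in> moment_le M" and M: "M > 0"
    and conv: "\<And>y. (\<lambda>n. conv_measure V (\<mu> n) y) \<longlonglongrightarrow> conv_measure V \<nu> y" and x: "x \<longlonglongrightarrow> x'"
  shows "(\<lambda>n. field (\<mu> n) (x n)) \<longlonglongrightarrow> field \<nu> x'"
proof -
  have "convergent (\<lambda>n. wt (x n) powr \<alpha>)"
    unfolding wt_def convergent_def
    using wt_nonzero[of x', unfolded wt_def]
    by (intro exI[of _ "(1 + (norm x')\<^sup>2) powr \<alpha>"] tendsto_intros x) simp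
  then obtain B where B: "\<And>n. norm (wt (x n) powr \<alpha>) \<le> B"
    using convergent_imp_Bseq BseqE by metis
  show ?thesis
    unfolding field_eq
  proof (rule integral_dominated_convergence)
    show "integrable lborel (\<lambda>y. fbound M * B * wt (y::'a) powr - (\<alpha> * m))"
      by (intro integrable_mult_right integrable_wt_\<alpha>m)
    note measurable_conv_measure[measurable]
    show "(\<lambda>y. conv_measure V \<nu> y powr (m - 1) *\<^sub>R DV (x' - y)) \<in> borel_measurable lborel"
      "(\<lambda>y. conv_measure V (\<mu> n) y powr (m - 1) *\<^sub>R DV (x n - y)) \<in> borel_measurable lborel" for n
      using \<mu> \<nu> by measurable
    show "AE y in lborel. norm (conv_measure V (\<mu> n) y powr (m - 1) *\<^sub>R DV (x n - y)) \<le> fbound M * B * wt y powr - (\<alpha> * m)" for n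
    proof (intro AE_I2 order_trans[OF field_integrand_le[OF \<mu> M]] mult_right_mono mult_left_mono)
      show "wt (x n) powr \<alpha> \<le> B" using B[of n] by simp
    qed (auto simp: fbound_nonneg)
    show "AE y in lborel. (\<lambda>n. conv_measure V (\<mu> n) y powr (m - 1) *\<^sub>R DV (x n - y)) \<longlonglongrightarrow> conv_measure V \<nu> y powr (m - 1) *\<^sub>R DV (x' - y)"
    proof (intro AE_I2 tendsto_scaleR tendsto_powr conv tendsto_const)
      show "conv_measure V \<nu> y \<noteq> 0" for y using conv_measure_pos[OF \<nu> M, of y] by simp
      show "(\<lambda>n. DV (x n - y)) \<longlonglongrightarrow> DV (x' - y)" for y
        using DV_cont by (intro isCont_tendsto_compose[of _ DV] tendsto_intros x) (simp add: continuous_on_eq_continuous_at)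
    qed
  qed
qed

lemma field_cont:
  assumes "\<mu> \<in> moment_le M" "M > 0"
  shows "continuous_on UNIV (field \<mu>)"
  unfolding continuous_on_sequentially
  using field_tendsto[of "\<lambda>_. \<mu>" M \<mu>] assms by (auto simp: o_def)

end

section \<open>Minimizing movements of finitely many particles\<close>

lemma lborel_shift:
  fixes f :: "'a::euclidean_space \<Rightarrow> real"
  assumes "f \<in> borel_measurable borel"
  shows "integrable lborel (\<lambda>y. f (y - c)) \<longleftrightarrow> integrable lborel f"
    and "(LINT y|lborel. f (y - c)) = (LINT y|lborel. f y)"
proof -
  have "integrable (distr lborel borel ((+) (- c))) f \<longleftrightarrow> integrable lborel (\<lambda>y. f (- c + y))"
    using assms by (intro integrable_distr_eq) auto
  then show "integrable lborel (\<lambda>y. f (y - c)) \<longleftrightarrow> integrable lborel f"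
    by (simp add: lborel_distr_plus)
  have "(LINT y|distr lborel borel ((+) (- c)). f y) = (LINT y|lborel. f (- c + y))"
    using assms by (intro integral_distr) auto
  then show "(LINT y|lborel. f (y - c)) = (LINT y|lborel. f y)"
    by (simp add: lborel_distr_plus)
qed

text \<open>Positions are functions on a fixed probability space \<open>p\<close>, so the weights
  never change and the joint law of the positions at two times is a coupling of their laws.\<close>

definition law :: "'i pmf \<Rightarrow> ('i \<Rightarrow> 'a::euclidean_space) \<Rightarrow> 'a measure" where
  "law p X = distr (measure_pmf p) borel X"

abbreviation expect :: "'i pmf \<Rightarrow> ('i \<Rightarrow> real) \<Rightarrow> real" where
  "expect p \<equiv> integral\<^sup>L (measure_pmf p)"

definition sqmean :: "'i pmf \<Rightarrow> ('i \<Rightarrow> 'a::euclidean_space) \<Rightarrow> real" where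
  "sqmean p X = expect p (\<lambda>i. (norm (X i))\<^sup>2)"

lemma sets_law [simp]: "sets (law p X) = sets borel"
  by (simp add: law_def)

lemma prob_space_law: "prob_space (law p X)"
  unfolding law_def by (intro measure_pmf.prob_space_distr) auto

lemma integral_law:
  fixes f :: "'a::euclidean_space \<Rightarrow> real"
  shows "f \<in> borel_measurable borel \<Longrightarrow> (LINT x|law p X. f x) = expect p (\<lambda>i. f (X i))"
  unfolding law_def by (intro integral_distr) auto

lemma integrable_finite_pmf [intro]:
  fixes f :: "'i \<Rightarrow> 'b::{banach, second_countable_topology}"
  shows "finite (set_pmf p) \<Longrightarrow> integrable (measure_pmf p) f"
  by (rule integrable_measure_pmf_finite)

lemma expect_sum: "finite (set_pmf p) \<Longrightarrow> expect p f = (\<Sum>i\<in>set_pmf p. f i * pmf p i)"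
  by (rule integral_measure_pmf_real) auto

lemma expect_mono:
  "finite (set_pmf p) \<Longrightarrow> (\<And>i. i \<in> set_pmf p \<Longrightarrow> f i \<le> g i) \<Longrightarrow> expect p f \<le> expect p g"
  by (intro integral_mono_AE integrable_finite_pmf) (auto simp: AE_measure_pmf_iff)

lemma expect_linear:
  "finite (set_pmf p) \<Longrightarrow> expect p (\<lambda>i. c * f i + d * g i) = c * expect p f + d * expect p g"
  by (subst Bochner_Integration.integral_add) auto

lemma sqmean_nonneg: "0 \<le> sqmean p X"
  unfolding sqmean_def by (intro integral_nonneg_AE) auto

lemma sqmean_add_le:
  assumes "finite (set_pmf p)"
  shows "sqmean p (\<lambda>i. X i + Y i) \<le> 2 * sqmean p X + 2 * sqmean p Y"
proof -
  have "sqmean p (\<lambda>i. X i + Y i) \<le> expect p (\<lambda>i. 2 * (norm (X i))\<^sup>2 + 2 * (norm (Y i))\<^sup>2)"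
    unfolding sqmean_def by (intro expect_mono assms norm_add_squared_le)
  also have "\<dots> = 2 * sqmean p X + 2 * sqmean p Y"
    unfolding sqmean_def by (rule expect_linear[OF assms])
  finally show ?thesis .
qed

lemma nn_integral_law:
  assumes "finite (set_pmf p)" "f \<in> borel_measurable borel" "\<And>x. 0 \<le> f x"
  shows "(\<integral>\<^sup>+ x. ennreal (f x) \<partial>law p X) = ennreal (expect p (\<lambda>i. f (X i)))"
proof -
  have "(\<integral>\<^sup>+ x. ennreal (f x) \<partial>law p X) = (\<integral>\<^sup>+ i. ennreal (f (X i)) \<partial>measure_pmf p)"
    unfolding law_def using assms by (subst nn_integral_distr) auto
  also have "\<dots> = ennreal (expect p (\<lambda>i. f (X i)))"
    using assms by (intro nn_integral_eq_integral) auto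
  finally show ?thesis .
qed

lemma law_moment_le:
  assumes "finite (set_pmf p)" "sqmean p X \<le> M"
  shows "law p X \<in> moment_le M"
  using nn_integral_law[OF assms(1), of "\<lambda>x. (norm x)\<^sup>2" X] assms(2)
  by (auto simp: moment_le_def prob_space_law sqmean_def intro: ennreal_leI)

section \<open>The energy of a finite particle system\<close>

context kernel
begin

lemma conv_law: "conv_measure V (law p X) y = expect p (\<lambda>i. V (y - X i))"
  unfolding conv_measure_def by (intro integral_law) measurable

lemma measurable_conv_law [measurable]: "conv_measure V (law p X) \<in> borel_measurable borel"
  by (intro borel_measurable_continuous_onI conv_measure_cont prob_space_law sets_law)

lemma conv_law_nonneg: "0 \<le> conv_measure V (law p X) y"
  unfolding conv_law using V_pos by (intro integral_nonneg_AE) (auto intro: less_imp_le)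

lemma V_shift_le:
  assumes "wt x powr \<alpha> \<le> R"
  shows "k2 * wt (y - x) powr - \<alpha> \<le> k2 * 2 powr \<alpha> * R * wt y powr - \<alpha>"
proof -
  have "wt (y - x) powr - \<alpha> \<le> 2 powr \<alpha> * wt x powr \<alpha> * wt y powr - \<alpha>"
    using \<alpha>_pos by (intro wt_diff_powr_le(2)) auto
  also have "\<dots> \<le> 2 powr \<alpha> * R * wt y powr - \<alpha>"
    using assms by (intro mult_left_mono mult_right_mono) auto
  finally show ?thesis
    using mult_left_mono[of _ _ k2] k2_pos by (fastforce simp: mult_ac)
qed

lemma conv_law_le:
  assumes "finite (set_pmf p)" "\<And>i. i \<in> set_pmf p \<Longrightarrow> wt (X i) powr \<alpha> \<le> R"
  shows "conv_measure V (law p X) y \<le> k2 * 2 powr \<alpha> * R * wt y powr - \<alpha>"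
proof -
  have "expect p (\<lambda>i. V (y - X i)) \<le> expect p (\<lambda>i. k2 * 2 powr \<alpha> * R * wt y powr - \<alpha>)"
    by (intro expect_mono assms(1) order_trans[OF V_le V_shift_le[OF assms(2)]])
  then show ?thesis by (simp add: conv_law)
qed

lemma conv_law_powr_le:
  assumes "finite (set_pmf p)" "\<And>i. i \<in> set_pmf p \<Longrightarrow> wt (X i) powr \<alpha> \<le> R" "R \<ge> 0"
  shows "conv_measure V (law p X) y powr m \<le> (k2 * 2 powr \<alpha> * R) powr m * wt y powr - (\<alpha> * m)"
proof -
  have "conv_measure V (law p X) y powr m \<le> (k2 * 2 powr \<alpha> * R * wt y powr - \<alpha>) powr m"
    using m by (intro powr_mono2 conv_law_nonneg conv_law_le[OF assms(1,2)]) auto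
  also have "\<dots> = (k2 * 2 powr \<alpha> * R) powr m * wt y powr - (\<alpha> * m)"
    using k2_pos assms(3) by (subst powr_mult) (auto simp: powr_powr)
  finally show ?thesis .
qed

lemma finite_bound:
  assumes "finite (set_pmf p)"
  obtains R where "R > 0" "\<And>i. i \<in> set_pmf p \<Longrightarrow> wt (X i :: 'a) powr \<alpha> \<le> R"
proof
  show "(\<Sum>i\<in>set_pmf p. wt (X i) powr \<alpha>) + 1 > 0"
    by (intro add_nonneg_pos sum_nonneg) auto
  show "wt (X i) powr \<alpha> \<le> (\<Sum>i\<in>set_pmf p. wt (X i) powr \<alpha>) + 1" if "i \<in> set_pmf p" for i
    using member_le_sum[OF that, of "\<lambda>i. wt (X i) powr \<alpha>"] assms by simp
qed

lemma integrable_conv_law_powr: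
  assumes "finite (set_pmf p)"
  shows "integrable lborel (\<lambda>y. conv_measure V (law p X) y powr m)"
proof -
  obtain R where R: "R > 0" "\<And>i. i \<in> set_pmf p \<Longrightarrow> wt (X i) powr \<alpha> \<le> R"
    using finite_bound[OF assms] by blast
  show ?thesis
  proof (rule Bochner_Integration.integrable_bound)
    show "integrable lborel (\<lambda>y::'a. (k2 * 2 powr \<alpha> * R) powr m * wt y powr - (\<alpha> * m))"
      by (intro integrable_mult_right integrable_wt_\<alpha>m)
  qed (use conv_law_powr_le[OF assms R(2)] R(1) in auto)
qed

text \<open>With the sign opposite to that of the paper, so that the scheme increases it.\<close>

definition internal_energy :: "'i pmf \<Rightarrow> ('i \<Rightarrow> 'a) \<Rightarrow> real" where
  "internal_energy p X = (LINT y|lborel. conv_measure V (law p X) y powr m) / (1 - m)"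

lemma internal_energy_nonneg: "0 \<le> internal_energy p X"
  unfolding internal_energy_def using m by (intro divide_nonneg_pos Bochner_Integration.integral_nonneg) auto

text \<open>Young's inequality without the optimal constant: each factor is bounded by the
  corresponding power of a + b.\<close>

lemma powr_le_sum:
  assumes "a \<ge> 0" "b \<ge> (0::real)"
  shows "a powr m * b powr (1 - m) \<le> a + b"
proof -
  have "a powr m * b powr (1 - m) \<le> (a + b) powr m * (a + b) powr (1 - m)"
    using assms m by (intro mult_mono powr_mono2) auto
  also have "\<dots> = a + b"
    using assms by (simp add: powr_add[symmetric])
  finally show ?thesis .
qed

text \<open>Young's inequality splits \<open>u powr m\<close> into a small multiple of
  \<open>u * wt\<close> and a multiple of \<open>wt powr - (m / (1 - m))\<close>. The first
  integrates to the second moment because \<open>\<alpha>1\<close> makes V times the weight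
  integrable; the second is integrable by \<open>m_dim\<close>. \<open>C\<close> depends on
  \<open>\<delta>\<close> but not on the particles, which keeps the later estimates uniform in their
  number.\<close>

lemma internal_energy_le:
  assumes "\<delta> > 0"
  shows "\<exists>C\<ge>0. \<forall>(p :: 'i pmf) X. finite (set_pmf p) \<longrightarrow> internal_energy p X \<le> \<delta> * sqmean p X + C"
proof -
  \<comment> \<open>The \<open>+ 1\<close> only makes K positive. \<open>\<delta>'\<close> is chosen
    such that \<open>\<delta>' * (2 * k2 * K) / (1 - m)\<close> equals \<open>\<delta>\<close>, and
    D such that \<open>\<delta>' powr m * D powr (1 - m)\<close> equals 1, as the splitting
    requires.\<close>
  define K where "K = (LINT y|lborel. wt (y::'a) powr - (\<alpha> - 1)) + 1"
  define \<delta>' where "\<delta>' = \<delta> * (1 - m) / (2 * k2 * K)"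
  define D where "D = \<delta>' powr (- m / (1 - m))"
  define I where "I = (LINT y|lborel. wt (y::'a) powr - (m / (1 - m)))"
  have iK: "integrable lborel (\<lambda>y::'a. wt y powr - (\<alpha> - 1))"
    using \<alpha>1 by (intro integrable_wt_powr)
  have iI: "integrable lborel (\<lambda>y::'a. wt y powr - (m / (1 - m)))"
    using m_dim by (intro integrable_wt_powr)
  have K: "K > 0" unfolding K_def by (intro add_nonneg_pos Bochner_Integration.integral_nonneg) auto
  have I0: "I \<ge> 0" unfolding I_def by (intro Bochner_Integration.integral_nonneg) auto
  have \<delta>': "\<delta>' > 0" using assms m K k2_pos by (simp add: \<delta>'_def)
  have V_wt: "V (y - x) * wt y \<le> 2 * k2 * wt x * wt (y - x) powr - (\<alpha> - 1)" for x y
  proof -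
    have "V (y - x) * wt y \<le> (k2 * wt (y - x) powr - \<alpha>) * (2 * wt (y - x) * wt x)"
      using V_pos[of "y - x"] k2_pos wt_add[of "y - x" x] by (intro mult_mono V_le) auto
    also have "\<dots> = 2 * k2 * wt x * (wt (y - x) powr - \<alpha> * wt (y - x) powr 1)"
      by simp
    also have "\<dots> = 2 * k2 * wt x * wt (y - x) powr - (\<alpha> - 1)"
      by (subst powr_add[symmetric]) simp
    finally show ?thesis .
  qed
  have iV: "integrable lborel (\<lambda>y. V (y - x) * wt y)" and bV: "(LINT y|lborel. V (y - x) * wt y) \<le> 2 * k2 * K * wt x" for x
  proof -
    have i: "integrable lborel (\<lambda>y. 2 * k2 * wt x * wt (y - x) powr - (\<alpha> - 1))"
      using iK by (intro integrable_mult_right) (subst lborel_shift, auto)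
    show iV: "integrable lborel (\<lambda>y. V (y - x) * wt y)"
      by (rule Bochner_Integration.integrable_bound[OF i])
        (use V_wt V_pos[of "y - x" for y] k2_pos in \<open>auto simp: abs_mult abs_of_pos\<close>)
    have "(LINT y|lborel. V (y - x) * wt y) \<le> (LINT y|lborel. 2 * k2 * wt x * wt (y - x) powr - (\<alpha> - 1))"
      by (intro integral_mono iV i V_wt)
    also have "\<dots> = 2 * k2 * wt x * (LINT y|lborel. wt (y::'a) powr - (\<alpha> - 1))"
      by (simp add: lborel_shift(2)[of "\<lambda>y. wt y powr (1 - \<alpha>)"])
    also have "\<dots> \<le> 2 * k2 * wt x * K"
      using k2_pos by (intro mult_left_mono) (auto simp: K_def)
    finally show "(LINT y|lborel. V (y - x) * wt y) \<le> 2 * k2 * K * wt x" by (simp add: mult_ac)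
  qed
  show ?thesis
  proof (intro exI[of _ "\<delta> + D * I / (1 - m)"] conjI allI impI)
    show "0 \<le> \<delta> + D * I / (1 - m)" using assms m I0 by (auto simp: D_def)
    fix p :: "'i pmf" and X :: "'i \<Rightarrow> 'a" assume fin: "finite (set_pmf p)"
    let ?u = "conv_measure V (law p X)"
    have u_wt: "?u y * wt y = (\<Sum>i\<in>set_pmf p. (V (y - X i) * wt y) * pmf p i)" for y
      unfolding conv_law expect_sum[OF fin] sum_distrib_right by (intro sum.cong) auto
    have iu: "integrable lborel (\<lambda>y. ?u y * wt y)"
      unfolding u_wt by (intro Bochner_Integration.integrable_sum integrable_mult_left iV)
    have "(LINT y|lborel. ?u y * wt y) = (\<Sum>i\<in>set_pmf p. (LINT y|lborel. V (y - X i) * wt y) * pmf p i)"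
      unfolding u_wt by (subst Bochner_Integration.integral_sum) (auto intro!: integrable_mult_left iV)
    also have "\<dots> \<le> (\<Sum>i\<in>set_pmf p. (2 * k2 * K * wt (X i)) * pmf p i)"
      by (intro sum_mono mult_right_mono bV) auto
    also have "\<dots> = expect p (\<lambda>i. 2 * k2 * K * wt (X i))"
      by (rule expect_sum[OF fin, symmetric])
    also have "\<dots> = 2 * k2 * K * (1 + sqmean p X)"
      unfolding sqmean_def wt_def by (simp add: integrable_finite_pmf[OF fin])
    finally have bu: "(LINT y|lborel. ?u y * wt y) \<le> 2 * k2 * K * (1 + sqmean p X)" .
    have pw: "?u y powr m \<le> \<delta>' * (?u y * wt y) + D * wt y powr - (m / (1 - m))" for y
    proof -
      have "(\<delta>' * (?u y * wt y)) powr m * (D * wt y powr - (m / (1 - m))) powr (1 - m) =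
          ?u y powr m * (\<delta>' powr m * D powr (1 - m)) * (wt y powr m * (wt y powr - (m / (1 - m))) powr (1 - m))"
        using \<delta>' conv_law_nonneg[of p X y] by (simp add: powr_mult D_def mult_ac)
      also have "\<delta>' powr m * D powr (1 - m) = 1"
        using \<delta>' m by (simp add: D_def powr_powr powr_add[symmetric])
      also have "wt y powr m * (wt y powr - (m / (1 - m))) powr (1 - m) = 1"
        using m by (simp add: powr_powr powr_add[symmetric])
      finally show ?thesis
        using powr_le_sum[of "\<delta>' * (?u y * wt y)" "D * wt y powr - (m / (1 - m))"] \<delta>' conv_law_nonneg[of p X y]
        by (simp add: D_def)
    qed
    have "(LINT y|lborel. ?u y powr m) \<le> (LINT y|lborel. \<delta>' * (?u y * wt y) + D * wt y powr - (m / (1 - m)))"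
      by (intro integral_mono integrable_conv_law_powr fin Bochner_Integration.integrable_add integrable_mult_right iu iI pw)
    also have "\<dots> = \<delta>' * (LINT y|lborel. ?u y * wt y) + D * I"
      by (subst Bochner_Integration.integral_add) (auto intro!: integrable_mult_right iu iI simp: I_def)
    also have "\<dots> \<le> \<delta>' * (2 * k2 * K * (1 + sqmean p X)) + D * I"
      using \<delta>' by (intro add_right_mono mult_left_mono bu) auto
    also have "\<dots> = \<delta> * (1 - m) * (1 + sqmean p X) + D * I"
      using K k2_pos by (simp add: \<delta>'_def)
    finally have "internal_energy p X \<le> (\<delta> * (1 - m) * (1 + sqmean p X) + D * I) / (1 - m)"
      unfolding internal_energy_def using m by (intro divide_right_mono) auto
    also have "\<dots> = \<delta> * sqmean p X + (\<delta> + D * I / (1 - m))"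
      using m by (simp add: field_simps)
    finally show "internal_energy p X \<le> \<delta> * sqmean p X + (\<delta> + D * I / (1 - m))" .
  qed
qed

lemma internal_energy_tendsto:
  assumes fin: "finite (set_pmf p)" and Z: "\<And>i. i \<in> set_pmf p \<Longrightarrow> (\<lambda>n. Z n i) \<longlonglongrightarrow> Z' i"
    and R: "\<And>n i. i \<in> set_pmf p \<Longrightarrow> wt (Z n i) powr \<alpha> \<le> R"
  shows "(\<lambda>n. internal_energy p (Z n)) \<longlonglongrightarrow> internal_energy p Z'"
proof -
  have "R \<ge> 0" using R set_pmf_not_empty[of p] by (metis ex_in_conv order_trans powr_ge_zero)
  have "(\<lambda>n. LINT y|lborel. conv_measure V (law p (Z n)) y powr m) \<longlonglongrightarrow> (LINT y|lborel. conv_measure V (law p Z') y powr m)"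
  proof (rule integral_dominated_convergence)
    show "integrable lborel (\<lambda>y::'a. (k2 * 2 powr \<alpha> * R) powr m * wt y powr - (\<alpha> * m))"
      by (intro integrable_mult_right integrable_wt_\<alpha>m)
    show "AE y in lborel. norm (conv_measure V (law p (Z n)) y powr m) \<le> (k2 * 2 powr \<alpha> * R) powr m * wt y powr - (\<alpha> * m)" for n
      using conv_law_powr_le[OF fin R \<open>R \<ge> 0\<close>] by auto
    show "AE y in lborel. (\<lambda>n. conv_measure V (law p (Z n)) y powr m) \<longlonglongrightarrow> conv_measure V (law p Z') y powr m"
    proof (intro AE_I2 tendsto_powr2 tendsto_const)
      show "(\<lambda>n. conv_measure V (law p (Z n)) y) \<longlonglongrightarrow> conv_measure V (law p Z') y" for y
        unfolding conv_law expect_sum[OF fin]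
        using V_cont by (intro tendsto_intros isCont_tendsto_compose[of _ V] Z) (auto simp: continuous_on_eq_continuous_at)
    qed (use m conv_law_nonneg in \<open>auto intro!: always_eventually\<close>)
  qed measurable
  then show ?thesis unfolding internal_energy_def using m by (intro tendsto_divide) auto
qed

text \<open>The direct method. With the constant \<open>1 / (8 * \<tau>)\<close> in
  \<open>internal_energy_le\<close>, the energy absorbs at most half of the quadratic term, up to a
  constant, so the functional is coercive. Minimizing sequences are then bounded in finitely many
  coordinates, and the functional is continuous along convergent ones.\<close>

lemma minimizer_exists:
  fixes X :: "'i \<Rightarrow> 'a"
  assumes fin: "finite (set_pmf p)" and \<tau>: "\<tau> > 0"
  shows "\<exists>Y. \<forall>Z. sqmean p (\<lambda>i. Y i - X i) / (2 * \<tau>) - internal_energy p Y \<le> sqmean p (\<lambda>i. Z i - X i) / (2 * \<tau>) - internal_energy p Z"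
proof -
  define \<Phi> where "\<Phi> Y = sqmean p (\<lambda>i. Y i - X i) / (2 * \<tau>) - internal_energy p Y" for Y
  obtain C where C: "\<And>Y. internal_energy p Y \<le> 1 / (8 * \<tau>) * sqmean p Y + C"
    using internal_energy_le[where 'i='i, of "1 / (8 * \<tau>)"] \<tau> fin by auto
  define C' where "C' = sqmean p X / (4 * \<tau>) + C"
  have coercive: "sqmean p (\<lambda>i. Y i - X i) / (4 * \<tau>) - C' \<le> \<Phi> Y" for Y
  proof -
    have "sqmean p Y \<le> 2 * sqmean p (\<lambda>i. Y i - X i) + 2 * sqmean p X"
      using sqmean_add_le[OF fin, of "\<lambda>i. Y i - X i" X] by simp
    then have "1 / (8 * \<tau>) * sqmean p Y \<le> 1 / (8 * \<tau>) * (2 * sqmean p (\<lambda>i. Y i - X i) + 2 * sqmean p X)"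
      using \<tau> by (intro mult_left_mono) auto
    also have "\<dots> = sqmean p (\<lambda>i. Y i - X i) / (4 * \<tau>) + sqmean p X / (4 * \<tau>)"
      using \<tau> by (simp add: field_simps)
    finally have "internal_energy p Y \<le> sqmean p (\<lambda>i. Y i - X i) / (4 * \<tau>) + C'"
      using C[of Y] by (simp add: C'_def)
    moreover have "sqmean p (\<lambda>i. Y i - X i) / (2 * \<tau>) = sqmean p (\<lambda>i. Y i - X i) / (4 * \<tau>) + sqmean p (\<lambda>i. Y i - X i) / (4 * \<tau>)"
      by simp
    ultimately show ?thesis unfolding \<Phi>_def by linarith
  qed
  have bdd: "bdd_below (range \<Phi>)"
  proof (rule bdd_belowI2)
    show "- C' \<le> \<Phi> Y" for Y
    proof -
      have "0 \<le> sqmean p (\<lambda>i. Y i - X i) / (4 * \<tau>)"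
        using \<tau> by (intro divide_nonneg_pos sqmean_nonneg) auto
      then show ?thesis using coercive[of Y] by linarith
    qed
  qed
  define J where "J = Inf (range \<Phi>)"
  have "\<exists>Y. \<Phi> Y < J + 1 / real (Suc n)" for n
    using cInf_lessD[of "range \<Phi>" "J + 1 / real (Suc n)"] by (auto simp: J_def)
  then obtain Y where Y: "\<And>n. \<Phi> (Y n) < J + 1 / real (Suc n)" by metis
  define B where "B = (J + 1 + C') * (4 * \<tau>)"
  have sq: "sqmean p (\<lambda>i. Y n i - X i) \<le> B" for n
  proof -
    have "1 / real (Suc n) \<le> 1" by simp
    then have "sqmean p (\<lambda>i. Y n i - X i) / (4 * \<tau>) \<le> J + 1 + C'"
      using coercive[of "Y n"] Y[of n] by linarith
    then show ?thesis using \<tau> by (simp add: B_def field_simps)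
  qed
  have B0: "0 \<le> B" using sq[of 0] sqmean_nonneg order_trans by blast
  \<comment> \<open>A bound on the mean square controls a single particle only after division by its
    weight. R thus depends on \<open>p\<close>, which does no harm for the mere existence of a
    minimizer.\<close>
  define R where "R = (\<Sum>i\<in>set_pmf p. norm (X i) + sqrt (B / pmf p i))"
  have nY: "norm (Y n i) \<le> R" if i: "i \<in> set_pmf p" for n i
  proof -
    have pos: "pmf p i > 0" using i by (simp add: pmf_positive)
    have "(norm (Y n i - X i))\<^sup>2 * pmf p i \<le> sqmean p (\<lambda>i. Y n i - X i)"
      unfolding sqmean_def expect_sum[OF fin]
      using member_le_sum[OF i, of "\<lambda>i. (norm (Y n i - X i))\<^sup>2 * pmf p i"] fin by simp
    then have "(norm (Y n i - X i))\<^sup>2 \<le> B / pmf p i"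
      using sq[of n] pos by (simp add: field_simps)
    then have "norm (Y n i - X i) \<le> sqrt (B / pmf p i)"
      by (rule real_le_rsqrt)
    then have "norm (Y n i) \<le> norm (X i) + sqrt (B / pmf p i)"
      using norm_triangle_ineq[of "Y n i - X i" "X i"] by simp
    also have "\<dots> \<le> R"
      unfolding R_def using fin i B0
      by (intro member_le_sum[of i _ "\<lambda>i. norm (X i) + sqrt (B / pmf p i)"]) auto
    finally show ?thesis .
  qed
  obtain r where r: "strict_mono (r :: nat \<Rightarrow> nat)" "\<And>i. i \<in> set_pmf p \<Longrightarrow> \<exists>l. (\<lambda>n. Y (r n) i) \<longlonglongrightarrow> l"
    using function_convergent_subsequence[of "set_pmf p" Y R] countable_finite[OF fin] nY by blast
  then obtain Y' where Y': "\<And>i. i \<in> set_pmf p \<Longrightarrow> (\<lambda>n. Y (r n) i) \<longlonglongrightarrow> Y' i"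
    by metis
  have "(\<lambda>n. internal_energy p (Y (r n))) \<longlonglongrightarrow> internal_energy p Y'"
  proof (rule internal_energy_tendsto[OF fin Y'])
    show "wt (Y (r n) i) powr \<alpha> \<le> (1 + R\<^sup>2) powr \<alpha>" if "i \<in> set_pmf p" for n i
      using nY[OF that] \<alpha>_pos by (intro powr_mono2) (auto simp: wt_def intro: power_mono)
  qed
  moreover have "(\<lambda>n. sqmean p (\<lambda>i. Y (r n) i - X i)) \<longlonglongrightarrow> sqmean p (\<lambda>i. Y' i - X i)"
    unfolding sqmean_def expect_sum[OF fin] by (intro tendsto_intros Y')
  ultimately have "(\<lambda>n. \<Phi> (Y (r n))) \<longlonglongrightarrow> \<Phi> Y'"
    unfolding \<Phi>_def using \<tau> by (intro tendsto_intros) auto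
  moreover have "(\<lambda>n. J + 1 / real (Suc (r n))) \<longlonglongrightarrow> J + 0"
    using LIMSEQ_subseq_LIMSEQ[OF LIMSEQ_inverse_real_of_nat r(1)]
    by (intro tendsto_add tendsto_const) (simp add: o_def inverse_eq_divide)
  ultimately have "\<Phi> Y' \<le> J + 0"
    by (rule LIMSEQ_le) (use Y in \<open>auto intro: less_imp_le\<close>)
  also have "J + 0 \<le> \<Phi> Z" for Z
    unfolding J_def using bdd by (simp add: cINF_lower)
  finally show ?thesis unfolding \<Phi>_def by blast
qed

end

section \<open>The first variation\<close>

context kernel
begin

definition \<kappa> :: real where "\<kappa> = m / (1 - m)"

lemma \<kappa>_pos: "\<kappa> > 0"
  using m by (simp add: \<kappa>_def)

text \<open>The minimizer is compared with \<open>Y + s *\<^sub>R \<zeta>\<close> for positive s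
  tending to 0, and the energy is differentiated under the integral. The one-sided inequality is
  enough, because \<open>\<zeta>\<close> is later taken to be the residual of the equation
  itself.\<close>

lemma Euler_Lagrange_le:
  fixes X Y \<zeta> :: "'i \<Rightarrow> 'a"
  assumes fin: "finite (set_pmf p)" and \<tau>: "\<tau> > 0"
    and min: "\<And>Z. sqmean p (\<lambda>i. Y i - X i) / (2 * \<tau>) - internal_energy p Y \<le> sqmean p (\<lambda>i. Z i - X i) / (2 * \<tau>) - internal_energy p Z"
  shows "\<kappa> * expect p (\<lambda>i. \<zeta> i \<bullet> field (law p Y) (Y i)) \<le> expect p (\<lambda>i. \<zeta> i \<bullet> (Y i - X i)) / \<tau>"
proof -
  define Z where "Z s i = Y i + s *\<^sub>R \<zeta> i" for s i
  define U where "U y s = conv_measure V (law p (Z s)) y" for y s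
  define DU where "DU y s = (\<Sum>i\<in>set_pmf p. (\<zeta> i \<bullet> DV (Z s i - y)) * pmf p i)" for y s
  \<comment> \<open>One second moment bound for all s in the unit interval, hence one dominating
    function for all the difference quotients. The \<open>+ 1\<close> keeps M positive.\<close>
  define M where "M = 2 * sqmean p Y + 2 * sqmean p \<zeta> + 1"
  have M: "M > 0" using sqmean_nonneg[of p Y] sqmean_nonneg[of p \<zeta>] by (simp add: M_def)
  have law_M: "law p (Z s) \<in> moment_le M" if "0 \<le> s" "s \<le> 1" for s
  proof (rule law_moment_le[OF fin])
    have "sqmean p (\<lambda>i. s *\<^sub>R \<zeta> i) = s\<^sup>2 * sqmean p \<zeta>"
      unfolding sqmean_def using fin by (simp add: power_mult_distrib)
    also have "\<dots> \<le> sqmean p \<zeta>"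
      using that sqmean_nonneg[of p \<zeta>] by (intro mult_left_le_one_le) (auto simp: power_le_one)
    finally show "sqmean p (Z s) \<le> M"
      using sqmean_add_le[OF fin, of Y "\<lambda>i. s *\<^sub>R \<zeta> i"] unfolding Z_def M_def by simp
  qed
  have Z0: "Z 0 = Y" by (simp add: Z_def fun_eq_iff)
  have DU: "(U y has_real_derivative DU y s) (at s)" for y s
  proof -
    have "((\<lambda>s. V (y - Z s i)) has_real_derivative \<zeta> i \<bullet> DV (Z s i - y)) (at s)" for i
    proof -
      have "((\<lambda>s. V (y - Z s i)) has_derivative (\<lambda>h. (- (h *\<^sub>R \<zeta> i)) \<bullet> DV (y - Z s i))) (at s)"
        by (rule has_derivative_compose[of "\<lambda>s. y - Z s i" "\<lambda>h. - (h *\<^sub>R \<zeta> i)" s UNIV V])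
          (auto simp: Z_def intro!: derivative_eq_intros V_has_derivative)
      \<comment> \<open>\<open>DV\<close> is odd, so the derivative takes the argument
        \<open>Z s i - y\<close>, which is the one in the field at a particle.\<close>
      moreover have "(- (h *\<^sub>R \<zeta> i)) \<bullet> DV (y - Z s i) = (\<zeta> i \<bullet> DV (Z s i - y)) * h" for h
        using DV_minus[of "y - Z s i"] by simp
      ultimately show ?thesis by (simp add: has_field_derivative_def)
    qed
    then show ?thesis
      unfolding U_def DU_def conv_law expect_sum[OF fin] by (intro DERIV_sum DERIV_cmult_right)
  qed
  have Upos: "U y s > 0" if "0 \<le> s" "s \<le> 1" for y s
    unfolding U_def by (rule conv_measure_pos[OF law_M[OF that] M])
  have DUm: "((\<lambda>s. U y s powr m) has_real_derivative m * (U y s powr (m - 1) * DU y s)) (at s)"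
    if "0 \<le> s" "s \<le> 1" for y s
    using DERIV_fun_powr[OF DU[of y s] Upos[OF that], of m] by (simp add: mult_ac)
  define R where "R i = (1 + (norm (Y i) + norm (\<zeta> i))\<^sup>2) powr \<alpha>" for i
  define B where "B = m * (\<Sum>i\<in>set_pmf p. norm (\<zeta> i) * (fbound M * R i) * pmf p i)"
  have DU_le: "\<bar>m * (U y s powr (m - 1) * DU y s)\<bar> \<le> B * wt y powr - (\<alpha> * m)" if s: "0 \<le> s" "s \<le> 1" for y s
  proof -
    have "U y s powr (m - 1) * norm (DV (Z s i - y)) \<le> fbound M * R i * wt y powr - (\<alpha> * m)" for i
    proof -
      have "norm (Z s i) \<le> norm (Y i) + norm (\<zeta> i)"
        unfolding Z_def using s mult_right_mono[of s 1 "norm (\<zeta> i)"]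
        by (intro order_trans[OF norm_triangle_ineq]) auto
      then have "wt (Z s i) powr \<alpha> \<le> R i"
        using \<alpha>_pos unfolding R_def wt_def by (intro powr_mono2 add_left_mono power_mono) auto
      then have "fbound M * wt (Z s i) powr \<alpha> * wt y powr - (\<alpha> * m) \<le> fbound M * R i * wt y powr - (\<alpha> * m)"
        by (intro mult_right_mono mult_left_mono fbound_nonneg) auto
      then show ?thesis
        using field_integrand_le[OF law_M[OF s] M, of y "Z s i"] by (simp add: U_def)
    qed note * = this
    have "\<bar>U y s powr (m - 1) * DU y s\<bar> \<le> (\<Sum>i\<in>set_pmf p. \<bar>U y s powr (m - 1) * ((\<zeta> i \<bullet> DV (Z s i - y)) * pmf p i)\<bar>)"
      unfolding DU_def sum_distrib_left by (rule sum_abs)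
    also have "\<dots> \<le> (\<Sum>i\<in>set_pmf p. norm (\<zeta> i) * (fbound M * R i) * pmf p i * wt y powr - (\<alpha> * m))"
    proof (rule sum_mono)
      fix i
      have "\<bar>U y s powr (m - 1) * ((\<zeta> i \<bullet> DV (Z s i - y)) * pmf p i)\<bar> =
          U y s powr (m - 1) * (\<bar>\<zeta> i \<bullet> DV (Z s i - y)\<bar> * pmf p i)"
        by (simp add: abs_mult)
      also have "\<dots> \<le> U y s powr (m - 1) * ((norm (\<zeta> i) * norm (DV (Z s i - y))) * pmf p i)"
        by (intro mult_left_mono mult_right_mono Cauchy_Schwarz_ineq2) auto
      also have "\<dots> = norm (\<zeta> i) * pmf p i * (U y s powr (m - 1) * norm (DV (Z s i - y)))"
        by (simp add: mult_ac)
      also have "\<dots> \<le> norm (\<zeta> i) * pmf p i * (fbound M * R i * wt y powr - (\<alpha> * m))"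
        by (intro mult_left_mono *) auto
      finally show "\<bar>U y s powr (m - 1) * ((\<zeta> i \<bullet> DV (Z s i - y)) * pmf p i)\<bar> \<le>
          norm (\<zeta> i) * (fbound M * R i) * pmf p i * wt y powr - (\<alpha> * m)" by (simp add: mult_ac)
    qed
    finally have "m * \<bar>U y s powr (m - 1) * DU y s\<bar> \<le> m * ((\<Sum>i\<in>set_pmf p. norm (\<zeta> i) * (fbound M * R i) * pmf p i) * wt y powr - (\<alpha> * m))"
      using m by (intro mult_left_mono) (auto simp: sum_distrib_right)
    then show ?thesis using m by (simp add: abs_mult B_def mult.assoc)
  qed
  define t where "t n = 1 / real (Suc n)" for n
  have t: "0 < t n" "t n \<le> 1" for n by (auto simp: t_def)
  have t0: "t \<longlonglongrightarrow> 0"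
    using LIMSEQ_inverse_real_of_nat by (simp add: t_def[abs_def] inverse_eq_divide)
  define q where "q n y = (U y (t n) powr m - U y 0 powr m) / t n" for n y
  \<comment> \<open>The mean value theorem replaces the quotient by a derivative at an intermediate
    point of the unit interval, where the bound \<open>DU_le\<close> holds.\<close>
  have q_le: "\<bar>q n y\<bar> \<le> B * wt y powr - (\<alpha> * m)" for n y
  proof -
    have "\<exists>z>0. z < t n \<and> U y (t n) powr m - U y 0 powr m = (t n - 0) * (m * (U y z powr (m - 1) * DU y z))"
    proof (rule MVT2[OF t(1)])
      show "((\<lambda>s. U y s powr m) has_real_derivative m * (U y s powr (m - 1) * DU y s)) (at s)"
        if "0 \<le> s" "s \<le> t n" for s
        using that t(2)[of n] by (intro DUm) auto
    qed
    then obtain z where z: "z > 0" "z < t n" "U y (t n) powr m - U y 0 powr m = (t n - 0) * (m * (U y z powr (m - 1) * DU y z))"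
      by blast
    then have "q n y = m * (U y z powr (m - 1) * DU y z)"
      using t(1)[of n] by (simp add: q_def)
    then show ?thesis using DU_le[of z y] z t(2)[of n] by simp
  qed
  have [measurable]: "(\<lambda>y. U y s) \<in> borel_measurable borel" for s
    unfolding U_def by measurable
  have [measurable]: "(\<lambda>y. DU y s) \<in> borel_measurable borel" for s
    unfolding DU_def by measurable
  have lim: "(\<lambda>n. LINT y|lborel. q n y) \<longlonglongrightarrow> (LINT y|lborel. m * (U y 0 powr (m - 1) * DU y 0))"
  proof (rule integral_dominated_convergence)
    show "integrable lborel (\<lambda>y::'a. B * wt y powr - (\<alpha> * m))"
      by (intro integrable_mult_right integrable_wt_\<alpha>m)
    show "AE y in lborel. norm (q n y) \<le> B * wt y powr - (\<alpha> * m)" for n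
      using q_le by auto
    show "q n \<in> borel_measurable lborel" for n
      unfolding q_def by measurable
    show "AE y in lborel. (\<lambda>n. q n y) \<longlonglongrightarrow> m * (U y 0 powr (m - 1) * DU y 0)"
    proof (intro AE_I2)
      fix y
      have "((\<lambda>h. (U y (0 + h) powr m - U y 0 powr m) / h) \<longlongrightarrow> m * (U y 0 powr (m - 1) * DU y 0)) (at 0)"
        using DUm[of 0 y] by (simp add: DERIV_def)
      moreover have "filterlim t (at 0) sequentially"
        using t0 t(1) by (auto simp: filterlim_at intro!: always_eventually less_imp_neq[THEN not_sym])
      ultimately show "(\<lambda>n. q n y) \<longlonglongrightarrow> m * (U y 0 powr (m - 1) * DU y 0)"
        unfolding q_def by (auto dest: filterlim_compose)
    qed
  qed measurable
  define e where "e = expect p (\<lambda>i. \<zeta> i \<bullet> (Y i - X i))"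
  have q_int: "(LINT y|lborel. q n y) \<le> (1 - m) * (e / \<tau> + t n * sqmean p \<zeta> / (2 * \<tau>))" for n
  proof -
    have "(LINT y|lborel. q n y) = (1 - m) * (internal_energy p (Z (t n)) - internal_energy p Y) / t n"
      unfolding q_def U_def Z0 internal_energy_def using m integrable_conv_law_powr[OF fin]
      by (simp add: diff_divide_distrib right_diff_distrib)
    also have "\<dots> \<le> (1 - m) * (sqmean p (\<lambda>i. Z (t n) i - X i) / (2 * \<tau>) - sqmean p (\<lambda>i. Y i - X i) / (2 * \<tau>)) / t n"
      using min[of "Z (t n)"] m t(1)[of n] by (intro divide_right_mono mult_left_mono) (auto intro: less_imp_le)
    also have "sqmean p (\<lambda>i. Z (t n) i - X i) = sqmean p (\<lambda>i. Y i - X i) + 2 * t n * e + (t n)\<^sup>2 * sqmean p \<zeta>"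
    proof -
      have "(norm (Z (t n) i - X i))\<^sup>2 = (norm (Y i - X i))\<^sup>2 + 2 * t n * (\<zeta> i \<bullet> (Y i - X i)) + (t n)\<^sup>2 * (norm (\<zeta> i))\<^sup>2" for i
      proof -
        have "Z (t n) i - X i = (Y i - X i) + t n *\<^sub>R \<zeta> i" by (simp add: Z_def)
        then show ?thesis
          by (simp only: power2_norm_eq_inner inner_add_left inner_add_right)
            (simp add: inner_commute power2_eq_square)
      qed
      then show ?thesis
        unfolding sqmean_def e_def by (simp add: integrable_finite_pmf[OF fin])
    qed
    also have "(1 - m) * ((sqmean p (\<lambda>i. Y i - X i) + 2 * t n * e + (t n)\<^sup>2 * sqmean p \<zeta>) / (2 * \<tau>) - sqmean p (\<lambda>i. Y i - X i) / (2 * \<tau>)) / t n =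
        (1 - m) * (e / \<tau> + t n * sqmean p \<zeta> / (2 * \<tau>))"
      using t(1)[of n] \<tau> by (simp add: field_simps power2_eq_square)
    finally show ?thesis .
  qed
  have "(\<lambda>n. (1 - m) * (e / \<tau> + t n * sqmean p \<zeta> / (2 * \<tau>))) \<longlonglongrightarrow> (1 - m) * (e / \<tau> + 0 * sqmean p \<zeta> / (2 * \<tau>))"
    using \<tau> by (intro tendsto_intros t0) auto
  then have "(LINT y|lborel. m * (U y 0 powr (m - 1) * DU y 0)) \<le> (1 - m) * (e / \<tau> + 0 * sqmean p \<zeta> / (2 * \<tau>))"
    using q_int by (intro LIMSEQ_le[OF lim]) auto
  moreover have "(LINT y|lborel. m * (U y 0 powr (m - 1) * DU y 0)) = m * expect p (\<lambda>i. \<zeta> i \<bullet> field (law p Y) (Y i))"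
  proof -
    have iF: "integrable lborel (\<lambda>y. U y 0 powr (m - 1) *\<^sub>R DV (Y i - y))" for i
      using integrable_field[OF law_M[of 0] M] by (simp add: U_def Z0)
    have "(LINT y|lborel. U y 0 powr (m - 1) * DU y 0) =
        (LINT y|lborel. (\<Sum>i\<in>set_pmf p. (\<zeta> i \<bullet> (U y 0 powr (m - 1) *\<^sub>R DV (Y i - y))) * pmf p i))"
      by (simp add: DU_def Z0 sum_distrib_left mult_ac)
    also have "\<dots> = (\<Sum>i\<in>set_pmf p. (LINT y|lborel. \<zeta> i \<bullet> (U y 0 powr (m - 1) *\<^sub>R DV (Y i - y))) * pmf p i)"
      by (subst Bochner_Integration.integral_sum) (intro integrable_mult_left integrable_inner_right iF, simp)
    also have "\<dots> = (\<Sum>i\<in>set_pmf p. (\<zeta> i \<bullet> (LINT y|lborel. U y 0 powr (m - 1) *\<^sub>R DV (Y i - y))) * pmf p i)"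
      by (intro sum.cong refl arg_cong2[where f="(*)"] integral_inner_right iF)
    also have "\<dots> = expect p (\<lambda>i. \<zeta> i \<bullet> field (law p Y) (Y i))"
      by (simp add: expect_sum[OF fin] field_eq U_def Z0)
    finally show ?thesis by simp
  qed
  ultimately have "m * expect p (\<lambda>i. \<zeta> i \<bullet> field (law p Y) (Y i)) \<le> (1 - m) * (e / \<tau> + 0 * sqmean p \<zeta> / (2 * \<tau>))"
    by (simp only:)
  then have "m * expect p (\<lambda>i. \<zeta> i \<bullet> field (law p Y) (Y i)) \<le> (1 - m) * (e / \<tau>)" by simp
  then have "m * expect p (\<lambda>i. \<zeta> i \<bullet> field (law p Y) (Y i)) / (1 - m) \<le> (1 - m) * (e / \<tau>) / (1 - m)"
    using m by (intro divide_right_mono) auto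
  then show ?thesis using m by (simp add: \<kappa>_def e_def)
qed

text \<open>The second condition is the Euler-Lagrange equation of the minimization defining \<open>Y\<close>.\<close>

definition implicit_step :: "'i pmf \<Rightarrow> real \<Rightarrow> ('i \<Rightarrow> 'a) \<Rightarrow> ('i \<Rightarrow> 'a) \<Rightarrow> bool" where
  "implicit_step p \<tau> X Y \<longleftrightarrow>
     sqmean p (\<lambda>i. Y i - X i) / (2 * \<tau>) + internal_energy p X \<le> internal_energy p Y \<and>
     (\<forall>i\<in>set_pmf p. Y i - X i = (\<tau> * \<kappa>) *\<^sub>R field (law p Y) (Y i))"

text \<open>Testing the first variation with the residual of the equation shows that its mean square
  is at most 0, so it vanishes at every particle of positive weight. Comparison of the minimizer
  with the old positions gives the energy inequality.\<close>

lemma minimizing_step: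
  fixes X :: "'i \<Rightarrow> 'a"
  assumes fin: "finite (set_pmf p)" and \<tau>: "\<tau> > 0"
  shows "\<exists>Y. implicit_step p \<tau> X Y"
proof -
  obtain Y where Y: "\<And>Z. sqmean p (\<lambda>i. Y i - X i) / (2 * \<tau>) - internal_energy p Y \<le> sqmean p (\<lambda>i. Z i - X i) / (2 * \<tau>) - internal_energy p Z"
    using minimizer_exists[OF fin \<tau>] by blast
  define \<zeta> where "\<zeta> i = \<kappa> *\<^sub>R field (law p Y) (Y i) - (Y i - X i) /\<^sub>R \<tau>" for i
  have "sqmean p \<zeta> = expect p (\<lambda>i. \<kappa> * (\<zeta> i \<bullet> field (law p Y) (Y i)) - (\<zeta> i \<bullet> (Y i - X i)) / \<tau>)"
    unfolding sqmean_def power2_norm_eq_inner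
    by (subst (2) \<zeta>_def) (simp add: inner_diff_right divide_inverse mult_ac)
  also have "\<dots> = \<kappa> * expect p (\<lambda>i. \<zeta> i \<bullet> field (law p Y) (Y i)) - expect p (\<lambda>i. \<zeta> i \<bullet> (Y i - X i)) / \<tau>"
    using fin by (subst Bochner_Integration.integral_diff) auto
  also have "\<dots> \<le> 0" using Euler_Lagrange_le[OF fin \<tau> Y, of \<zeta>] by simp
  finally have "sqmean p \<zeta> = 0" using sqmean_nonneg[of p \<zeta>] by simp
  then have "\<forall>i\<in>set_pmf p. (norm (\<zeta> i))\<^sup>2 * pmf p i = 0"
    unfolding sqmean_def expect_sum[OF fin] by (subst (asm) sum_nonneg_eq_0_iff[OF fin]) auto
  then have "\<zeta> i = 0" if "i \<in> set_pmf p" for i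
    using that by (auto simp: set_pmf_iff)
  then have "Y i - X i = (\<tau> * \<kappa>) *\<^sub>R field (law p Y) (Y i)" if "i \<in> set_pmf p" for i
  proof -
    have "\<kappa> *\<^sub>R field (law p Y) (Y i) = (Y i - X i) /\<^sub>R \<tau>"
      using \<open>\<And>i. i \<in> set_pmf p \<Longrightarrow> \<zeta> i = 0\<close>[OF that] by (simp add: \<zeta>_def)
    then have "\<tau> *\<^sub>R (\<kappa> *\<^sub>R field (law p Y) (Y i)) = \<tau> *\<^sub>R ((Y i - X i) /\<^sub>R \<tau>)" by simp
    then show ?thesis using \<tau> by simp
  qed
  moreover have "sqmean p (\<lambda>i. Y i - X i) / (2 * \<tau>) + internal_energy p X \<le> internal_energy p Y"
    using Y[of X] by (simp add: sqmean_def)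
  ultimately show ?thesis unfolding implicit_step_def by blast
qed

end

section \<open>Finite approximation, time steps and test functions\<close>

text \<open>The identity is the limit of simple functions with norm at most 2|x|, and the image
  measures under them have finite support. The factor 2 becomes 4 in the second moment.\<close>

lemma finite_pmf_approximation:
  fixes \<rho> :: "'a::euclidean_space measure"
  assumes \<rho>: "\<rho> \<in> moment_le M" and M: "M \<ge> 0"
  obtains p :: "nat \<Rightarrow> 'a pmf" where "\<And>n. finite (set_pmf (p n))" "\<And>n. sqmean (p n) (\<lambda>x. x) \<le> 4 * M"
    "\<And>f B. continuous_on UNIV f \<Longrightarrow> (\<And>x. \<bar>f x\<bar> \<le> B) \<Longrightarrow> (\<lambda>n. expect (p n) f) \<longlonglongrightarrow> (LINT x|\<rho>. f x)"
proof -
  interpret prob_space \<rho> using \<rho> by (simp add: moment_le_def)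
  have sets: "sets \<rho> = sets borel" using \<rho> by (simp add: moment_le_def)
  have sp: "space \<rho> = UNIV" using sets_eq_imp_space_eq[OF sets] by simp
  have "(\<lambda>x::'a. x) \<in> borel_measurable \<rho>" using sets by (simp add: measurable_def sp)
  from borel_measurable_implies_sequence_metric[OF this, of 0] obtain s where
    s: "\<And>n. simple_function \<rho> (s n)" "\<And>x. (\<lambda>n. s n x) \<longlonglongrightarrow> x" "\<And>n x. norm (s n x) \<le> 2 * norm x"
    by (auto simp: sp)
  have ms: "s n \<in> measurable \<rho> (count_space UNIV)" for n
    using s(1)[of n] by (simp add: measurable_simple_function)
  have msb: "s n \<in> borel_measurable \<rho>" for n
    using s(1)[of n] by (rule borel_measurable_simple_function)
  have fin: "finite (range (s n))" for n
    using s(1)[of n] by (simp add: simple_function_def sp)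
  define D where "D n = distr \<rho> (count_space UNIV) (s n)" for n
  \<comment> \<open>The condition under which \<open>Abs_pmf\<close> loses nothing: almost every
    point is an atom. The finite range leaves only finitely many values to check.\<close>
  have ae: "AE x in D n. measure (D n) {x} \<noteq> 0" for n
  proof -
    have "AE \<omega> in \<rho>. \<forall>a\<in>range (s n). s n \<omega> = a \<longrightarrow> measure (D n) {a} \<noteq> 0"
    proof (rule AE_finite_allI[OF fin])
      fix a
      show "AE \<omega> in \<rho>. s n \<omega> = a \<longrightarrow> measure (D n) {a} \<noteq> 0"
      proof (cases "measure (D n) {a} = 0")
        case True
        then have "measure \<rho> (s n -` {a} \<inter> space \<rho>) = 0"
          using ms[of n] by (simp add: D_def measure_distr)
        moreover have "s n -` {a} \<inter> space \<rho> \<in> sets \<rho>"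
          using measurable_sets[OF ms[of n], of "{a}"] by simp
        ultimately have "AE \<omega> in \<rho>. \<omega> \<notin> s n -` {a} \<inter> space \<rho>"
          by (intro AE_not_in null_setsI) (simp_all add: emeasure_eq_measure)
        then show ?thesis by eventually_elim (auto simp: sp)
      qed simp
    qed
    then have "AE \<omega> in \<rho>. measure (D n) {s n \<omega>} \<noteq> 0" by eventually_elim auto
    then show ?thesis unfolding D_def by (subst AE_distr_iff[OF ms]) auto
  qed
  have "prob_space (D n)" "sets (D n) = UNIV" for n
    unfolding D_def by (intro prob_space_distr ms) simp
  then have D: "measure_pmf (Abs_pmf (D n)) = D n" for n
    using ae by (intro Abs_pmf_inverse) simp
  define p where "p n = Abs_pmf (D n)" for n
  have ex: "expect (p n) f = (LINT x|\<rho>. f (s n x))" for n and f :: "'a \<Rightarrow> real"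
    unfolding p_def D unfolding D_def by (intro integral_distr ms) auto
  show thesis
  proof
    have sub: "set_pmf (p n) \<subseteq> range (s n)" for n
    proof -
      have "AE x in measure_pmf (p n). x \<in> range (s n)"
        unfolding p_def D unfolding D_def by (subst AE_distr_iff[OF ms]) auto
      then show ?thesis by (auto simp: AE_measure_pmf_iff)
    qed
    then show finp: "finite (set_pmf (p n))" for n
      using fin finite_subset by blast
    note i2 = moment_le_second_moment[OF \<rho> M]
    show "sqmean (p n) (\<lambda>x. x) \<le> 4 * M" for n
    proof -
      have le: "(norm (s n x))\<^sup>2 \<le> 4 * (norm x)\<^sup>2" for x
        using power_mono[OF s(3)[of n x], of 2] by (simp add: power_mult_distrib)
      have "(LINT x|\<rho>. (norm (s n x))\<^sup>2) \<le> (LINT x|\<rho>. 4 * (norm x)\<^sup>2)"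
      proof (rule integral_mono)
        show "integrable \<rho> (\<lambda>x. 4 * (norm x)\<^sup>2)" using i2(1) by simp
        then show "integrable \<rho> (\<lambda>x. (norm (s n x))\<^sup>2)"
          by (rule Bochner_Integration.integrable_bound) (use le msb[of n] in auto)
      qed (rule le)
      then show ?thesis unfolding sqmean_def ex using i2 by simp
    qed
    fix f :: "'a \<Rightarrow> real" and B assume f: "continuous_on UNIV f" "\<And>x. \<bar>f x\<bar> \<le> B"
    have fm: "f \<in> borel_measurable borel" using f(1) by (rule borel_measurable_continuous_onI)
    show "(\<lambda>n. expect (p n) f) \<longlonglongrightarrow> (LINT x|\<rho>. f x)"
      unfolding ex
    proof (rule integral_dominated_convergence[where w="\<lambda>_. B"])
      show "f \<in> borel_measurable \<rho>" by (rule moment_le_measurable[OF \<rho> fm])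
      show "(\<lambda>x. f (s n x)) \<in> borel_measurable \<rho>" for n
        by (rule measurable_compose[OF msb fm])
      show "AE x in \<rho>. (\<lambda>n. f (s n x)) \<longlonglongrightarrow> f x"
        using f(1) by (intro AE_I2 isCont_tendsto_compose[of _ f] s(2)) (simp add: continuous_on_eq_continuous_at)
    qed (use f(2) in auto)
  qed
qed

section \<open>Quadratic means of displacements\<close>

definition rms :: "'i pmf \<Rightarrow> ('i \<Rightarrow> 'a::euclidean_space) \<Rightarrow> real" where
  "rms p X = sqrt (sqmean p X)"

lemma rms_nonneg: "0 \<le> rms p X"
  by (simp add: rms_def sqmean_nonneg)

lemma rms_squared: "(rms p X)\<^sup>2 = sqmean p X"
  by (simp add: rms_def sqmean_nonneg)

text \<open>Minkowski's inequality: with each displacement scaled by the square root of its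
  probability, the quadratic mean is a Euclidean norm.\<close>

lemma rms_add_le:
  assumes fin: "finite (set_pmf p)"
  shows "rms p (\<lambda>i. X i + Y i) \<le> rms p X + rms p Y"
proof -
  have eq: "rms p Z = L2_set (\<lambda>i. norm (Z i) * sqrt (pmf p i)) (set_pmf p)" for Z :: "'a \<Rightarrow> 'b"
    unfolding rms_def sqmean_def expect_sum[OF fin] L2_set_def
    by (simp add: power_mult_distrib)
  have "rms p (\<lambda>i. X i + Y i) \<le> L2_set (\<lambda>i. norm (X i) * sqrt (pmf p i) + norm (Y i) * sqrt (pmf p i)) (set_pmf p)"
    unfolding eq
    by (intro L2_set_mono) (auto simp: distrib_right[symmetric] intro!: mult_right_mono norm_triangle_ineq)
  also have "\<dots> \<le> rms p X + rms p Y"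
    unfolding eq by (rule L2_set_triangle_ineq)
  finally show ?thesis .
qed

lemma expect_norm_le_rms:
  assumes fin: "finite (set_pmf p)"
  shows "expect p (\<lambda>i. norm (X i)) \<le> rms p X"
proof -
  define c where "c = expect p (\<lambda>i. norm (X i))"
  have "0 \<le> expect p (\<lambda>i. (norm (X i) - c)\<^sup>2)" by (intro integral_nonneg_AE) auto
  also have "\<dots> = expect p (\<lambda>i. (norm (X i))\<^sup>2 - 2 * c * norm (X i) + c\<^sup>2)"
    by (simp add: power2_diff algebra_simps)
  also have "\<dots> = sqmean p X - c\<^sup>2"
    by (simp add: integrable_finite_pmf[OF fin] sqmean_def c_def[symmetric] power2_eq_square)
  finally have "c\<^sup>2 \<le> sqmean p X" by simp
  then show ?thesis unfolding c_def rms_def by (rule real_le_rsqrt)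
qed

lemma rms_path_le:
  assumes fin: "finite (set_pmf p)" and "k \<le> l"
  shows "rms p (\<lambda>i. X l i - X k i) \<le> (\<Sum>j\<in>{k..<l}. rms p (\<lambda>i. X (Suc j) i - X j i))"
  using \<open>k \<le> l\<close>
proof (induction l rule: dec_induct)
  case base
  show ?case by (simp add: rms_def sqmean_def)
next
  case (step l)
  have "rms p (\<lambda>i. X (Suc l) i - X k i) \<le> rms p (\<lambda>i. X (Suc l) i - X l i) + rms p (\<lambda>i. X l i - X k i)"
    using rms_add_le[OF fin, of "\<lambda>i. X (Suc l) i - X l i" "\<lambda>i. X l i - X k i"] by simp
  then show ?case using step by simp
qed

text \<open>The Arzela-Ascoli argument with a defect: step curves are equicontinuous only up to
  their mesh \<open>e n\<close>, and since this tends to 0, convergence still passes from rational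
  times to all times.\<close>

lemma equicontinuous_convergent:
  fixes F :: "nat \<Rightarrow> real \<Rightarrow> real"
  assumes conv: "\<And>q. q \<in> \<rat> \<Longrightarrow> convergent (\<lambda>n. F n q)" and e: "e \<longlonglongrightarrow> 0" and C: "C \<ge> 0"
    and equi: "\<And>n s t. \<bar>F n t - F n s\<bar> \<le> C * sqrt (\<bar>t - s\<bar> + e n)"
  shows "convergent (\<lambda>n. F n t)"
proof -
  have "Cauchy (\<lambda>n. F n t)"
  proof (rule metric_CauchyI)
    fix \<epsilon> :: real assume \<epsilon>: "\<epsilon> > 0"
    define d where "d = (\<epsilon> / (3 * (C + 1)))\<^sup>2"
    have d: "d > 0" using \<epsilon> C by (simp add: d_def)
    obtain q where q: "q \<in> \<rat>" "t < q" "q < t + d / 2"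
      using Rats_dense_in_real[of t "t + d / 2"] d by auto
    have "\<forall>\<^sub>F n in sequentially. e n < d / 2"
      using d by (intro order_tendstoD(2)[OF e]) auto
    then obtain N where N: "\<And>n. n \<ge> N \<Longrightarrow> e n < d / 2" by (auto simp: eventually_sequentially)
    have near: "\<bar>F n t - F n q\<bar> < \<epsilon> / 3" if "n \<ge> N" for n
    proof -
      have "\<bar>F n t - F n q\<bar> \<le> C * sqrt (\<bar>t - q\<bar> + e n)" by (rule equi)
      also have "\<dots> \<le> C * sqrt d"
        using C q N[OF that] by (intro mult_left_mono real_sqrt_le_mono) auto
      also have "\<dots> = C * (\<epsilon> / (3 * (C + 1)))"
        using \<epsilon> C by (simp add: d_def real_sqrt_abs abs_of_nonneg)
      also have "\<dots> < \<epsilon> / 3" using \<epsilon> C by (simp add: field_simps)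
      finally show ?thesis .
    qed
    have "Cauchy (\<lambda>n. F n q)" using conv[OF q(1)] by (rule convergent_Cauchy)
    then obtain N' where N': "\<And>m n. m \<ge> N' \<Longrightarrow> n \<ge> N' \<Longrightarrow> \<bar>F m q - F n q\<bar> < \<epsilon> / 3"
      using metric_CauchyD[of "\<lambda>n. F n q" "\<epsilon> / 3"] \<epsilon> by (auto simp: dist_real_def)
    show "\<exists>N. \<forall>m\<ge>N. \<forall>n\<ge>N. dist (F m t) (F n t) < \<epsilon>"
    proof (intro exI[of _ "max N N'"] allI impI)
      fix m n assume "m \<ge> max N N'" "n \<ge> max N N'"
      then have "\<bar>F m t - F m q\<bar> < \<epsilon> / 3" "\<bar>F n t - F n q\<bar> < \<epsilon> / 3" "\<bar>F m q - F n q\<bar> < \<epsilon> / 3"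
        using near[of m] near[of n] N'[of m n] by auto
      then show "dist (F m t) (F n t) < \<epsilon>"
        unfolding dist_real_def by linarith
    qed
  qed
  then show ?thesis by (rule Cauchy_convergent)
qed

section \<open>Integrals of step functions in time\<close>

lemma set_integrable_const_Ioc: "set_integrable lborel {a<..b::real} (\<lambda>_. c::real)"
  unfolding set_integrable_def
  by (cases "a \<le> b") (auto intro!: integrable_scaleR_left integrable_real_indicator)

text \<open>Rounding up matches the implicit scheme: the interval from \<open>j * \<tau>\<close> to
  \<open>(j + 1) * \<tau>\<close> carries the value \<open>g (Suc j)\<close> after the step. The
  value \<open>g 0\<close> occurs, for nonnegative times, only at time 0.\<close>

lemma integral_step_function:
  fixes g :: "nat \<Rightarrow> real"
  assumes \<tau>: "\<tau> > 0"
  shows "set_integrable lborel {0..real k * \<tau>} (\<lambda>s. g (nat \<lceil>s / \<tau>\<rceil>)) \<and>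
    (LBINT s:{0..real k * \<tau>}. g (nat \<lceil>s / \<tau>\<rceil>)) = (\<Sum>j<k. \<tau> * g (Suc j))"
proof (induction k)
  case 0
  have "set_integrable lborel {0::real} (\<lambda>s. g (nat \<lceil>s / \<tau>\<rceil>))"
    by (rule set_integrable_cong[THEN iffD1, OF refl refl, of _ "\<lambda>_. g 0"])
      (auto simp: set_integrable_def)
  moreover have "(LBINT s:{0::real}. g (nat \<lceil>s / \<tau>\<rceil>)) = (LBINT s:{0::real}. g 0)"
    by (intro set_lebesgue_integral_cong) auto
  ultimately show ?case by (simp add: set_integral_const)
next
  case (Suc k)
  let ?a = "real k * \<tau>" and ?b = "real (Suc k) * \<tau>"
  have ab: "?a \<le> ?b" "?b - ?a = \<tau>" using \<tau> by (auto simp: algebra_simps)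
  have U: "{0..?b} = {0..?a} \<union> {?a<..?b}" using ab \<tau> by (intro ivl_disj_un_two(8)[symmetric]) auto
  have c: "g (nat \<lceil>s / \<tau>\<rceil>) = g (Suc k)" if "s \<in> {?a<..?b}" for s
  proof -
    have "real k < s / \<tau>" "s / \<tau> \<le> real (Suc k)" using that \<tau> by (auto simp: field_simps)
    then have "\<lceil>s / \<tau>\<rceil> = int (Suc k)" by (intro ceiling_unique) auto
    then show ?thesis by (simp only: nat_int)
  qed
  have i: "set_integrable lborel {?a<..?b} (\<lambda>s. g (nat \<lceil>s / \<tau>\<rceil>))"
    by (rule set_integrable_cong[THEN iffD2, OF refl refl c]) (auto intro: set_integrable_const_Ioc)
  have "(LBINT s:{?a<..?b}. g (nat \<lceil>s / \<tau>\<rceil>)) = (LBINT s:{?a<..?b}. g (Suc k))"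
    by (intro set_lebesgue_integral_cong) (auto simp: c)
  also have "\<dots> = \<tau> * g (Suc k)" using ab by (simp add: set_lebesgue_integral_def)
  finally have v: "(LBINT s:{?a<..?b}. g (nat \<lceil>s / \<tau>\<rceil>)) = \<tau> * g (Suc k)" .
  show ?case
    unfolding U
  proof
    show "set_integrable lborel ({0..?a} \<union> {?a<..?b}) (\<lambda>s. g (nat \<lceil>s / \<tau>\<rceil>))"
      using Suc i by (intro set_integrable_Un) auto
    have "(LBINT s:{0..?a} \<union> {?a<..?b}. g (nat \<lceil>s / \<tau>\<rceil>)) =
        (LBINT s:{0..?a}. g (nat \<lceil>s / \<tau>\<rceil>)) + (LBINT s:{?a<..?b}. g (nat \<lceil>s / \<tau>\<rceil>))"
      using Suc i by (intro set_integral_Un) auto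
    then show "(LBINT s:{0..?a} \<union> {?a<..?b}. g (nat \<lceil>s / \<tau>\<rceil>)) = (\<Sum>j<Suc k. \<tau> * g (Suc j))"
      unfolding v using Suc by simp
  qed
qed

text \<open>The sum runs over whole steps, up to the first grid point not before t. It therefore
  exceeds the integral by the part over an interval of length at most \<open>\<tau>\<close>.\<close>

lemma integral_step_function_error:
  fixes g :: "nat \<Rightarrow> real"
  assumes \<tau>: "\<tau> > 0" and t: "t \<ge> 0" and B: "\<And>j. j \<le> nat \<lceil>t / \<tau>\<rceil> \<Longrightarrow> \<bar>g j\<bar> \<le> B"
  shows "\<bar>(\<Sum>j<nat \<lceil>t / \<tau>\<rceil>. \<tau> * g (Suc j)) - (LBINT s:{0..t}. g (nat \<lceil>s / \<tau>\<rceil>))\<bar> \<le> \<tau> * B"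
proof -
  define k where "k = nat \<lceil>t / \<tau>\<rceil>"
  let ?g = "\<lambda>s. g (nat \<lceil>s / \<tau>\<rceil>)"
  have "0 \<le> t / \<tau>" using t \<tau> by simp
  then have k: "t / \<tau> \<le> real k" "real k \<le> t / \<tau> + 1" unfolding k_def by linarith+
  then have tk: "t \<le> real k * \<tau>" "real k * \<tau> \<le> t + \<tau>" using \<tau> by (auto simp: field_simps)
  have i: "set_integrable lborel {0..real k * \<tau>} ?g" and v: "(LBINT s:{0..real k * \<tau>}. ?g s) = (\<Sum>j<k. \<tau> * g (Suc j))"
    using integral_step_function[OF \<tau>, of k g] by auto
  have U: "{0..real k * \<tau>} = {0..t} \<union> {t<..real k * \<tau>}" using tk t by (intro ivl_disj_un_two(8)[symmetric]) auto
  have i1: "set_integrable lborel {0..t} ?g" and i2: "set_integrable lborel {t<..real k * \<tau>} ?g"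
    using tk t by (auto intro: set_integrable_subset[OF i])
  have "(\<Sum>j<k. \<tau> * g (Suc j)) - (LBINT s:{0..t}. ?g s) = (LBINT s:{t<..real k * \<tau>}. ?g s)"
    unfolding v[symmetric] U using i1 i2 by (subst set_integral_Un) auto
  also have "\<bar>\<dots>\<bar> \<le> (LBINT s:{t<..real k * \<tau>}. B)"
  proof -
    have gB: "\<bar>?g s\<bar> \<le> B" if "s \<in> {t<..real k * \<tau>}" for s
    proof -
      have "s / \<tau> \<le> real k" using that \<tau> by (simp add: field_simps)
      then have "nat \<lceil>s / \<tau>\<rceil> \<le> k" by (simp add: ceiling_le_iff nat_le_iff)
      then show ?thesis by (intro B) (simp add: k_def)
    qed
    show ?thesis
      unfolding set_lebesgue_integral_def real_norm_def[symmetric]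
      by (rule Bochner_Integration.integral_norm_bound_integral[OF i2[unfolded set_integrable_def]
            set_integrable_const_Ioc[unfolded set_integrable_def]]) (auto simp: gB split: split_indicator)
  qed
  also have "\<dots> = (real k * \<tau> - t) * B" using tk by (simp add: set_lebesgue_integral_def)
  also have "\<dots> \<le> \<tau> * B"
    using tk B[of 0] by (intro mult_right_mono) auto
  finally show ?thesis by (simp add: k_def)
qed

section \<open>Test functions\<close>

lemma differentiable_GDERIV:
  fixes f :: "'a::euclidean_space \<Rightarrow> real"
  assumes "f differentiable (at x)"
  shows "GDERIV f x :> grad f x"
proof -
  obtain f' where f': "(f has_derivative f') (at x)" using assms by (auto simp: differentiable_def)
  interpret bounded_linear f' using f' by (rule has_derivative_bounded_linear)
  have "f' h = h \<bullet> (\<Sum>b\<in>Basis. f' b *\<^sub>R b)" for h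
  proof -
    have "f' h = f' (\<Sum>b\<in>Basis. (h \<bullet> b) *\<^sub>R b)" by (simp add: euclidean_representation)
    also have "\<dots> = (\<Sum>b\<in>Basis. (h \<bullet> b) * f' b)" by (simp add: sum scale)
    also have "\<dots> = h \<bullet> (\<Sum>b\<in>Basis. f' b *\<^sub>R b)" by (simp add: inner_sum_right mult.commute)
    finally show ?thesis .
  qed
  then have "f' = (\<lambda>h. h \<bullet> (\<Sum>b\<in>Basis. f' b *\<^sub>R b))" by blast
  with f' have "GDERIV f x :> (\<Sum>b\<in>Basis. f' b *\<^sub>R b)" by (simp add: gderiv_def)
  then show ?thesis by (simp add: grad_eqI)
qed

lemma C1c_E:
  fixes \<phi> :: "'a::euclidean_space \<Rightarrow> real"
  assumes "\<phi> \<in> C1c"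
  obtains R where "R > 0" "\<And>x. norm x > R \<Longrightarrow> \<phi> x = 0" "\<And>x. norm x > R \<Longrightarrow> grad \<phi> x = 0"
    "\<And>x. GDERIV \<phi> x :> grad \<phi> x" "continuous_on UNIV (grad \<phi>)" "continuous_on UNIV \<phi>"
proof -
  have diff: "\<And>x. \<phi> differentiable (at x)" and cont: "continuous_on UNIV (grad \<phi>)"
    and comp: "compact (closure (support_on UNIV \<phi>))"
    using assms by (auto simp: C1c_def)
  obtain R where R: "R > 0" "\<And>x. x \<in> closure (support_on UNIV \<phi>) \<Longrightarrow> norm x \<le> R"
    using compact_imp_bounded[OF comp] by (auto simp: bounded_pos)
  have zero: "\<phi> x = 0" if "norm x > R" for x
    using R(2)[of x] that closure_subset[of "support_on UNIV \<phi>"] by (force simp: support_on_def)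
  have "grad \<phi> x = 0" if "norm x > R" for x
  proof (rule grad_eqI)
    have "((\<lambda>_. 0) has_derivative (\<lambda>h. h \<bullet> 0)) (at x)" by simp
    moreover have "open {x::'a. norm x > R}" by (intro open_Collect_less continuous_intros)
    ultimately show "GDERIV \<phi> x :> 0"
      unfolding gderiv_def using that zero
      by (auto intro: has_derivative_transform_within_open[of "\<lambda>_. 0"])
  qed
  moreover have "continuous_on UNIV \<phi>"
    using diff by (simp add: differentiable_imp_continuous_within continuous_on_eq_continuous_within)
  ultimately show thesis using that R(1) zero differentiable_GDERIV[OF diff] cont by blast
qed

lemma compact_support_bounded:
  fixes f :: "'a::euclidean_space \<Rightarrow> real"
  assumes "continuous_on UNIV f" "\<And>x. norm x > R \<Longrightarrow> f x = 0"
  obtains B where "B > 0" "\<And>x. \<bar>f x\<bar> \<le> B"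
proof -
  have "compact (f ` cball 0 R)"
    by (intro compact_continuous_image continuous_on_subset[OF assms(1)]) auto
  then obtain B where "B > 0" "\<forall>y\<in>f ` cball 0 R. norm y \<le> B"
    using compact_imp_bounded bounded_pos by blast
  then have B: "B > 0" "\<And>x. norm x \<le> R \<Longrightarrow> \<bar>f x\<bar> \<le> B" by auto
  have "\<bar>f x\<bar> \<le> B" for x
    using B assms(2)[of x] by (cases "norm x \<le> R") auto
  then show thesis using B that by blast
qed

text \<open>The gradient is only continuous, so the remainder need not be quadratic. Short
  increments use its uniform continuity; for those of length at least \<open>\<delta>\<close>, the
  bound 2G|b - a| becomes quadratic after division by \<open>\<delta>\<close>. Summed over the
  steps, the linear term meets the bounded total length and the quadratic term meets the action,
  which carries a factor of the mesh.\<close>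

lemma C1c_Taylor:
  fixes \<phi> :: "'a::euclidean_space \<Rightarrow> real"
  assumes "\<phi> \<in> C1c" "\<eta> > 0"
  obtains C where "C \<ge> 0" "\<And>a b. \<bar>\<phi> b - \<phi> a - grad \<phi> b \<bullet> (b - a)\<bar> \<le> \<eta> * norm (b - a) + C * (norm (b - a))\<^sup>2"
proof -
  obtain R where R: "R > 0" "\<And>x. norm x > R \<Longrightarrow> grad \<phi> x = 0"
    and der: "\<And>x. GDERIV \<phi> x :> grad \<phi> x" and cont: "continuous_on UNIV (grad \<phi>)"
    using C1c_E[OF assms(1)] by metis
  obtain G where "G > 0" "\<And>x. \<bar>norm (grad \<phi> x)\<bar> \<le> G"
    by (rule compact_support_bounded[of "\<lambda>x. norm (grad \<phi> x)" R])
      (use R cont in \<open>auto intro: continuous_intros\<close>)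
  then have G: "G > 0" "\<And>x. norm (grad \<phi> x) \<le> G" by auto
  have "uniformly_continuous_on (cball 0 (R + 1)) (grad \<phi>)"
    by (intro compact_uniformly_continuous continuous_on_subset[OF cont]) auto
  then obtain d where d: "d > 0" "\<And>x y. x \<in> cball 0 (R + 1) \<Longrightarrow> y \<in> cball 0 (R + 1) \<Longrightarrow> dist x y < d \<Longrightarrow> dist (grad \<phi> x) (grad \<phi> y) < \<eta>"
    using assms(2) unfolding uniformly_continuous_on_def by metis
  \<comment> \<open>Since \<open>\<delta>\<close> is at most 1, two points this close both lie
    outside the ball of radius R as soon as one of them lies outside that of radius R + 1; the
    gradient vanishes at both.\<close>
  define \<delta> where "\<delta> = min d 1"
  have \<delta>: "\<delta> > 0" using d by (simp add: \<delta>_def)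
  have uc: "norm (grad \<phi> x - grad \<phi> y) \<le> \<eta>" if "norm (x - y) < \<delta>" for x y
  proof (cases "norm x \<le> R + 1 \<and> norm y \<le> R + 1")
    case True
    then show ?thesis using d(2)[of x y] that by (auto simp: dist_norm \<delta>_def)
  next
    case False
    then have "norm x > R" "norm y > R"
      using that norm_triangle_sub[of x y] norm_triangle_sub[of y x] by (auto simp: \<delta>_def norm_minus_commute)
    then show ?thesis using R(2) assms(2) by simp
  qed
  have bound: "\<bar>\<phi> b - \<phi> a - grad \<phi> b \<bullet> (b - a)\<bar> \<le> H * norm (b - a)"
    if H: "\<And>z. z \<in> closed_segment a b \<Longrightarrow> norm (grad \<phi> z - grad \<phi> b) \<le> H" for a b H
  proof -
    have "norm ((\<phi> b - grad \<phi> b \<bullet> b) - (\<phi> a - grad \<phi> b \<bullet> a)) \<le> H * norm (b - a)"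
    proof (rule differentiable_bound[of "closed_segment a b" _ "\<lambda>z h. h \<bullet> (grad \<phi> z - grad \<phi> b)"])
      fix z assume z: "z \<in> closed_segment a b"
      have "(\<phi> has_derivative (\<lambda>h. h \<bullet> grad \<phi> z)) (at z within closed_segment a b)"
        using der[of z] unfolding gderiv_def by (rule has_derivative_at_withinI)
      then show "((\<lambda>z. \<phi> z - grad \<phi> b \<bullet> z) has_derivative (\<lambda>h. h \<bullet> (grad \<phi> z - grad \<phi> b))) (at z within closed_segment a b)"
        by (auto intro!: derivative_eq_intros simp: inner_diff_right inner_commute)
      show "onorm (\<lambda>h. h \<bullet> (grad \<phi> z - grad \<phi> b)) \<le> H"
      proof (rule onorm_le)
        show "norm (h \<bullet> (grad \<phi> z - grad \<phi> b)) \<le> H * norm h" for h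
          using Cauchy_Schwarz_ineq2[of h "grad \<phi> z - grad \<phi> b"] mult_left_mono[OF H[OF z], of "norm h"]
          by (simp add: mult.commute)
      qed
    qed auto
    then show ?thesis by (simp add: inner_diff_right algebra_simps)
  qed
  show thesis
  proof
    show "0 \<le> 2 * G / \<delta>" using G \<delta> by simp
    fix a b
    show "\<bar>\<phi> b - \<phi> a - grad \<phi> b \<bullet> (b - a)\<bar> \<le> \<eta> * norm (b - a) + 2 * G / \<delta> * (norm (b - a))\<^sup>2"
    proof (cases "norm (b - a) < \<delta>")
      case True
      have "\<bar>\<phi> b - \<phi> a - grad \<phi> b \<bullet> (b - a)\<bar> \<le> \<eta> * norm (b - a)"
      proof (rule bound, rule uc)
        fix z assume "z \<in> closed_segment a b"
        then have "norm (z - b) \<le> norm (b - a)"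
          using segment_bound(2)[of z a b] by (simp add: norm_minus_commute)
        then show "norm (z - b) < \<delta>" using True by simp
      qed
      then show ?thesis using G \<delta> by (smt (verit) divide_nonneg_pos mult_nonneg_nonneg zero_le_power2)
    next
      case False
      have "\<bar>\<phi> b - \<phi> a - grad \<phi> b \<bullet> (b - a)\<bar> \<le> (2 * G) * norm (b - a)"
      proof (rule bound)
        show "norm (grad \<phi> z - grad \<phi> b) \<le> 2 * G" for z
          using norm_triangle_ineq4[of "grad \<phi> z" "grad \<phi> b"] G(2)[of z] G(2)[of b] by simp
      qed
      also have "\<dots> \<le> 2 * G / \<delta> * (norm (b - a))\<^sup>2"
      proof -
        have "1 \<le> norm (b - a) / \<delta>" using False \<delta> by simp
        then have "(2 * G) * norm (b - a) * 1 \<le> (2 * G) * norm (b - a) * (norm (b - a) / \<delta>)"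
          using G by (intro mult_left_mono) auto
        then show ?thesis by (simp add: power2_eq_square)
      qed
      finally show ?thesis using assms(2) by (smt (verit) mult_nonneg_nonneg norm_ge_zero)
    qed
  qed
qed

section \<open>The discrete curves\<close>

definition mesh :: "nat \<Rightarrow> real" where "mesh n = 1 / real (Suc n)"

lemma mesh_pos: "0 < mesh n" and mesh_le_1: "mesh n \<le> 1" and mesh_tendsto: "mesh \<longlonglongrightarrow> 0"
  using LIMSEQ_inverse_real_of_nat by (simp_all add: mesh_def[abs_def] inverse_eq_divide)

text \<open>\<open>X n k i\<close> is the position after k steps of the particle that started at i:
  particles are labelled by their initial positions, hence the identity at k = 0.\<close>

locale particle_scheme = kernel V DV \<alpha> m k1 k2
  for V :: "'a::euclidean_space \<Rightarrow> real" and DV \<alpha> m k1 k2 +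
  fixes T M0 :: real and \<rho>0 :: "'a measure" and p :: "nat \<Rightarrow> 'a pmf" and X :: "nat \<Rightarrow> nat \<Rightarrow> 'a \<Rightarrow> 'a"
  assumes T: "T > 0" and M0: "M0 \<ge> 0" and fin: "\<And>n. finite (set_pmf (p n))"
    and \<rho>0: "\<rho>0 \<in> moment_le M0"
    and sq0: "\<And>n. sqmean (p n) (\<lambda>x. x) \<le> M0"
    and p_conv: "\<And>f B. continuous_on UNIV f \<Longrightarrow> (\<And>x. \<bar>f x\<bar> \<le> B) \<Longrightarrow> (\<lambda>n. expect (p n) f) \<longlonglongrightarrow> (LINT x|\<rho>0. f x)"
    and X0: "\<And>n. X n 0 = (\<lambda>x. x)"
    and step: "\<And>n k. implicit_step (p n) (mesh n) (X n k) (X n (Suc k))"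
begin

definition inc :: "nat \<Rightarrow> nat \<Rightarrow> real" where
  "inc n j = rms (p n) (\<lambda>i. X n (Suc j) i - X n j i)"

lemma inc_nonneg: "0 \<le> inc n j"
  by (simp add: inc_def rms_nonneg)

lemma rms_steps: "k \<le> l \<Longrightarrow> rms (p n) (\<lambda>i. X n l i - X n k i) \<le> (\<Sum>j\<in>{k..<l}. inc n j)"
  unfolding inc_def by (rule rms_path_le[OF fin])

text \<open>The energy inequalities telescope and bound the action by the final energy, hence by a
  small multiple of the final second moment. That moment is in turn bounded by the action through
  Cauchy-Schwarz, and the smallness closes the circle. The bound T + 1 leaves room for the last grid
  point, which may exceed T by one mesh.\<close>

lemma energy_estimate:
  "\<exists>S>0. \<forall>n k. real k * mesh n \<le> T + 1 \<longrightarrow> (\<Sum>j<k. (inc n j)\<^sup>2) \<le> mesh n * S \<and> sqmean (p n) (X n k) \<le> S"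
proof -
  \<comment> \<open>With this choice half of the action quotient Q is absorbed, and Q is at most
    \<open>8 * \<delta> * M0 + 4 * C\<close>.\<close>
  define \<delta> where "\<delta> = 1 / (8 * (T + 1))"
  have \<delta>: "\<delta> > 0" "4 * \<delta> * (T + 1) = 1 / 2" using T by (auto simp: \<delta>_def)
  obtain C where C: "C \<ge> 0" "\<And>(q :: 'a pmf) Y. finite (set_pmf q) \<Longrightarrow> internal_energy q Y \<le> \<delta> * sqmean q Y + C"
    using internal_energy_le[OF \<delta>(1), where 'i='a] by blast
  define S0 where "S0 = 8 * \<delta> * M0 + 4 * C"
  have S0: "S0 \<ge> 0" using \<delta> M0 C by (simp add: S0_def)
  define S where "S = max S0 (2 * M0 + 2 * ((T + 1) * S0)) + 1"
  have main: "(\<Sum>j<k. (inc n j)\<^sup>2) \<le> mesh n * S0 \<and> sqmean (p n) (X n k) \<le> 2 * M0 + 2 * ((T + 1) * S0)"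
    if k: "real k * mesh n \<le> T + 1" for n k
  proof -
    define Q where "Q = (\<Sum>j<k. (inc n j)\<^sup>2) / mesh n"
    have Q0: "Q \<ge> 0" unfolding Q_def using mesh_pos[of n] by (intro divide_nonneg_pos sum_nonneg) auto
    have Qm: "(\<Sum>j<k. (inc n j)\<^sup>2) = mesh n * Q" using mesh_pos[of n] by (simp add: Q_def)
    have "(\<Sum>j<k. (inc n j)\<^sup>2) / (2 * mesh n) + internal_energy (p n) (X n 0) \<le> internal_energy (p n) (X n k)" for k
    proof (induction k)
      case (Suc k)
      have "(\<Sum>j<Suc k. (inc n j)\<^sup>2) / (2 * mesh n) = (\<Sum>j<k. (inc n j)\<^sup>2) / (2 * mesh n) + (inc n k)\<^sup>2 / (2 * mesh n)"
        by (simp add: add_divide_distrib)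
      then show ?case using Suc step[of n k] by (simp add: implicit_step_def inc_def rms_squared)
    qed simp
    from this[of k] have "Q / 2 \<le> internal_energy (p n) (X n k)"
      using internal_energy_nonneg[of "p n" "X n 0"] by (simp add: Q_def mult.commute)
    also have "\<dots> \<le> \<delta> * sqmean (p n) (X n k) + C" by (rule C(2)[OF fin])
    finally have Q1: "Q \<le> 2 * \<delta> * sqmean (p n) (X n k) + 2 * C" by simp
    have "rms (p n) (\<lambda>i. X n k i - X n 0 i) \<le> (\<Sum>j<k. inc n j)"
      using rms_steps[of 0 k n] by (simp add: atLeast0LessThan)
    then have "sqmean (p n) (\<lambda>i. X n k i - X n 0 i) \<le> (\<Sum>j<k. inc n j)\<^sup>2"
      unfolding rms_squared[symmetric] by (intro power_mono rms_nonneg)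
    also have "\<dots> \<le> real k * (\<Sum>j<k. (inc n j)\<^sup>2)"
      using sum_squared_le_sum_of_squares[of "inc n" "{..<k}"] by (simp add: mult.commute)
    also have "\<dots> = (real k * mesh n) * Q" by (simp add: Qm)
    also have "\<dots> \<le> (T + 1) * Q" by (intro mult_right_mono k Q0)
    finally have "sqmean (p n) (\<lambda>i. X n k i - X n 0 i) \<le> (T + 1) * Q" .
    then have Q2: "sqmean (p n) (X n k) \<le> 2 * ((T + 1) * Q) + 2 * M0"
      using sqmean_add_le[OF fin, of n "\<lambda>i. X n k i - X n 0 i" "X n 0"] sq0[of n] by (simp add: X0)
    have "2 * \<delta> * sqmean (p n) (X n k) \<le> 2 * \<delta> * (2 * ((T + 1) * Q) + 2 * M0)"
      using \<delta> by (intro mult_left_mono Q2) auto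
    also have "\<dots> = (4 * \<delta> * (T + 1)) * Q + 4 * \<delta> * M0" by (simp add: algebra_simps)
    finally have "Q \<le> S0" using Q1 \<delta>(2) by (simp add: S0_def)
    moreover from this have "(T + 1) * Q \<le> (T + 1) * S0" using T by (intro mult_left_mono) auto
    ultimately show ?thesis using Q2 mesh_pos[of n] by (auto simp: Qm)
  qed
  show ?thesis
  proof (intro exI[of _ S] conjI allI impI)
    show "S > 0" using S0 by (simp add: S_def)
    fix n k assume k: "real k * mesh n \<le> T + 1"
    have "mesh n * S0 \<le> mesh n * S" using mesh_pos[of n] by (intro mult_left_mono) (auto simp: S_def)
    then show "(\<Sum>j<k. (inc n j)\<^sup>2) \<le> mesh n * S" "sqmean (p n) (X n k) \<le> S"
      using main[OF k] by (auto simp: S_def)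
  qed
qed

definition S :: real where
  "S = (SOME S. S > 0 \<and> (\<forall>n k. real k * mesh n \<le> T + 1 \<longrightarrow>
     (\<Sum>j<k. (inc n j)\<^sup>2) \<le> mesh n * S \<and> sqmean (p n) (X n k) \<le> S))"

lemma S_pos: "S > 0"
  and sum_inc_squared: "real k * mesh n \<le> T + 1 \<Longrightarrow> (\<Sum>j<k. (inc n j)\<^sup>2) \<le> mesh n * S"
  and sqmean_le_S: "real k * mesh n \<le> T + 1 \<Longrightarrow> sqmean (p n) (X n k) \<le> S"
  using someI_ex[OF energy_estimate[unfolded Bex_def]] unfolding S_def[symmetric] by blast+

text \<open>Rounding up selects the position after the step. Times beyond T are frozen at T and
  negative times give index 0, so that all curves and lengths are defined on the whole line, as the
  Stieltjes measures require.\<close>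

definition idx :: "nat \<Rightarrow> real \<Rightarrow> nat" where
  "idx n t = nat \<lceil>min T t / mesh n\<rceil>"

lemma idx_0 [simp]: "idx n 0 = 0"
  using T by (simp add: idx_def)

lemma idx_mono: "s \<le> t \<Longrightarrow> idx n s \<le> idx n t"
  unfolding idx_def using mesh_pos[of n] by (intro nat_mono ceiling_mono divide_right_mono) auto

lemma idx_diff_le:
  assumes "s \<le> t"
  shows "(real (idx n t) - real (idx n s)) * mesh n \<le> (t - s) + mesh n"
proof -
  let ?x = "min T s / mesh n" and ?y = "min T t / mesh n"
  have "min T t - min T s \<le> t - s" using assms by auto
  then have "(min T t - min T s) / mesh n \<le> (t - s) / mesh n"
    using mesh_pos[of n] by (intro divide_right_mono) auto
  then have d: "?y - ?x \<le> (t - s) / mesh n" by (simp add: diff_divide_distrib)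
  have "real (nat \<lceil>?y\<rceil>) - real (nat \<lceil>?x\<rceil>) \<le> (t - s) / mesh n + 1"
  proof (cases "?y \<le> 0")
    case True
    moreover have "0 \<le> (t - s) / mesh n" using assms mesh_pos[of n] by simp
    ultimately show ?thesis by simp
  next
    case False
    then have "real (nat \<lceil>?y\<rceil>) \<le> ?y + 1" by linarith
    moreover have "?x \<le> real (nat \<lceil>?x\<rceil>)" by linarith
    ultimately show ?thesis using d by linarith
  qed
  then have "(real (idx n t) - real (idx n s)) * mesh n \<le> ((t - s) / mesh n + 1) * mesh n"
    unfolding idx_def using mesh_pos[of n] by (intro mult_right_mono) auto
  then show ?thesis using mesh_pos[of n] by (simp add: distrib_right)
qed

lemma idx_le: "real (idx n t) * mesh n \<le> T + 1"
proof -
  have "real (idx n t) * mesh n \<le> real (idx n (max t 0)) * mesh n"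
    using mesh_pos[of n] idx_mono[of t "max t 0" n] by (intro mult_right_mono) auto
  also have "idx n (max t 0) = idx n (min T (max t 0))" by (simp add: idx_def)
  also have "real \<dots> * mesh n \<le> min T (max t 0) + mesh n"
    using idx_diff_le[of 0 "min T (max t 0)" n] T by simp
  finally show ?thesis using mesh_le_1[of n] by linarith
qed

text \<open>For \<open>c > 0\<close> only the jumps of speed at most \<open>c\<close> are counted: this is the Lipschitz part of
  the length \<open>travel 0\<close>.\<close>

definition jump :: "nat \<Rightarrow> nat \<Rightarrow> nat \<Rightarrow> real" where
  "jump c n j = (if c = 0 \<or> inc n j \<le> real c * mesh n then inc n j else 0)"

definition travel :: "nat \<Rightarrow> nat \<Rightarrow> real \<Rightarrow> real" where
  "travel c n t = (\<Sum>j<idx n t. jump c n j)"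

lemma jump_bounds: "0 \<le> jump c n j" "jump c n j \<le> inc n j"
  using inc_nonneg by (auto simp: jump_def)

lemma travel_diff:
  assumes "s \<le> t"
  shows "travel c n t - travel c n s = (\<Sum>j\<in>{idx n s..<idx n t}. jump c n j)"
  unfolding travel_def lessThan_atLeast0 by (rule sum_diff_nat_ivl[OF le0 idx_mono[OF assms]])

lemma travel_mono: "s \<le> t \<Longrightarrow> travel c n s \<le> travel c n t"
  using travel_diff[of s t c n] sum_nonneg[of "{idx n s..<idx n t}" "jump c n"] jump_bounds(1) by simp

lemma sum_inc_squared_Ico:
  assumes "real k * mesh n \<le> T + 1"
  shows "(\<Sum>j\<in>{l..<k}. (inc n j)\<^sup>2) \<le> mesh n * S"
  by (rule order_trans[OF sum_mono2 sum_inc_squared[OF assms]]) auto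

text \<open>Cauchy-Schwarz over the jumps: their squares are summed by the action bound, and their
  number times the mesh exceeds t - s by at most one mesh. This is a Hoelder estimate of exponent
  1/2 with the mesh as defect.\<close>

lemma travel_diff_le:
  assumes "s \<le> t"
  shows "travel c n t - travel c n s \<le> sqrt S * sqrt ((t - s) + mesh n)"
proof -
  let ?I = "{idx n s..<idx n t}"
  have "travel c n t - travel c n s \<le> (\<Sum>j\<in>?I. inc n j)"
    unfolding travel_diff[OF assms] by (intro sum_mono jump_bounds)
  also have "\<dots> \<le> sqrt (S * ((t - s) + mesh n))"
  proof (rule real_le_rsqrt)
    have "(\<Sum>j\<in>?I. inc n j)\<^sup>2 \<le> (\<Sum>j\<in>?I. (inc n j)\<^sup>2) * real (card ?I)"
      by (rule sum_squared_le_sum_of_squares)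
    also have "\<dots> \<le> (mesh n * S) * real (card ?I)"
      by (intro mult_right_mono sum_inc_squared_Ico idx_le) auto
    also have "\<dots> = S * ((real (idx n t) - real (idx n s)) * mesh n)"
      using idx_mono[OF assms, of n] by (simp add: of_nat_diff)
    also have "\<dots> \<le> S * ((t - s) + mesh n)"
      using S_pos by (intro mult_left_mono idx_diff_le assms) auto
    finally show "(\<Sum>j\<in>?I. inc n j)\<^sup>2 \<le> S * ((t - s) + mesh n)" .
  qed
  finally show ?thesis by (simp add: real_sqrt_mult)
qed

lemma travel_equicontinuous: "\<bar>travel c n t - travel c n s\<bar> \<le> sqrt S * sqrt (\<bar>t - s\<bar> + mesh n)"
  using travel_diff_le[of s t c n] travel_diff_le[of t s c n] travel_mono[of s t c n] travel_mono[of t s c n]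
  by (cases "s \<le> t") auto

lemma travel_bounds: "0 \<le> travel c n t" "travel c n t \<le> sqrt S * sqrt (T + 1)"
proof -
  show "0 \<le> travel c n t" unfolding travel_def by (intro sum_nonneg jump_bounds)
  have "travel c n t \<le> travel c n (max t 0)" by (intro travel_mono) auto
  also have "travel c n (max t 0) = travel c n (min T (max t 0)) - travel c n 0"
  proof -
    have "travel c n 0 = 0" by (simp add: travel_def)
    then show ?thesis by (simp add: travel_def idx_def)
  qed
  also have "\<dots> \<le> sqrt S * sqrt ((min T (max t 0) - 0) + mesh n)"
    using T by (intro travel_diff_le) auto
  also have "\<dots> \<le> sqrt S * sqrt (T + 1)"
    using S_pos mesh_le_1[of n] by (intro mult_left_mono real_sqrt_le_mono) auto
  finally show "travel c n t \<le> sqrt S * sqrt (T + 1)" .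
qed

lemma rms_le_travel: "rms (p n) (\<lambda>i. X n (idx n t) i - X n (idx n s) i) \<le> \<bar>travel 0 n t - travel 0 n s\<bar>"
proof -
  have *: "rms (p n) (\<lambda>i. X n (idx n t) i - X n (idx n s) i) \<le> travel 0 n t - travel 0 n s" if "s \<le> t" for s t
    using rms_steps[OF idx_mono[OF that, of n]] travel_diff[OF that, of 0 n] by (simp add: jump_def)
  show ?thesis
  proof (cases "s \<le> t")
    case True
    then show ?thesis using *[OF True] by linarith
  next
    case False
    have "rms (p n) (\<lambda>i. X n (idx n t) i - X n (idx n s) i) = rms (p n) (\<lambda>i. X n (idx n s) i - X n (idx n t) i)"
      by (simp add: rms_def sqmean_def norm_minus_commute)
    then show ?thesis using *[of t s] False by linarith
  qed
qed

definition curve :: "nat \<Rightarrow> real \<Rightarrow> 'a measure" where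
  "curve n t = law (p n) (X n (idx n t))"

lemma law_X_moment: "real k * mesh n \<le> T + 1 \<Longrightarrow> law (p n) (X n k) \<in> moment_le S"
  by (intro law_moment_le fin sqmean_le_S)

lemma curve_moment: "curve n t \<in> moment_le S"
  unfolding curve_def by (intro law_X_moment idx_le)

lemma integral_curve_equicontinuous:
  fixes f :: "'a \<Rightarrow> real"
  assumes f: "f \<in> borel_measurable borel" "\<And>x y. \<bar>f x - f y\<bar> \<le> L * dist x y" and L: "L \<ge> 0"
  shows "\<bar>(LINT x|curve n t. f x) - (LINT x|curve n s. f x)\<bar> \<le> (L * sqrt S) * sqrt (\<bar>t - s\<bar> + mesh n)"
proof -
  have "\<bar>(LINT x|curve n t. f x) - (LINT x|curve n s. f x)\<bar> =
      \<bar>expect (p n) (\<lambda>i. f (X n (idx n t) i) - f (X n (idx n s) i))\<bar>"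
    unfolding curve_def using f(1) fin[of n] by (simp add: integral_law integrable_finite_pmf)
  also have "\<dots> \<le> expect (p n) (\<lambda>i. \<bar>f (X n (idx n t) i) - f (X n (idx n s) i)\<bar>)"
    by (rule integral_abs_bound)
  also have "\<dots> \<le> expect (p n) (\<lambda>i. L * norm (X n (idx n t) i - X n (idx n s) i))"
    using f(2) by (intro expect_mono fin) (auto simp: dist_norm)
  also have "\<dots> \<le> L * rms (p n) (\<lambda>i. X n (idx n t) i - X n (idx n s) i)"
    using L by (simp add: mult_left_mono expect_norm_le_rms[OF fin])
  also have "\<dots> \<le> L * (sqrt S * sqrt (\<bar>t - s\<bar> + mesh n))"
    using L by (intro mult_left_mono order_trans[OF rms_le_travel travel_equicontinuous])
  finally show ?thesis by (simp add: mult.assoc)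
qed

end

section \<open>Selection of a convergent subsequence\<close>

context particle_scheme
begin

text \<open>Subsequences are selected at rational times only, and equicontinuity extends the
  convergence to all times. At a general time a Skorohod representation is at hand only along a
  further subsequence, so the convergence is stated for integrals of \<open>lip1\<close>
  functions.\<close>

lemma convergent_curves:
  obtains r :: "nat \<Rightarrow> nat" and \<Lambda> :: "nat \<Rightarrow> real \<Rightarrow> real" and \<rho> :: "real \<Rightarrow> 'a measure"
  where "strict_mono r" "\<And>c t. (\<lambda>n. travel c (r n) t) \<longlonglongrightarrow> \<Lambda> c t" "\<And>t. \<rho> t \<in> moment_le S"
    "\<And>t f. lip1 f \<Longrightarrow> (\<lambda>n. LINT x|curve (r n) t. f x) \<longlonglongrightarrow> (LINT x|\<rho> t. f x)"
proof -
  obtain r0 where r0: "strict_mono (r0 :: nat \<Rightarrow> nat)"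
    "\<And>x. x \<in> \<rat> \<times> (UNIV :: nat set) \<Longrightarrow> \<exists>l. (\<lambda>n. travel (snd x) (r0 n) (fst x)) \<longlonglongrightarrow> l"
  proof (rule function_convergent_subsequence[of "\<rat> \<times> (UNIV :: nat set)" "\<lambda>n x. travel (snd x) n (fst x)" "sqrt S * sqrt (T + 1)"])
    show "countable (\<rat> \<times> (UNIV :: nat set))" by (intro countable_SIGMA countable_rat) auto
    show "norm (travel (snd x) n (fst x)) \<le> sqrt S * sqrt (T + 1)" for n and x :: "real \<times> nat"
      using travel_bounds[of "snd x" n "fst x"] by simp
  qed blast
  define P where "P i s \<longleftrightarrow> (\<exists>\<nu>. skorohod_conv (\<lambda>n. curve (r0 (s n)) (from_nat_into \<rat> i)) \<nu>)" for i and s :: "nat \<Rightarrow> nat"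
  interpret subseqs P
  proof
    fix i and s :: "nat \<Rightarrow> nat"
    show "\<exists>r'. strict_mono r' \<and> P i (s \<circ> r')"
      using moment_le_compact[of "\<lambda>n. curve (r0 (s n)) (from_nat_into \<rat> i)" S] curve_moment
      unfolding P_def o_def by blast
  qed
  \<comment> \<open>From index \<open>Suc i\<close> on, the diagonal sequence is a subsequence of
    the one selected for the i-th rational. The dropped initial terms cause the offset that
    \<open>LIMSEQ_offset\<close> removes.\<close>
  have P_diag: "P i (diagseq \<circ> ((+) (Suc i)))" for i
    by (rule diagseq_holds) (auto simp: P_def o_def intro: skorohod_conv_subseq)
  define r where "r = r0 \<circ> diagseq"
  have r: "strict_mono r" unfolding r_def by (intro strict_mono_o r0 subseq_diagseq)
  have mesh0: "(\<lambda>n. mesh (r n)) \<longlonglongrightarrow> 0"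
    using LIMSEQ_subseq_LIMSEQ[OF mesh_tendsto r] by (simp add: o_def)
  have "convergent (\<lambda>n. travel c (r n) t)" for c t
  proof (rule equicontinuous_convergent[OF _ mesh0])
    show "convergent (\<lambda>n. travel c (r n) q)" if q: "q \<in> \<rat>" for q
    proof -
      obtain l where "(\<lambda>n. travel c (r0 n) q) \<longlonglongrightarrow> l" using r0(2)[of "(q, c)"] q by auto
      from LIMSEQ_subseq_LIMSEQ[OF this subseq_diagseq] show ?thesis
        unfolding convergent_def r_def by (auto simp: o_def)
    qed
    show "\<bar>travel c (r n) t - travel c (r n) s\<bar> \<le> sqrt S * sqrt (\<bar>t - s\<bar> + mesh (r n))" for n s t
      by (rule travel_equicontinuous)
  qed (use S_pos in simp)
  then obtain \<Lambda> where \<Lambda>: "\<And>c t. (\<lambda>n. travel c (r n) t) \<longlonglongrightarrow> \<Lambda> c t"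
    unfolding convergent_def by metis
  have conv: "convergent (\<lambda>n. LINT x|curve (r n) t. f x)" if f: "lip1 f" for f t
  proof -
    obtain L where L: "L \<ge> 0" "\<And>x y. \<bar>f x - f y\<bar> \<le> L * dist x y" using f by (auto simp: lip1_def)
    have fm: "f \<in> borel_measurable borel"
      by (intro borel_measurable_continuous_onI lip1_continuous f)
    show ?thesis
    proof (rule equicontinuous_convergent[OF _ mesh0])
      fix q :: real assume q: "q \<in> \<rat>"
      obtain i where i: "q = from_nat_into \<rat> i"
        using from_nat_into_surj[OF countable_rat q] by metis
      obtain \<nu> where "skorohod_conv (\<lambda>n. curve (r (n + Suc i)) q) \<nu>"
        using iffD1[OF P_def P_diag[of i]] unfolding i[symmetric] by (auto simp: o_def r_def add.commute)
      from LIMSEQ_offset[where f="\<lambda>n. LINT x|curve (r n) q. f x", OF skorohod_conv_lip1[OF this f]]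
      show "convergent (\<lambda>n. LINT x|curve (r n) q. f x)"
        by (rule convergentI)
    next
      show "\<bar>(LINT x|curve (r n) t. f x) - (LINT x|curve (r n) s. f x)\<bar> \<le> (L * sqrt S) * sqrt (\<bar>t - s\<bar> + mesh (r n))" for n s t
        by (rule integral_curve_equicontinuous[OF fm L(2) L(1)])
    qed (use L S_pos in simp)
  qed
  have "\<exists>\<nu>. \<nu> \<in> moment_le S \<and> (\<forall>f. lip1 f \<longrightarrow> (\<lambda>n. LINT x|curve (r n) t. f x) \<longlonglongrightarrow> (LINT x|\<nu>. f x))" for t
  proof -
    obtain s \<nu> where s: "strict_mono s" "skorohod_conv (\<lambda>n. curve (r (s n)) t) \<nu>" "\<nu> \<in> moment_le S"
      using moment_le_compact[of "\<lambda>n. curve (r n) t" S] curve_moment by blast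
    \<comment> \<open>The measure arises from one subsequence, but the integrals converge along the
      whole sequence, so their limits agree.\<close>
    have "(\<lambda>n. LINT x|curve (r n) t. f x) \<longlonglongrightarrow> (LINT x|\<nu>. f x)" if f: "lip1 f" for f
    proof -
      obtain l where l: "(\<lambda>n. LINT x|curve (r n) t. f x) \<longlonglongrightarrow> l"
        using conv[OF f] unfolding convergent_def by blast
      have "(\<lambda>n. LINT x|curve (r (s n)) t. f x) \<longlonglongrightarrow> l"
        using LIMSEQ_subseq_LIMSEQ[OF l s(1)] by (simp add: o_def)
      moreover have "(\<lambda>n. LINT x|curve (r (s n)) t. f x) \<longlonglongrightarrow> (LINT x|\<nu>. f x)"
        by (rule skorohod_conv_lip1[OF s(2) f])
      ultimately show ?thesis using l LIMSEQ_unique by blast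
    qed
    then show ?thesis using s(3) by blast
  qed
  then obtain \<rho> where \<rho>: "\<And>t. \<rho> t \<in> moment_le S"
    "\<And>t f. lip1 f \<Longrightarrow> (\<lambda>n. LINT x|curve (r n) t. f x) \<longlonglongrightarrow> (LINT x|\<rho> t. f x)"
    by metis
  show thesis by (rule that[OF r \<Lambda> \<rho>])
qed

end

section \<open>The limit curve\<close>

context particle_scheme
begin

text \<open>The field may grow like \<open>wt x powr \<alpha>\<close>, but the gradient of a test
  function has compact support. The bound is uniform over all measures obeying the moment bound, as
  dominated convergence in time requires.\<close>

lemma field_test_bounded:
  assumes \<phi>: "\<phi> \<in> C1c"
  obtains B where "B > 0" "\<And>\<mu> x. \<mu> \<in> moment_le S \<Longrightarrow> \<bar>grad \<phi> x \<bullet> field \<mu> x\<bar> \<le> B"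
proof -
  obtain R where R: "\<And>x. norm x > R \<Longrightarrow> grad \<phi> x = 0" and cont: "continuous_on UNIV (grad \<phi>)"
    using C1c_E[OF \<phi>] by metis
  obtain G where G: "G > 0" "\<And>x. \<bar>norm (grad \<phi> x) * wt x powr \<alpha>\<bar> \<le> G"
  proof (rule compact_support_bounded[of "\<lambda>x. norm (grad \<phi> x) * wt x powr \<alpha>" R])
    show "continuous_on UNIV (\<lambda>x. norm (grad \<phi> x) * wt x powr \<alpha>)"
      by (intro continuous_intros cont) auto
  qed (use R in auto)
  have fS: "ftotal S \<ge> 0"
    unfolding ftotal_def by (intro mult_nonneg_nonneg fbound_nonneg Bochner_Integration.integral_nonneg) auto
  show thesis
  proof
    show "ftotal S * G + 1 > 0" using G fS by (intro add_nonneg_pos mult_nonneg_nonneg) auto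
    fix \<mu> :: "'a measure" and x assume \<mu>: "\<mu> \<in> moment_le S"
    have "\<bar>grad \<phi> x \<bullet> field \<mu> x\<bar> \<le> norm (grad \<phi> x) * norm (field \<mu> x)"
      by (rule Cauchy_Schwarz_ineq2)
    also have "\<dots> \<le> norm (grad \<phi> x) * (ftotal S * wt x powr \<alpha>)"
      by (intro mult_left_mono norm_field_le[OF \<mu> S_pos]) auto
    also have "\<dots> = ftotal S * (norm (grad \<phi> x) * wt x powr \<alpha>)" by simp
    also have "\<dots> \<le> ftotal S * G" using G(2)[of x] fS by (intro mult_left_mono) auto
    finally show "\<bar>grad \<phi> x \<bullet> field \<mu> x\<bar> \<le> ftotal S * G + 1" by simp
  qed
qed

lemma measurable_test_field:
  assumes "\<phi> \<in> C1c" "\<mu> \<in> moment_le S"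
  shows "(\<lambda>x. grad \<phi> x \<bullet> field \<mu> x) \<in> borel_measurable borel"
proof -
  have "continuous_on UNIV (grad \<phi>)" using C1c_E[OF assms(1)] by metis
  then show ?thesis
    by (intro borel_measurable_continuous_onI continuous_intros field_cont[OF assms(2) S_pos])
qed

definition rate :: "('a \<Rightarrow> real) \<Rightarrow> nat \<Rightarrow> nat \<Rightarrow> real" where
  "rate \<phi> n j = (LINT x|law (p n) (X n j). grad \<phi> x \<bullet> field (law (p n) (X n j)) x)"

lemma rate_bound:
  assumes "\<And>\<mu> x. \<mu> \<in> moment_le S \<Longrightarrow> \<bar>grad \<phi> x \<bullet> field \<mu> x\<bar> \<le> B" "\<phi> \<in> C1c" "real j * mesh n \<le> T + 1"
  shows "\<bar>rate \<phi> n j\<bar> \<le> B"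
proof -
  note mom = law_X_moment[OF assms(3)]
  have "rate \<phi> n j = expect (p n) (\<lambda>i. grad \<phi> (X n j i) \<bullet> field (law (p n) (X n j)) (X n j i))"
    unfolding rate_def by (intro integral_law measurable_test_field assms mom)
  also have "\<bar>\<dots>\<bar> \<le> expect (p n) (\<lambda>i. B)"
    by (rule order_trans[OF integral_abs_bound]) (intro expect_mono fin assms(1) mom)
  finally show ?thesis by simp
qed

text \<open>Each step is expanded about its end point, where the implicit equation turns the linear
  term into the mesh times \<open>\<kappa>\<close> times the rate at index \<open>Suc k\<close>. The
  Taylor remainders add up to the error.\<close>

lemma discrete_equation:
  assumes \<phi>: "\<phi> \<in> C1c" and k: "real k * mesh n \<le> T + 1"
    and Taylor: "\<And>a b. \<bar>\<phi> b - \<phi> a - grad \<phi> b \<bullet> (b - a)\<bar> \<le> \<eta> * norm (b - a) + C * (norm (b - a))\<^sup>2"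
    and \<eta>: "\<eta> \<ge> 0"
  shows "\<bar>expect (p n) (\<lambda>i. \<phi> (X n k i)) - expect (p n) \<phi> - \<kappa> * (\<Sum>j<k. mesh n * rate \<phi> n (Suc j))\<bar> \<le>
    \<eta> * (\<Sum>j<k. inc n j) + C * (\<Sum>j<k. (inc n j)\<^sup>2)"
  using k
proof (induction k)
  case 0
  then show ?case by (simp add: X0)
next
  case (Suc k)
  have k: "real k * mesh n \<le> T + 1" using Suc.prems mesh_pos[of n] by (simp add: distrib_right)
  let ?a = "X n k" and ?b = "X n (Suc k)"
  note mom = law_X_moment[OF Suc.prems]
  note I = integrable_finite_pmf[OF fin]
  have "\<kappa> * (mesh n * rate \<phi> n (Suc k)) = expect (p n) (\<lambda>i. \<kappa> * mesh n * (grad \<phi> (?b i) \<bullet> field (law (p n) ?b) (?b i)))"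
    unfolding rate_def by (subst integral_law) (auto intro: measurable_test_field[OF \<phi> mom])
  also have "\<dots> = expect (p n) (\<lambda>i. grad \<phi> (?b i) \<bullet> (?b i - ?a i))"
    by (intro integral_cong_AE) (auto simp: AE_measure_pmf_iff step[unfolded implicit_step_def] mult_ac)
  finally have eq: "expect (p n) (\<lambda>i. \<phi> (?b i)) - expect (p n) (\<lambda>i. \<phi> (?a i)) - \<kappa> * (mesh n * rate \<phi> n (Suc k)) =
      expect (p n) (\<lambda>i. \<phi> (?b i) - \<phi> (?a i) - grad \<phi> (?b i) \<bullet> (?b i - ?a i))"
    by (simp add: I)
  have "\<bar>expect (p n) (\<lambda>i. \<phi> (?b i) - \<phi> (?a i) - grad \<phi> (?b i) \<bullet> (?b i - ?a i))\<bar> \<le>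
      expect (p n) (\<lambda>i. \<eta> * norm (?b i - ?a i) + C * (norm (?b i - ?a i))\<^sup>2)"
    by (rule order_trans[OF integral_abs_bound]) (intro expect_mono fin Taylor)
  also have "\<dots> = \<eta> * expect (p n) (\<lambda>i. norm (?b i - ?a i)) + C * (inc n k)\<^sup>2"
    unfolding inc_def rms_squared sqmean_def by (rule expect_linear[OF fin])
  also have "\<dots> \<le> \<eta> * inc n k + C * (inc n k)\<^sup>2"
    unfolding inc_def using \<eta> by (intro add_right_mono mult_left_mono expect_norm_le_rms fin)
  finally have "\<bar>expect (p n) (\<lambda>i. \<phi> (?b i)) - expect (p n) (\<lambda>i. \<phi> (?a i)) - \<kappa> * (mesh n * rate \<phi> n (Suc k))\<bar> \<le>
      \<eta> * inc n k + C * (inc n k)\<^sup>2"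
    unfolding eq .
  then show ?case using Suc.IH[OF k] unfolding sum.lessThan_Suc distrib_left by linarith
qed

section \<open>Properties of a limit curve\<close>

context
  fixes r :: "nat \<Rightarrow> nat" and \<Lambda> :: "nat \<Rightarrow> real \<Rightarrow> real" and \<rho> :: "real \<Rightarrow> 'a measure"
  assumes r: "strict_mono r" and \<Lambda>: "\<And>c t. (\<lambda>n. travel c (r n) t) \<longlonglongrightarrow> \<Lambda> c t"
    and \<rho>: "\<And>t. \<rho> t \<in> moment_le S"
    and \<rho>_lip1: "\<And>t f. lip1 f \<Longrightarrow> (\<lambda>n. LINT x|curve (r n) t. f x) \<longlonglongrightarrow> (LINT x|\<rho> t. f x)"
begin

lemma mesh_r: "(\<lambda>n. mesh (r n)) \<longlonglongrightarrow> 0"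
  using LIMSEQ_subseq_LIMSEQ[OF mesh_tendsto r] by (simp add: o_def)

lemma curve_functional:
  fixes J :: "nat \<Rightarrow> real"
  assumes "\<And>s. strict_mono s \<Longrightarrow> skorohod_conv (\<lambda>n. curve (r (s n)) t) (\<rho> t) \<Longrightarrow> (\<lambda>n. J (s n)) \<longlonglongrightarrow> J'"
  shows "J \<longlonglongrightarrow> J'"
  by (rule tendsto_along_compact[of "\<lambda>n. curve (r n) t" S "\<rho> t" S, OF curve_moment \<rho> \<rho>_lip1 assms])

lemma conv_measure_tendsto: "(\<lambda>n. conv_measure V (curve (r n) t) y) \<longlonglongrightarrow> conv_measure V (\<rho> t) y"
proof -
  have "lip1 (\<lambda>x. V (y - x) / k2)"
  proof (rule lip1I[of _ 1])
    show "\<bar>V (y - x) / k2\<bar> \<le> 1" for x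
      using V_pos[of "y - x"] V_le_k2[of "y - x"] k2_pos by (simp add: abs_of_pos)
    show "\<bar>V (y - u) / k2 - V (y - v) / k2\<bar> \<le> 1 * dist u v" for u v
      using V_Lipschitz[of "y - u" "y - v"] k2_pos
      by (simp add: diff_divide_distrib[symmetric] divide_le_eq dist_norm norm_minus_commute mult.commute)
  qed
  from tendsto_mult_right[OF \<rho>_lip1[OF this, of t], of k2] show ?thesis
    unfolding conv_measure_def using k2_pos by simp
qed

text \<open>Measure and integrand vary together. A Skorohod representation reduces the claim to
  convergence of the integrands along convergent points, which \<open>field_tendsto\<close>
  provides.\<close>

lemma test_field_tendsto:
  assumes \<phi>: "\<phi> \<in> C1c"
  shows "(\<lambda>n. LINT x|curve (r n) t. grad \<phi> x \<bullet> field (curve (r n) t) x) \<longlonglongrightarrow> (LINT x|\<rho> t. grad \<phi> x \<bullet> field (\<rho> t) x)"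
proof (rule curve_functional)
  obtain B where B: "\<And>\<mu> x. \<mu> \<in> moment_le S \<Longrightarrow> \<bar>grad \<phi> x \<bullet> field \<mu> x\<bar> \<le> B"
    using field_test_bounded[OF \<phi>] by metis
  have cont: "continuous_on UNIV (grad \<phi>)" using C1c_E[OF \<phi>] by metis
  fix s :: "nat \<Rightarrow> nat" assume s: "strict_mono s" "skorohod_conv (\<lambda>n. curve (r (s n)) t) (\<rho> t)"
  show "(\<lambda>n. LINT x|curve (r (s n)) t. grad \<phi> x \<bullet> field (curve (r (s n)) t) x) \<longlonglongrightarrow> (LINT x|\<rho> t. grad \<phi> x \<bullet> field (\<rho> t) x)"
  proof (rule skorohod_conv_integral[OF s(2)])
    show "(\<lambda>n. grad \<phi> (x n) \<bullet> field (curve (r (s n)) t) (x n)) \<longlonglongrightarrow> grad \<phi> x' \<bullet> field (\<rho> t) x'"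
      if x: "x \<longlonglongrightarrow> x'" for x x'
    proof (intro tendsto_inner)
      show "(\<lambda>n. grad \<phi> (x n)) \<longlonglongrightarrow> grad \<phi> x'"
        using cont by (intro isCont_tendsto_compose[OF _ x]) (simp add: continuous_on_eq_continuous_at)
      show "(\<lambda>n. field (curve (r (s n)) t) (x n)) \<longlonglongrightarrow> field (\<rho> t) x'"
        using LIMSEQ_subseq_LIMSEQ[OF conv_measure_tendsto s(1)]
        by (intro field_tendsto[OF _ \<rho> S_pos _ x] curve_moment) (simp add: o_def)
    qed
    show "\<bar>grad \<phi> x \<bullet> field (curve (r (s n)) t) x\<bar> \<le> B" for n x
      by (rule B[OF curve_moment])
  qed (intro measurable_test_field \<phi> \<rho> curve_moment)+
qed

lemma bounded_continuous_tendsto: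
  fixes f :: "'a \<Rightarrow> real"
  shows "continuous_on UNIV f \<Longrightarrow> (\<And>x. \<bar>f x\<bar> \<le> B) \<Longrightarrow> (\<lambda>n. LINT x|curve (r n) t. f x) \<longlonglongrightarrow> (LINT x|\<rho> t. f x)"
  by (rule curve_functional) (rule skorohod_conv_bounded_continuous)

lemma initial: "\<rho> 0 = \<rho>0"
proof (rule moment_le_eqI[OF \<rho> \<rho>0])
  fix f :: "'a \<Rightarrow> real" assume f: "lip1 f"
  then have c: "continuous_on UNIV f" by (rule lip1_continuous)
  have "(LINT x|curve n 0. f x) = expect (p n) f" for n
    unfolding curve_def by (subst integral_law) (auto simp: X0 intro: borel_measurable_continuous_onI c)
  then have "(\<lambda>n. expect (p (r n)) f) \<longlonglongrightarrow> (LINT x|\<rho> 0. f x)" using \<rho>_lip1[OF f, of 0] by simp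
  moreover have "(\<lambda>n. expect (p (r n)) f) \<longlonglongrightarrow> (LINT x|\<rho>0. f x)"
    using LIMSEQ_subseq_LIMSEQ[OF p_conv[OF c, of 1] r] f by (simp add: o_def lip1_def)
  ultimately show "(LINT x|\<rho> 0. f x) = (LINT x|\<rho>0. f x)" by (rule LIMSEQ_unique)
qed

text \<open>The labels already couple the positions at two times, so no optimal plan is needed
  before the limit. A subsequence of these joint laws converges on the product space, and Fatou's
  lemma bounds the cost of the limit by the limiting length.\<close>

lemma W2_le_travel: "W2 (\<rho> s) (\<rho> t) \<le> \<bar>\<Lambda> 0 t - \<Lambda> 0 s\<bar>"
proof -
  define Y where "Y n i = (X (r n) (idx (r n) s) i, X (r n) (idx (r n) t) i)" for n i
  define \<gamma> where "\<gamma> n = law (p (r n)) (Y n)" for n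
  have mom: "\<gamma> n \<in> moment_le (2 * S)" for n
    unfolding \<gamma>_def
  proof (rule law_moment_le[OF fin])
    have "sqmean (p (r n)) (Y n) = sqmean (p (r n)) (X (r n) (idx (r n) s)) + sqmean (p (r n)) (X (r n) (idx (r n) t))"
      unfolding sqmean_def Y_def by (simp add: norm_Pair integrable_finite_pmf[OF fin])
    also have "\<dots> \<le> 2 * S"
      using sqmean_le_S[OF idx_le, of "r n" s] sqmean_le_S[OF idx_le, of "r n" t] by simp
    finally show "sqmean (p (r n)) (Y n) \<le> 2 * S" .
  qed
  obtain s' \<Gamma> where s': "strict_mono s'" "skorohod_conv (\<lambda>n. \<gamma> (s' n)) \<Gamma>" "\<Gamma> \<in> moment_le (2 * S)"
    using moment_le_compact[of \<gamma> "2 * S"] mom by blast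
  \<comment> \<open>Stated for a nonexpansive map g so that one argument serves for both
    projections.\<close>
  have marginal: "distr \<Gamma> borel g = \<rho> u"
    if g: "\<And>x y. dist (g x) (g y) \<le> dist x y" "\<And>z. norm (g z) \<le> norm z"
      and gY: "\<And>n i. g (Y n i) = X (r n) (idx (r n) u) i" for g :: "'a \<times> 'a \<Rightarrow> 'a" and u
  proof -
    have gc: "continuous_on UNIV g"
      using g(1) by (intro lipschitz_on_continuous_on[of 1] lipschitz_onI) auto
    then have gm: "g \<in> borel_measurable borel" by (rule borel_measurable_continuous_onI)
    have g\<Gamma>: "g \<in> borel_measurable \<Gamma>"
      using gm s'(3) measurable_cong_sets[of \<Gamma> borel borel borel] by (auto simp: moment_le_def)
    show ?thesis
    proof (rule moment_le_eqI[OF _ \<rho>])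
      have "(\<integral>\<^sup>+ x. ennreal ((norm x)\<^sup>2) \<partial>distr \<Gamma> borel g) = (\<integral>\<^sup>+ z. ennreal ((norm (g z))\<^sup>2) \<partial>\<Gamma>)"
        by (intro nn_integral_distr g\<Gamma>) measurable
      also have "\<dots> \<le> (\<integral>\<^sup>+ z. ennreal ((norm z)\<^sup>2) \<partial>\<Gamma>)"
        by (intro nn_integral_mono ennreal_leI power_mono g) auto
      finally show "distr \<Gamma> borel g \<in> moment_le (2 * S)"
        using s'(3) by (auto simp: moment_le_def intro!: prob_space.prob_space_distr g\<Gamma>)
      fix f :: "'a \<Rightarrow> real" assume f: "lip1 f"
      have fm: "f \<in> borel_measurable borel"
        by (intro borel_measurable_continuous_onI lip1_continuous f)
      have "lip1 (\<lambda>z. f (g z))"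
      proof -
        obtain L where L: "L \<ge> 0" "\<And>x y. \<bar>f x - f y\<bar> \<le> L * dist x y" using f by (auto simp: lip1_def)
        show ?thesis
        proof (rule lip1I[of _ L])
          show "\<bar>f (g x) - f (g y)\<bar> \<le> L * dist x y" for x y
            using L(2)[of "g x" "g y"] mult_left_mono[OF g(1)[of x y] L(1)] by linarith
        qed (use f in \<open>auto simp: lip1_def\<close>)
      qed
      from skorohod_conv_lip1[OF s'(2) this]
      have "(\<lambda>n. LINT z|\<gamma> (s' n). f (g z)) \<longlonglongrightarrow> (LINT z|\<Gamma>. f (g z))" .
      moreover have "(LINT z|\<gamma> n. f (g z)) = (LINT x|curve (r n) u. f x)" for n
        unfolding \<gamma>_def curve_def using measurable_compose[OF gm fm] fm by (simp add: integral_law gY)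
      moreover have "(LINT z|\<Gamma>. f (g z)) = (LINT x|distr \<Gamma> borel g. f x)"
        by (intro integral_distr[symmetric] g\<Gamma> fm)
      ultimately have "(\<lambda>n. LINT x|curve (r (s' n)) u. f x) \<longlonglongrightarrow> (LINT x|distr \<Gamma> borel g. f x)" by simp
      moreover have "(\<lambda>n. LINT x|curve (r (s' n)) u. f x) \<longlonglongrightarrow> (LINT x|\<rho> u. f x)"
        using LIMSEQ_subseq_LIMSEQ[OF \<rho>_lip1[OF f, of u] s'(1)] by (simp add: o_def)
      ultimately show "(LINT x|distr \<Gamma> borel g. f x) = (LINT x|\<rho> u. f x)" by (rule LIMSEQ_unique)
    qed
  qed
  have "\<Gamma> \<in> couplings (\<rho> s) (\<rho> t)"
    unfolding couplings_def using s'(3)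
    by (auto simp: moment_le_def intro!: marginal dist_fst_le dist_snd_le norm_fst_le norm_snd_le simp: Y_def)
  moreover have "(\<integral>\<^sup>+ z. ennreal ((dist (fst z) (snd z))\<^sup>2) \<partial>\<Gamma>) \<le> ennreal (\<bar>\<Lambda> 0 t - \<Lambda> 0 s\<bar>\<^sup>2)"
  proof (rule skorohod_conv_nn_integral_le[OF s'(2)])
    show "continuous_on UNIV (\<lambda>z::'a \<times> 'a. (dist (fst z) (snd z))\<^sup>2)" by (intro continuous_intros)
    have d: "(\<lambda>n. travel c (r (s' n)) u) \<longlonglongrightarrow> \<Lambda> c u" for c u
      using LIMSEQ_subseq_LIMSEQ[OF \<Lambda> s'(1)] by (simp add: o_def)
    show "(\<lambda>n. \<bar>travel 0 (r (s' n)) t - travel 0 (r (s' n)) s\<bar>\<^sup>2) \<longlonglongrightarrow> \<bar>\<Lambda> 0 t - \<Lambda> 0 s\<bar>\<^sup>2"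
      by (intro tendsto_intros d)
    fix n
    let ?n = "r (s' n)"
    have "(\<integral>\<^sup>+ z. ennreal ((dist (fst z) (snd z))\<^sup>2) \<partial>\<gamma> (s' n)) =
        ennreal (expect (p ?n) (\<lambda>i. (dist (fst (Y (s' n) i)) (snd (Y (s' n) i)))\<^sup>2))"
      unfolding \<gamma>_def
      by (rule nn_integral_law[OF fin]) (auto intro!: borel_measurable_continuous_onI continuous_intros)
    also have "expect (p ?n) (\<lambda>i. (dist (fst (Y (s' n) i)) (snd (Y (s' n) i)))\<^sup>2) =
        (rms (p ?n) (\<lambda>i. X ?n (idx ?n t) i - X ?n (idx ?n s) i))\<^sup>2"
      unfolding rms_squared sqmean_def Y_def by (simp add: dist_norm norm_minus_commute)
    also have "ennreal \<dots> \<le> ennreal (\<bar>travel 0 ?n t - travel 0 ?n s\<bar>\<^sup>2)"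
      by (intro ennreal_leI power_mono rms_le_travel rms_nonneg)
    finally show "(\<integral>\<^sup>+ z. ennreal ((dist (fst z) (snd z))\<^sup>2) \<partial>\<gamma> (s' n)) \<le> ennreal (\<bar>travel 0 ?n t - travel 0 ?n s\<bar>\<^sup>2)" .
  qed
  ultimately show ?thesis by (intro W2_le_of_coupling) auto
qed

section \<open>Absolute continuity of the limiting length\<close>

lemma \<Lambda>_mono: "mono (\<Lambda> c)"
  by (intro monoI LIMSEQ_le[OF \<Lambda> \<Lambda>]) (auto intro: travel_mono)

lemma \<Lambda>_Holder: "\<bar>\<Lambda> c t - \<Lambda> c s\<bar> \<le> sqrt S * sqrt \<bar>t - s\<bar>"
proof (rule LIMSEQ_le)
  show "(\<lambda>n. \<bar>travel c (r n) t - travel c (r n) s\<bar>) \<longlonglongrightarrow> \<bar>\<Lambda> c t - \<Lambda> c s\<bar>"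
    by (intro tendsto_intros \<Lambda>)
  have "(\<lambda>n. sqrt S * sqrt (\<bar>t - s\<bar> + mesh (r n))) \<longlonglongrightarrow> sqrt S * sqrt (\<bar>t - s\<bar> + 0)"
    by (intro tendsto_intros mesh_r)
  then show "(\<lambda>n. sqrt S * sqrt (\<bar>t - s\<bar> + mesh (r n))) \<longlonglongrightarrow> sqrt S * sqrt \<bar>t - s\<bar>" by simp
qed (auto intro: travel_equicontinuous)

lemma \<Lambda>_cont: "continuous_on UNIV (\<Lambda> c)"
  unfolding continuous_on_eq_continuous_at[OF open_UNIV] isCont_def
proof
  fix t
  have "((\<lambda>s. sqrt S * sqrt \<bar>s - t\<bar>) \<longlongrightarrow> sqrt S * sqrt \<bar>t - t\<bar>) (at t)"
    by (intro tendsto_intros)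
  then have lim: "((\<lambda>s. sqrt S * sqrt \<bar>s - t\<bar>) \<longlongrightarrow> 0) (at t)" by simp
  show "\<Lambda> c \<midarrow>t\<rightarrow> \<Lambda> c t"
    by (rule LIM_zero_cancel, rule Lim_null_comparison[OF _ lim]) (simp add: \<Lambda>_Holder)
qed

text \<open>Every counted jump has length at most c times the mesh, and the number of jumps times
  the mesh is at most t - s plus one mesh, which disappears in the limit.\<close>

lemma \<Lambda>_slow_Lipschitz:
  assumes "c > 0" "s \<le> t"
  shows "\<Lambda> c t - \<Lambda> c s \<le> real c * (t - s)"
proof (rule LIMSEQ_le)
  show "(\<lambda>n. travel c (r n) t - travel c (r n) s) \<longlonglongrightarrow> \<Lambda> c t - \<Lambda> c s"
    by (intro tendsto_intros \<Lambda>)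
  have "(\<lambda>n. real c * ((t - s) + mesh (r n))) \<longlonglongrightarrow> real c * ((t - s) + 0)"
    by (intro tendsto_intros mesh_r)
  then show "(\<lambda>n. real c * ((t - s) + mesh (r n))) \<longlonglongrightarrow> real c * (t - s)" by simp
  have "travel c n t - travel c n s \<le> real c * ((t - s) + mesh n)" for n
  proof -
    have "travel c n t - travel c n s \<le> (\<Sum>j\<in>{idx n s..<idx n t}. real c * mesh n)"
      unfolding travel_diff[OF assms(2)] using mesh_pos[of n] assms(1)
      by (intro sum_mono) (auto simp: jump_def)
    also have "\<dots> = real c * ((real (idx n t) - real (idx n s)) * mesh n)"
      using idx_mono[OF assms(2), of n] by (simp add: of_nat_diff)
    also have "\<dots> \<le> real c * ((t - s) + mesh n)"
      by (intro mult_left_mono idx_diff_le assms) auto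
    finally show ?thesis .
  qed
  then show "\<exists>N. \<forall>n\<ge>N. travel c (r n) t - travel c (r n) s \<le> real c * ((t - s) + mesh (r n))" by blast
qed

text \<open>A Chebyshev estimate: a jump longer than c times the mesh is at most its square divided
  by that threshold. The action bound has a factor of the mesh, which cancels, so the total does not
  depend on n.\<close>

lemma \<Lambda>_fast_small:
  assumes "s \<le> t"
  shows "0 \<le> (\<Lambda> 0 t - \<Lambda> c t) - (\<Lambda> 0 s - \<Lambda> c s)"
    and "c > 0 \<Longrightarrow> (\<Lambda> 0 t - \<Lambda> c t) - (\<Lambda> 0 s - \<Lambda> c s) \<le> S / real c"
proof -
  have lim: "(\<lambda>n. (travel 0 (r n) t - travel c (r n) t) - (travel 0 (r n) s - travel c (r n) s)) \<longlonglongrightarrow>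
      (\<Lambda> 0 t - \<Lambda> c t) - (\<Lambda> 0 s - \<Lambda> c s)"
    by (intro tendsto_intros \<Lambda>)
  have eq: "(travel 0 n t - travel c n t) - (travel 0 n s - travel c n s) =
      (\<Sum>j\<in>{idx n s..<idx n t}. inc n j - jump c n j)" for n
    using travel_diff[OF assms, of 0 n] travel_diff[OF assms, of c n] by (simp add: jump_def sum_subtractf)
  show "0 \<le> (\<Lambda> 0 t - \<Lambda> c t) - (\<Lambda> 0 s - \<Lambda> c s)"
    by (rule LIMSEQ_le_const[OF lim]) (use jump_bounds(2) in \<open>auto simp: eq intro!: sum_nonneg\<close>)
  assume c: "c > 0"
  have "(\<Sum>j\<in>{idx n s..<idx n t}. inc n j - jump c n j) \<le> S / real c" for n
  proof -
    have "(\<Sum>j\<in>{idx n s..<idx n t}. inc n j - jump c n j) \<le> (\<Sum>j\<in>{idx n s..<idx n t}. (inc n j)\<^sup>2 / (real c * mesh n))"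
    proof (rule sum_mono)
      fix j
      show "inc n j - jump c n j \<le> (inc n j)\<^sup>2 / (real c * mesh n)"
      proof (cases "inc n j \<le> real c * mesh n")
        case True
        then show ?thesis using c mesh_pos[of n] by (simp add: jump_def)
      next
        case False
        then have "inc n j * (real c * mesh n) \<le> inc n j * inc n j"
          using inc_nonneg by (intro mult_left_mono) auto
        then show ?thesis using False c mesh_pos[of n] by (simp add: jump_def le_divide_eq power2_eq_square)
      qed
    qed
    also have "\<dots> = (\<Sum>j\<in>{idx n s..<idx n t}. (inc n j)\<^sup>2) / (real c * mesh n)"
      by (simp add: sum_divide_distrib)
    also have "\<dots> \<le> (mesh n * S) / (real c * mesh n)"
      using mesh_pos[of n] by (intro divide_right_mono sum_inc_squared_Ico idx_le) auto
    also have "\<dots> = S / real c" using mesh_pos[of n] by simp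
    finally show ?thesis .
  qed
  then show "(\<Lambda> 0 t - \<Lambda> c t) - (\<Lambda> 0 s - \<Lambda> c s) \<le> S / real c"
    by (intro LIMSEQ_le_const2[OF lim]) (auto simp: eq)
qed

text \<open>For given e the Lipschitz part is \<open>\<Lambda> c\<close> with c > S/e: the jumps
  left out have total length at most e in the limit.\<close>

lemma \<Lambda>_density: "\<exists>g. integrable lborel g \<and> (\<forall>s t. s \<le> t \<longrightarrow> \<Lambda> 0 t - \<Lambda> 0 s = (LBINT r:{s..t}. g r))"
proof (rule absolutely_continuous_density[OF \<Lambda>_mono \<Lambda>_cont])
  show "0 \<le> \<Lambda> 0 t \<and> \<Lambda> 0 t \<le> sqrt S * sqrt (T + 1)" for t
    using travel_bounds by (auto intro: LIMSEQ_le_const[OF \<Lambda>] LIMSEQ_le_const2[OF \<Lambda>])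
  fix e :: real assume e: "e > 0"
  obtain c :: nat where c: "S / e < real c" using reals_Archimedean2 by blast
  have c0: "c > 0" using c e S_pos by (cases c) (auto simp: divide_less_0_iff not_less)
  then have Sc: "S / real c \<le> e" using c e by (simp add: field_simps)
  show "\<exists>L K. mono L \<and> continuous_on UNIV L \<and> mono (\<lambda>t. \<Lambda> 0 t - L t) \<and>
      mono (\<lambda>t. K * t - L t) \<and> K \<ge> 0 \<and> (\<forall>s t. s \<le> t \<longrightarrow> (\<Lambda> 0 t - L t) - (\<Lambda> 0 s - L s) \<le> e)"
  proof (intro exI[of _ "\<Lambda> c"] exI[of _ "real c"] conjI allI impI \<Lambda>_mono \<Lambda>_cont monoI)
    show "\<Lambda> 0 s - \<Lambda> c s \<le> \<Lambda> 0 t - \<Lambda> c t" if "s \<le> t" for s t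
      using \<Lambda>_fast_small(1)[OF that, of c] by simp
    show "real c * s - \<Lambda> c s \<le> real c * t - \<Lambda> c t" if "s \<le> t" for s t
      using \<Lambda>_slow_Lipschitz[OF c0 that] by (simp add: algebra_simps)
    show "\<Lambda> 0 t - \<Lambda> c t - (\<Lambda> 0 s - \<Lambda> c s) \<le> e" if "s \<le> t" for s t
      using \<Lambda>_fast_small(2)[OF that c0] Sc by linarith
  qed simp
qed

lemma \<rho>_P2: "\<rho> t \<in> P2"
  using \<rho>[of t] by (auto simp: P2_def moment_le_def intro: le_less_trans)

lemma limit_W2_continuous: "W2_continuous_on {0..T} \<rho>"
  unfolding W2_continuous_on_def
proof (intro conjI ballI \<rho>_P2)
  fix t
  have "continuous_on {0..T} (\<Lambda> 0)" using \<Lambda>_cont by (rule continuous_on_subset) auto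
  moreover assume "t \<in> {0..T}"
  ultimately have "(\<Lambda> 0 \<longlongrightarrow> \<Lambda> 0 t) (at t within {0..T})" by (simp add: continuous_on)
  then have "((\<lambda>s. \<bar>\<Lambda> 0 t - \<Lambda> 0 s\<bar>) \<longlongrightarrow> \<bar>\<Lambda> 0 t - \<Lambda> 0 t\<bar>) (at t within {0..T})"
    by (intro tendsto_rabs tendsto_diff tendsto_const)
  then have lim: "((\<lambda>s. \<bar>\<Lambda> 0 t - \<Lambda> 0 s\<bar>) \<longlongrightarrow> 0) (at t within {0..T})" by simp
  show "((\<lambda>s. W2 (\<rho> s) (\<rho> t)) \<longlongrightarrow> 0) (at t within {0..T})"
  proof (rule Lim_null_comparison[OF _ lim])
    have "0 \<le> W2 (\<rho> s) (\<rho> t)" for s by (simp add: W2_def)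
    then show "\<forall>\<^sub>F s in at t within {0..T}. norm (W2 (\<rho> s) (\<rho> t)) \<le> \<bar>\<Lambda> 0 t - \<Lambda> 0 s\<bar>"
      using W2_le_travel by simp
  qed
qed

lemma limit_W2_absolutely_continuous: "W2_absolutely_continuous T \<rho>"
proof -
  obtain g where g: "integrable lborel g" "\<And>s t. s \<le> t \<Longrightarrow> \<Lambda> 0 t - \<Lambda> 0 s = (LBINT r:{s..t}. g r)"
    using \<Lambda>_density by blast
  show ?thesis
    unfolding W2_absolutely_continuous_def
  proof (intro conjI ballI \<rho>_P2 exI[of _ g] allI impI)
    show "set_integrable lborel {0..T} g"
      unfolding set_integrable_def using g(1) by (intro integrable_mult_indicator) auto
    fix s t assume "0 \<le> s \<and> s \<le> t \<and> t \<le> T"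
    then have "s \<le> t" by simp
    then show "W2 (\<rho> s) (\<rho> t) \<le> (LBINT r:{s..t}. g r)"
      using W2_le_travel[of s t] g(2)[of s t] monoD[OF \<Lambda>_mono, of s t 0] by linarith
  qed
qed

text \<open>The order of limits matters: the Taylor constant C depends on \<open>\<eta>\<close>. For
  fixed \<open>\<eta>\<close> the terms with the mesh vanish as n grows and leave
  \<open>\<eta> * P\<close>, where P is a bound on the total length independent of
  \<open>\<eta>\<close>; afterwards \<open>\<eta>\<close> is made small.\<close>

lemma limit_equation:
  assumes \<phi>: "\<phi> \<in> C1c"
  defines "J s \<equiv> LINT x|\<rho> s. grad \<phi> x \<bullet> field (\<rho> s) x"
  shows "set_integrable lborel {0..T} J"
    and "t \<in> {0..T} \<Longrightarrow> (LINT x|\<rho> t. \<phi> x) - (LINT x|\<rho>0. \<phi> x) = \<kappa> * (LBINT s:{0..t}. J s)"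
proof -
  obtain B where B: "B > 0" "\<And>\<mu> x. \<mu> \<in> moment_le S \<Longrightarrow> \<bar>grad \<phi> x \<bullet> field \<mu> x\<bar> \<le> B"
    using field_test_bounded[OF \<phi>] by metis
  obtain R where R: "\<And>x. norm x > R \<Longrightarrow> \<phi> x = 0" and \<phi>_cont: "continuous_on UNIV \<phi>"
    using C1c_E[OF \<phi>] by metis
  obtain G where G: "\<And>x. \<bar>\<phi> x\<bar> \<le> G"
    using compact_support_bounded[OF \<phi>_cont R] by metis
  \<comment> \<open>The time is rounded without the cut-off at T contained in \<open>idx\<close>,
    the form to which the step function estimate applies. The two agree up to time T.\<close>
  define g where "g n s = rate \<phi> (r n) (nat \<lceil>s / mesh (r n)\<rceil>)" for n s
  have g_idx: "g n s = rate \<phi> (r n) (idx (r n) s)" if "s \<le> T" for n s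
    using that by (simp add: g_def idx_def min_def)
  have g_le: "\<bar>g n s\<bar> \<le> B" if "s \<le> T" for n s
    unfolding g_idx[OF that] by (rule rate_bound[OF B(2) \<phi> idx_le])
  have g_lim: "(\<lambda>n. g n s) \<longlonglongrightarrow> J s" if "s \<le> T" for s
    using test_field_tendsto[OF \<phi>, of s] unfolding g_idx[OF that] J_def rate_def curve_def .
  have g_meas [measurable]: "g n \<in> borel_measurable borel" for n
  proof -
    have "(\<lambda>s. nat \<lceil>s / mesh (r n)\<rceil>) \<in> measurable borel (count_space UNIV)" by measurable
    from measurable_compose[OF this, of "rate \<phi> (r n)" borel] show ?thesis by (simp add: g_def[abs_def])
  qed
  have lim: "(\<lambda>n. LBINT s:{0..t}. g n s) \<longlonglongrightarrow> (LBINT s:{0..t}. J s)" and int: "set_integrable lborel {0..t} J"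
    if t: "t \<le> T" for t
  proof -
    have pw: "(\<lambda>n. indicat_real {0..t} s *\<^sub>R g n s) \<longlonglongrightarrow> indicat_real {0..t} s *\<^sub>R J s" for s
      using g_lim[of s] t by (auto split: split_indicator)
    have Jm: "(\<lambda>s. indicat_real {0..t} s *\<^sub>R J s) \<in> borel_measurable lborel"
      by (rule borel_measurable_LIMSEQ_real[OF pw]) auto
    have iB: "integrable lborel (\<lambda>s. indicat_real {0..t} s *\<^sub>R B)"
      by (intro integrable_scaleR_left integrable_real_indicator) (simp_all add: emeasure_lborel_Icc_eq)
    have gB: "norm (indicat_real {0..t} s *\<^sub>R g n s) \<le> indicat_real {0..t} s *\<^sub>R B" for n s
      using g_le[of s n] t by (cases "s \<in> {0..t}") auto
    have gm: "(\<lambda>s. indicat_real {0..t} s *\<^sub>R g n s) \<in> borel_measurable lborel" for n by measurable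
    note dct = AE_I2[of lborel, OF pw] AE_I2[of lborel, OF gB]
    show "(\<lambda>n. LBINT s:{0..t}. g n s) \<longlonglongrightarrow> (LBINT s:{0..t}. J s)"
      unfolding set_lebesgue_integral_def by (rule integral_dominated_convergence[OF Jm gm iB dct])
    show "set_integrable lborel {0..t} J"
      unfolding set_integrable_def by (rule integrable_dominated_convergence[OF Jm gm iB dct])
  qed
  show "set_integrable lborel {0..T} J" by (rule int) simp
  assume t: "t \<in> {0..T}"
  define P where "P = sqrt S * sqrt (T + 1)"
  define D where "D = (LINT x|\<rho> t. \<phi> x) - (LINT x|\<rho>0. \<phi> x) - \<kappa> * (LBINT s:{0..t}. J s)"
  have "\<bar>D\<bar> \<le> \<eta> * P" if \<eta>: "\<eta> > 0" for \<eta>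
  proof -
    obtain C where C: "C \<ge> 0" and Taylor: "\<And>a b. \<bar>\<phi> b - \<phi> a - grad \<phi> b \<bullet> (b - a)\<bar> \<le> \<eta> * norm (b - a) + C * (norm (b - a))\<^sup>2"
      using C1c_Taylor[OF \<phi> \<eta>] by metis
    have \<phi>m: "\<phi> \<in> borel_measurable borel" using \<phi>_cont by (rule borel_measurable_continuous_onI)
    have l: "(\<lambda>n. (LINT x|curve (r n) t. \<phi> x) - expect (p (r n)) \<phi> - \<kappa> * (LBINT s:{0..t}. g n s)) \<longlonglongrightarrow> D"
      unfolding D_def using LIMSEQ_subseq_LIMSEQ[OF p_conv[OF \<phi>_cont G] r] t
      by (intro tendsto_intros bounded_continuous_tendsto[OF \<phi>_cont G] lim) (auto simp: o_def)
    have "\<bar>(LINT x|curve (r n) t. \<phi> x) - expect (p (r n)) \<phi> - \<kappa> * (LBINT s:{0..t}. g n s)\<bar> \<le>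
        \<eta> * P + C * (mesh (r n) * S) + \<kappa> * (mesh (r n) * B)" for n
    proof -
      let ?n = "r n" and ?k = "idx (r n) t"
      have k: "?k = nat \<lceil>t / mesh ?n\<rceil>" using t by (simp add: idx_def min_absorb2)
      have "\<bar>expect (p ?n) (\<lambda>i. \<phi> (X ?n ?k i)) - expect (p ?n) \<phi> - \<kappa> * (\<Sum>j<?k. mesh ?n * rate \<phi> ?n (Suc j))\<bar> \<le>
          \<eta> * (\<Sum>j<?k. inc ?n j) + C * (\<Sum>j<?k. (inc ?n j)\<^sup>2)"
        using \<eta> by (intro discrete_equation \<phi> idx_le Taylor) auto
      also have "\<dots> \<le> \<eta> * P + C * (mesh ?n * S)"
      proof (intro add_mono mult_left_mono sum_inc_squared idx_le C)
        show "(\<Sum>j<?k. inc ?n j) \<le> P"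
          using travel_bounds(2)[of 0 ?n t] by (simp add: travel_def jump_def P_def)
      qed (use \<eta> in auto)
      finally have 1: "\<bar>expect (p ?n) (\<lambda>i. \<phi> (X ?n ?k i)) - expect (p ?n) \<phi> - \<kappa> * (\<Sum>j<?k. mesh ?n * rate \<phi> ?n (Suc j))\<bar> \<le> \<eta> * P + C * (mesh ?n * S)" .
      have "\<bar>(\<Sum>j<?k. mesh ?n * rate \<phi> ?n (Suc j)) - (LBINT s:{0..t}. g n s)\<bar> \<le> mesh ?n * B"
        unfolding k g_def
      proof (rule integral_step_function_error[OF mesh_pos])
        fix j assume "j \<le> nat \<lceil>t / mesh ?n\<rceil>"
        then have "real j * mesh ?n \<le> real ?k * mesh ?n"
          unfolding k using mesh_pos[of ?n] by (intro mult_right_mono) auto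
        then show "\<bar>rate \<phi> ?n j\<bar> \<le> B"
          using idx_le[of ?n t] by (intro rate_bound[OF B(2) \<phi>]) auto
      qed (use t in auto)
      then have "\<kappa> * \<bar>(\<Sum>j<?k. mesh ?n * rate \<phi> ?n (Suc j)) - (LBINT s:{0..t}. g n s)\<bar> \<le> \<kappa> * (mesh ?n * B)"
        using \<kappa>_pos by (intro mult_left_mono) auto
      then have 2: "\<bar>\<kappa> * (\<Sum>j<?k. mesh ?n * rate \<phi> ?n (Suc j)) - \<kappa> * (LBINT s:{0..t}. g n s)\<bar> \<le> \<kappa> * (mesh ?n * B)"
        using \<kappa>_pos by (simp add: abs_mult right_diff_distrib[symmetric])
      have "(LINT x|curve ?n t. \<phi> x) = expect (p ?n) (\<lambda>i. \<phi> (X ?n ?k i))"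
        unfolding curve_def by (rule integral_law[OF \<phi>m])
      then show ?thesis using 1 2 by linarith
    qed note bound = this
    have "(\<lambda>n. \<eta> * P + C * (mesh (r n) * S) + \<kappa> * (mesh (r n) * B)) \<longlonglongrightarrow> \<eta> * P + C * (0 * S) + \<kappa> * (0 * B)"
      by (intro tendsto_intros mesh_r)
    then have "\<bar>D\<bar> \<le> \<eta> * P + C * (0 * S) + \<kappa> * (0 * B)"
      using bound by (intro LIMSEQ_le[OF tendsto_rabs[OF l]]) auto
    then show ?thesis by simp
  qed note small = this
  have "D = 0"
  proof (rule ccontr)
    assume "D \<noteq> 0"
    have P: "P \<ge> 0" using S_pos T by (simp add: P_def)
    \<comment> \<open>This choice of \<open>\<eta>\<close> makes the right-hand side smaller than
      half of |D|.\<close>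
    then have "\<bar>D\<bar> \<le> (\<bar>D\<bar> / (2 * (P + 1))) * P" using \<open>D \<noteq> 0\<close> by (intro small) auto
    also have "\<dots> < \<bar>D\<bar>"
    proof -
      have "0 < P * \<bar>D\<bar> + \<bar>D\<bar> * 2" using P \<open>D \<noteq> 0\<close> by (intro add_nonneg_pos) auto
      then show ?thesis using P by (simp add: field_simps)
    qed
    finally show False by simp
  qed
  then show "(LINT x|\<rho> t. \<phi> x) - (LINT x|\<rho>0. \<phi> x) = \<kappa> * (LBINT s:{0..t}. J s)" by (simp add: D_def)
qed

lemma limit_distributional_solution: "distributional_solution T m V \<rho>0 \<rho>"
  unfolding distributional_solution_def
proof (intro conjI ballI allI)
  show "integrable lborel (\<lambda>y. conv_measure V (\<rho> s) y powr (m - 1) *\<^sub>R grad V (x - y))" for s x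
    unfolding grad_V by (rule integrable_field[OF \<rho> S_pos])
  fix \<phi> :: "'a \<Rightarrow> real" assume \<phi>: "\<phi> \<in> C1c"
  show "integrable (\<rho> s) (\<lambda>x. grad \<phi> x \<bullet> field (\<rho> s) x)" for s
  proof -
    obtain B where B: "\<And>\<mu> x. \<mu> \<in> moment_le S \<Longrightarrow> \<bar>grad \<phi> x \<bullet> field \<mu> x\<bar> \<le> B"
      using field_test_bounded[OF \<phi>] by metis
    interpret prob_space "\<rho> s" using \<rho>[of s] by (simp add: moment_le_def)
    show ?thesis
      by (rule integrable_const_bound[of _ B])
        (use B[OF \<rho>] in \<open>auto intro: moment_le_measurable[OF \<rho>] measurable_test_field \<phi> \<rho>\<close>)
  qed
  show "set_integrable lborel {0..T} (\<lambda>s. LINT x|\<rho> s. grad \<phi> x \<bullet> field (\<rho> s) x)"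
    by (rule limit_equation(1)[OF \<phi>])
  show "(LINT x|\<rho> t. \<phi> x) - (LINT x|\<rho>0. \<phi> x) = m / (1 - m) * (LBINT s:{0..t}. (LINT x|\<rho> s. grad \<phi> x \<bullet> field (\<rho> s) x))"
    if "t \<in> {0..T}" for t
    using limit_equation(2)[OF \<phi> that] by (simp add: \<kappa>_def)
qed

end

theorem solution_exists:
  "\<exists>\<rho>. W2_continuous_on {0..T} \<rho> \<and> W2_absolutely_continuous T \<rho> \<and> \<rho> 0 = \<rho>0 \<and>
    distributional_solution T m V \<rho>0 \<rho>"
proof -
  obtain r \<Lambda> \<rho> where *: "strict_mono r" "\<And>c t. (\<lambda>n. travel c (r n) t) \<longlonglongrightarrow> \<Lambda> c t" "\<And>t. \<rho> t \<in> moment_le S"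
    "\<And>t f. lip1 f \<Longrightarrow> (\<lambda>n. LINT x|curve (r n) t. f x) \<longlonglongrightarrow> (LINT x|\<rho> t. f x)"
    using convergent_curves by metis
  show ?thesis
    using limit_W2_continuous[OF *] limit_W2_absolutely_continuous[OF *] initial[OF *]
      limit_distributional_solution[OF *] by blast
qed

end

context kernel
begin

theorem solution_exists:
  assumes T: "T > 0" and \<rho>0: "\<rho>0 \<in> P2"
  shows "\<exists>\<rho>. W2_continuous_on {0..T} \<rho> \<and> W2_absolutely_continuous T \<rho> \<and> \<rho> 0 = \<rho>0 \<and>
    distributional_solution T m V \<rho>0 \<rho>"
proof -
  define M where "M = enn2real (\<integral>\<^sup>+ x. ennreal ((norm x)\<^sup>2) \<partial>\<rho>0)"
  have M: "M \<ge> 0" "\<rho>0 \<in> moment_le M"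
    using \<rho>0 by (auto simp: M_def P2_def moment_le_def ennreal_enn2real_if less_top[symmetric] top_unique)
  obtain p :: "nat \<Rightarrow> 'a pmf" where p: "\<And>n. finite (set_pmf (p n))" "\<And>n. sqmean (p n) (\<lambda>x. x) \<le> 4 * M"
    "\<And>f B. continuous_on UNIV f \<Longrightarrow> (\<And>x. \<bar>f x\<bar> \<le> B) \<Longrightarrow> (\<lambda>n. expect (p n) f) \<longlonglongrightarrow> (LINT x|\<rho>0. f x)"
    using finite_pmf_approximation[OF M(2,1)] by metis
  have "\<exists>X. \<forall>k. (k = 0 \<longrightarrow> X k = (\<lambda>x. x)) \<and> implicit_step (p n) (mesh n) (X k) (X (Suc k))" for n
    by (rule dependent_nat_choice) (use minimizing_step[OF p(1)[of n] mesh_pos[of n]] in auto)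
  then obtain X where X: "\<And>n. X n 0 = (\<lambda>x. x)"
    "\<And>n k. implicit_step (p n) (mesh n) (X n k) (X n (Suc k))"
    by metis
  have "particle_scheme V DV \<alpha> m k1 k2 T (4 * M) \<rho>0 p X"
  proof (intro particle_scheme.intro kernel_axioms particle_scheme_axioms.intro)
    show "T > 0" "4 * M \<ge> 0" using T M(1) by auto
    show "\<rho>0 \<in> moment_le (4 * M)" using M by (intro moment_le_mono[OF M(2)]) auto
    show "finite (set_pmf (p n))" "sqmean (p n) (\<lambda>x. x) \<le> 4 * M" for n by (fact p(1) p(2))+
    show "(\<lambda>n. expect (p n) f) \<longlonglongrightarrow> (LINT x|\<rho>0. f x)"
      if "continuous_on UNIV f" "\<And>x. \<bar>f x\<bar> \<le> B" for f and B :: real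
      using that by (rule p(3))
    show "X n 0 = (\<lambda>x. x)" "implicit_step (p n) (mesh n) (X n k) (X n (Suc k))" for n k by (fact X)+
  qed
  then show ?thesis by (rule particle_scheme.solution_exists)
qed

end

section \<open>The bracket kernel\<close>

text \<open>A divergent integral would be 0 by convention, and so would its reciprocal; hence
  integrability comes before positivity.\<close>

lemma kernel_const_pos:
  assumes "\<alpha> > real DIM('a::euclidean_space) / 2"
  shows "kernel_const TYPE('a) \<alpha> > 0"
proof -
  let ?I = "LBINT x::'a. wt x powr - \<alpha>"
  have int: "integrable lborel (\<lambda>x::'a. wt x powr - \<alpha>)"
    by (rule integrable_wt_powr[OF assms])
  have "?I \<noteq> 0"
  proof
    assume "?I = 0"
    then have "AE x::'a in lborel. wt x powr - \<alpha> = 0"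
      by (subst (asm) integral_nonneg_eq_0_iff_AE[OF int]) auto
    then have "AE x::'a in lborel. False" by eventually_elim simp
    then obtain N where "space lborel \<subseteq> N" "emeasure lborel N = 0" "N \<in> sets (lborel :: 'a measure)"
      by (rule AE_E) auto
    then have "emeasure lborel (UNIV :: 'a set) = 0" by (simp add: top.extremum_unique)
    then show False by simp
  qed
  moreover have "?I \<ge> 0" by (intro Bochner_Integration.integral_nonneg) auto
  ultimately have "?I > 0" by linarith
  then show ?thesis by (simp add: kernel_const_def wt_def)
qed

lemma bracket_powr: "bracket x powr (- 2 * \<alpha>) = wt x powr - \<alpha>"
proof -
  have "bracket x = wt x powr (1 / 2)" by (simp add: bracket_def wt_def powr_half_sqrt)
  then show ?thesis by (simp add: powr_powr)
qed

lemma wt_scaleR_bounds: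
  fixes x :: "'a::euclidean_space"
  assumes "\<epsilon> > 0"
  shows "min 1 (1 / \<epsilon>\<^sup>2) * wt x \<le> wt (x /\<^sub>R \<epsilon>)" "wt (x /\<^sub>R \<epsilon>) \<le> max 1 (1 / \<epsilon>\<^sup>2) * wt x"
proof -
  have eq: "wt (x /\<^sub>R \<epsilon>) = 1 * 1 + (1 / \<epsilon>\<^sup>2) * (norm x)\<^sup>2"
    using assms by (simp add: wt_def power_divide divide_inverse power_mult_distrib power_inverse mult.commute)
  have "min 1 (1 / \<epsilon>\<^sup>2) * 1 + min 1 (1 / \<epsilon>\<^sup>2) * (norm x)\<^sup>2 \<le> wt (x /\<^sub>R \<epsilon>)"
    unfolding eq by (intro add_mono mult_right_mono) auto
  then show "min 1 (1 / \<epsilon>\<^sup>2) * wt x \<le> wt (x /\<^sub>R \<epsilon>)" by (simp add: wt_def distrib_left)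
  have "wt (x /\<^sub>R \<epsilon>) \<le> max 1 (1 / \<epsilon>\<^sup>2) * 1 + max 1 (1 / \<epsilon>\<^sup>2) * (norm x)\<^sup>2"
    unfolding eq by (intro add_mono mult_right_mono) auto
  then show "wt (x /\<^sub>R \<epsilon>) \<le> max 1 (1 / \<epsilon>\<^sup>2) * wt x" by (simp add: wt_def distrib_left)
qed

text \<open>The condition m > d/(d+2) says d(1 - m) < 2m, which is \<open>m_dim\<close>. As 2m < 2,
  it also gives d/2 < dm/2 + 1, and the right side is less than \<open>\<alpha> * m\<close> by the
  assumption on \<open>\<alpha>\<close>; 1/m > 1 gives \<open>\<alpha>1\<close>. Rescaling changes
  the weight only by factors depending on \<open>\<epsilon>\<close>, which enter \<open>k1\<close>
  and \<open>k2\<close>.\<close>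

lemma kernel_rescale_bracket:
  assumes \<epsilon>: "\<epsilon> > 0" and mdim: "real DIM('a::euclidean_space) / (real DIM('a) + 2) < m" and m1: "m < 1"
    and \<alpha>: "\<alpha> > real DIM('a) / 2 + 1 / m"
  shows "\<exists>DV k1 k2. kernel (rescale \<epsilon> (bracket_kernel \<alpha>) :: 'a \<Rightarrow> real) DV \<alpha> m k1 k2"
proof -
  let ?d = "real DIM('a)"
  have d: "?d \<ge> 0" by simp
  have m0: "m > 0" using mdim d by (smt (verit) divide_nonneg_pos)
  have md: "2 * m > ?d * (1 - m)"
  proof -
    have "?d < m * (?d + 2)" using mdim d by (simp add: pos_divide_less_eq)
    then show ?thesis by (simp add: algebra_simps)
  qed
  have "1 / m > 1" using m0 m1 by simp
  then have \<alpha>1: "\<alpha> - 1 > ?d / 2" using \<alpha> by linarith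
  have "(?d / 2 + 1 / m) * m < \<alpha> * m" using \<alpha> m0 by (intro mult_strict_right_mono)
  then have "?d / 2 * m + 1 < \<alpha> * m" using m0 by (simp add: distrib_right)
  moreover have "?d / 2 \<le> ?d / 2 * m + 1" using md m1 by (simp add: algebra_simps)
  ultimately have \<alpha>m: "\<alpha> * m > ?d / 2" by linarith
  have \<alpha>0: "\<alpha> > 0" using \<alpha>1 d by (smt (verit) divide_nonneg_pos)
  define A where "A = (1 / \<epsilon> ^ DIM('a)) * kernel_const TYPE('a) \<alpha>"
  have A: "A > 0" unfolding A_def using \<epsilon> \<alpha>1 by (intro mult_pos_pos kernel_const_pos) auto
  let ?V = "rescale \<epsilon> (bracket_kernel \<alpha>) :: 'a \<Rightarrow> real"
  have V: "?V x = A * wt (x /\<^sub>R \<epsilon>) powr - \<alpha>" for x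
    unfolding rescale_def bracket_kernel_def bracket_powr A_def by simp
  define c where "c = 1 / \<epsilon>\<^sup>2"
  have c: "c > 0" "c * \<epsilon> = 1 / \<epsilon>" using \<epsilon> by (simp_all add: c_def power2_eq_square)
  have wt_eq: "wt (z /\<^sub>R \<epsilon>) = 1 + c * (z \<bullet> z)" for z :: 'a
    using \<epsilon> by (simp add: c_def wt_def power_mult_distrib power_inverse divide_inverse flip: power2_norm_eq_inner)
  define DV where "DV x = - (2 * \<alpha> * A * c * wt (x /\<^sub>R \<epsilon>) powr (- \<alpha> - 1)) *\<^sub>R x" for x :: 'a
  define a where "a = min 1 (1 / \<epsilon>\<^sup>2)"
  define b where "b = max 1 (1 / \<epsilon>\<^sup>2)"
  have a: "a > 0" using \<epsilon> by (simp add: a_def)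
  have b: "b > 0" by (simp add: b_def)
  define k1 where "k1 = A * b powr - \<alpha>"
  \<comment> \<open>One constant for the kernel and its gradient: the factor
    \<open>2 * \<alpha> / \<epsilon>\<close> comes from the chain rule, after
    |x|/\<open>\<epsilon>\<close> has been bounded by the weight at the rescaled point.\<close>
  define k2 where "k2 = max 1 (2 * \<alpha> / \<epsilon>) * (A * a powr - \<alpha>)"
  have upper: "A * wt (x /\<^sub>R \<epsilon>) powr - \<alpha> \<le> A * a powr - \<alpha> * wt x powr - \<alpha>" for x :: 'a
  proof -
    have "wt (x /\<^sub>R \<epsilon>) powr - \<alpha> \<le> (a * wt x) powr - \<alpha>"
      using wt_scaleR_bounds(1)[OF \<epsilon>, of x] \<alpha>0 a by (intro powr_mono2') (auto simp: a_def)
    then show ?thesis using A a by (simp add: powr_mult mult.assoc)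
  qed
  have "kernel ?V DV \<alpha> m k1 k2"
  proof
    show "0 < m" "m < 1" "\<alpha> * m > ?d / 2" "\<alpha> - 1 > ?d / 2" by (fact m0 m1 \<alpha>m \<alpha>1)+
    show "m / (1 - m) > ?d / 2" using md m1 by (simp add: field_simps)
    show "k1 > 0" using A b by (simp add: k1_def)
    fix x :: 'a
    have "(b * wt x) powr - \<alpha> \<le> wt (x /\<^sub>R \<epsilon>) powr - \<alpha>"
      using wt_scaleR_bounds(2)[OF \<epsilon>, of x] \<alpha>0 b by (intro powr_mono2') (auto simp: b_def)
    then show "k1 * wt x powr - \<alpha> \<le> ?V x"
      unfolding V k1_def using A b by (simp add: powr_mult mult.assoc)
    have "A * a powr - \<alpha> \<le> k2"
      unfolding k2_def using A a mult_right_mono[of 1 "max 1 (2 * \<alpha> / \<epsilon>)" "A * a powr - \<alpha>"] by simp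
    then have "A * a powr - \<alpha> * wt x powr - \<alpha> \<le> k2 * wt x powr - \<alpha>"
      by (intro mult_right_mono) auto
    then show "?V x \<le> k2 * wt x powr - \<alpha>"
      unfolding V using upper[of x] by linarith
    show "?V (- x) = ?V x" unfolding V by (simp add: wt_def)
    have "GDERIV (\<lambda>x::'a. 1 + c * (x \<bullet> x)) x :> (2 * c) *\<^sub>R x"
      unfolding gderiv_def by (auto intro!: derivative_eq_intros simp: inner_commute)
    moreover have "DERIV (\<lambda>u. A * u powr - \<alpha>) (1 + c * (x \<bullet> x)) :> A * (- \<alpha> * (1 + c * (x \<bullet> x)) powr (- \<alpha> - 1))"
    proof (intro DERIV_cmult has_real_derivative_powr)
      show "1 + c * (x \<bullet> x) > 0" using c by (intro add_pos_nonneg) auto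
    qed
    ultimately have "GDERIV (\<lambda>x::'a. A * (1 + c * (x \<bullet> x)) powr - \<alpha>) x :>
        (A * (- \<alpha> * (1 + c * (x \<bullet> x)) powr (- \<alpha> - 1))) *\<^sub>R (2 * c) *\<^sub>R x"
      by (rule GDERIV_DERIV_compose)
    then show "GDERIV ?V x :> DV x"
      unfolding V[abs_def] DV_def wt_eq by (simp add: mult_ac)
    have "norm (DV x) = 2 * \<alpha> / \<epsilon> * A * wt (x /\<^sub>R \<epsilon>) powr (- \<alpha> - 1) * norm (x /\<^sub>R \<epsilon>)"
    proof -
      have "norm (DV x) = 2 * \<alpha> * A * c * wt (x /\<^sub>R \<epsilon>) powr (- \<alpha> - 1) * norm x"
        using \<alpha>0 A c by (simp add: DV_def abs_mult)
      also have "norm x = \<epsilon> * norm (x /\<^sub>R \<epsilon>)" using \<epsilon> by simp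
      also have "2 * \<alpha> * A * c * wt (x /\<^sub>R \<epsilon>) powr (- \<alpha> - 1) * (\<epsilon> * norm (x /\<^sub>R \<epsilon>)) =
          2 * \<alpha> * (c * \<epsilon>) * A * wt (x /\<^sub>R \<epsilon>) powr (- \<alpha> - 1) * norm (x /\<^sub>R \<epsilon>)"
        by (simp only: mult_ac)
      finally show ?thesis unfolding c(2) by simp
    qed
    also have "\<dots> \<le> 2 * \<alpha> / \<epsilon> * A * wt (x /\<^sub>R \<epsilon>) powr (- \<alpha> - 1) * wt (x /\<^sub>R \<epsilon>)"
    proof (intro mult_left_mono)
      show "norm (x /\<^sub>R \<epsilon>) \<le> wt (x /\<^sub>R \<epsilon>)"
      proof -
        have "t \<le> 1 + t\<^sup>2" if "t \<ge> 0" for t :: real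
          using sum_squares_bound[of t 1] that by simp
        from this[OF norm_ge_zero] show ?thesis unfolding wt_def .
      qed
    qed (use \<epsilon> \<alpha>0 A in auto)
    also have "\<dots> = 2 * \<alpha> / \<epsilon> * (A * wt (x /\<^sub>R \<epsilon>) powr - \<alpha>)"
    proof -
      have "w powr (- \<alpha> - 1) * w = w powr - \<alpha>" if "w > 0" for w :: real
        using that by (simp add: powr_diff)
      from this[OF wt_pos[of "x /\<^sub>R \<epsilon>"]] show ?thesis by (simp only: mult.assoc)
    qed
    also have "\<dots> \<le> max 1 (2 * \<alpha> / \<epsilon>) * (A * a powr - \<alpha> * wt x powr - \<alpha>)"
      by (rule mult_mono[OF max.cobounded2 upper]) (use A in auto)
    finally show "norm (DV x) \<le> k2 * wt x powr - \<alpha>" by (simp add: k2_def mult.assoc)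
  next
    show "continuous_on UNIV DV"
      unfolding DV_def by (intro continuous_intros) auto
  qed
  then show ?thesis by blast
qed

theorem theorem6p1:
  fixes T \<epsilon> m \<alpha> :: real and \<rho>0 :: "'a::euclidean_space measure"
  assumes "T > 0" and "\<epsilon> > 0"
    and "real DIM('a) / (real DIM('a) + 2) < m" and "m < 1"
    and "\<alpha> > real DIM('a) / 2 + 1 / m"
    and "\<rho>0 \<in> P2"
    and "energy m \<rho>0 < \<infinity>"
  shows "\<exists>\<rho> :: real \<Rightarrow> 'a measure.
           W2_continuous_on {0..T} \<rho> \<and>
           W2_absolutely_continuous T \<rho> \<and>
           \<rho> 0 = \<rho>0 \<and>
           distributional_solution T m (rescale \<epsilon> (bracket_kernel \<alpha>)) \<rho>0 \<rho>"
proof -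
  obtain DV k1 k2 where "kernel (rescale \<epsilon> (bracket_kernel \<alpha>) :: 'a \<Rightarrow> real) DV \<alpha> m k1 k2"
    using kernel_rescale_bracket[OF assms(2-5)] by blast
  then show ?thesis using assms(1,6) by (rule kernel.solution_exists)
qed

end
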